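(* In the setting described in the context, let $g=\partial_a\phi$ be the Lyapunov--Schmidt reduced function and $\phi$ the reduced potential at the simple degeneracy. If $\phi$ is invariant under $a\mapsto -a$ and $$g_{a\mu}(0,0)\neq 0,\qquad g_{aaa}(0,0)\neq 0,$$ then the reduced equation $g(a,\mu)=0$ is locally equivalent to the pitchfork normal form $$a(\alpha\mu+\beta a^2)+\text{h.o.t.}=0,\qquad \alpha=g_{a\mu}(0,0),\quad \beta=\tfrac16 g_{aaa}(0,0)$$ (h.o.t. denotes higher-order terms). There is the trivial branch $a=0$ together with two symmetric nontrivial branches $$a_\pm(\mu)=\pm\sqrt{-\alpha\mu/\beta}+o(|\mu|^{1/2})$$ on the side where $-\alpha\mu/\beta>0$. If the reduced potential has expansion $$\phi(a,\mu)=\phi(0,0)+\tfrac12\alpha\mu a^2+\tfrac14\beta a^4+\text{h.o.t.}$$ with $\beta>0$, the pitchfork is supercritical: the bifurcating branches are local minima in the reduced direction, while the trivial branch changes Morse index by one.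
   Context: Let $\mathcal M$ be a finite-dimensional Riemannian manifold, $I\subset\mathbb R$ an open interval containing $[0,1]$, and $L\in C^k(\mathcal M\times I,\mathbb R)$ with $k\ge 4$. Write $F(\theta,\lambda):=\nabla_\theta L(\theta,\lambda)$. Assumption (smooth critical branch): there is a smooth map $\theta_0:I\to\mathcal M$ with $F(\theta_0(\lambda),\lambda)=0$ for all $\lambda\in I$. Assumption (simple degeneracy): there is $\lambda^*\in(0,1)$ such that at $\theta^*:=\theta_0(\lambda^* )$ the Hessian $H^*:=\nabla^2_\theta L(\theta^*,\lambda^* )$ has one-dimensional kernel $\mathcal N:=\operatorname{Ker}(H^* )=\operatorname{span}\{v_0\}$, $\|v_0\|=1$. Let $\mathcal R:=\mathcal N^\perp$, so $T_{\theta^*}\mathcal M=\mathcal N\oplus\mathcal R$ orthogonally; $P_{\mathcal N}$, $P_{\mathcal R}$ are the orthogonal projections. Straightened coordinates: put $\mu:=\lambda-\lambda^*$. Choose a local chart near $\theta^*$ and, after a smooth change of coordinates, a coordinate $u$ in which the critical branch is $u=0$ for all sufficiently small $\mu$. Let $\widetilde L(u,\mu)$ be the objective in these coordinates and $\widetilde F(u,\mu):=\nabla_u\widetilde L(u,\mu)$, so $\widetilde F(0,\mu)=0$ for all small $|\mu|$, and $\nabla_u^2\widetilde L(0,0)$ is symmetric with kernel $\mathcal N=\operatorname{span}\{v_0\}$. Write $u=av_0+w$ with $a\in\mathbb R$, $w\in\mathcal R$. Reduced function and potential: let $w^*(a,\mu)\in\mathcal R$ be the unique smooth local solution, with $w^*(0,0)=0$,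 of $P_{\mathcal R}\widetilde F(av_0+w^*(a,\mu),\mu)=0$. Define $\phi(a,\mu):=\widetilde L(av_0+w^*(a,\mu),\mu)$ and $g(a,\mu):=P_{\mathcal N}\widetilde F(av_0+w^*(a,\mu),\mu)\cdot v_0=\partial_a\phi(a,\mu)$. Zeros of $g$ near $(0,0)$ correspond one-to-one to critical points of $\widetilde L(\cdot,\mu)$ near $(0,0)$. Subscripts on $g$ denote partial derivatives. The Morse index of a critical point is the number of negative eigenvalues of its Hessian. *)

theory Defs
  imports "HOL-Analysis.Analysis" "HOL-Library.Landau_Symbols"
begin

section \<open>Functions of class C^k\<close>

text \<open>
  Only meant for open sets S of a finite-dimensional space, where it is the usual notion:
  all iterated directional derivatives up to order k exist and are continuous.
\<close>

primrec Ck_on :: "nat \<Rightarrow> ('a::euclidean_space \<Rightarrow> 'b::real_normed_vector) \<Rightarrow> 'a set \<Rightarrow> bool" where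
  "Ck_on 0 f S \<longleftrightarrow> continuous_on S f"
| "Ck_on (Suc k) f S \<longleftrightarrow>
     (\<forall>x\<in>S. f differentiable (at x)) \<and>
     (\<forall>v. Ck_on k (\<lambda>x. frechet_derivative f (at x) v) S)"

definition smooth_on :: "('a::euclidean_space \<Rightarrow> 'b::real_normed_vector) \<Rightarrow> 'a set \<Rightarrow> bool" where
  "smooth_on f S \<longleftrightarrow> (\<forall>k. Ck_on k f S)"

definition gradient :: "('a::real_inner \<Rightarrow> real) \<Rightarrow> 'a \<Rightarrow> 'a" where
  "gradient f x = (THE D. GDERIV f x :> D)"


section \<open>Riemannian manifolds\<close>

text \<open>
  The manifold is the whole type \<open>'m\<close>, modelled on the Euclidean space \<open>'a\<close>. A chart is a pair
  of its domain and its coordinate map. The atlas need not be maximal.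
\<close>

type_synonym ('m, 'a) chart = "'m set \<times> ('m \<Rightarrow> 'a)"

definition chart_inv :: "('m, 'a) chart \<Rightarrow> 'a \<Rightarrow> 'm" where
  "chart_inv c = inv_into (fst c) (snd c)"

definition chart_image :: "('m, 'a) chart \<Rightarrow> 'a set" where
  "chart_image c = snd c ` fst c"

locale smooth_manifold =
  fixes A :: "('m::{t2_space, second_countable_topology}, 'a::euclidean_space) chart set"
  assumes chart: "c \<in> A \<Longrightarrow> open (fst c) \<and> open (chart_image c) \<and>
                    homeomorphism (fst c) (chart_image c) (snd c) (chart_inv c)"
    and cover: "(\<Union>c\<in>A. fst c) = UNIV"
    and transition: "c \<in> A \<Longrightarrow> d \<in> A \<Longrightarrow>
                    smooth_on (snd d \<circ> chart_inv c) (snd c ` (fst c \<inter> fst d))"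

text \<open>
  A tangent vector at p is represented by its components in a chart c around p;
  \<open>G c p \<xi> \<eta>\<close> is the inner product of the tangent vectors at p whose components in c are
  \<open>\<xi>\<close> and \<open>\<eta>\<close>.
\<close>

locale riemannian_manifold = smooth_manifold A
  for A :: "('m::{t2_space, second_countable_topology}, 'a::euclidean_space) chart set" +
  fixes G :: "('m, 'a) chart \<Rightarrow> 'm \<Rightarrow> 'a \<Rightarrow> 'a \<Rightarrow> real"
  assumes metric_bilinear: "c \<in> A \<Longrightarrow> p \<in> fst c \<Longrightarrow> bilinear (G c p)"
    and metric_sym: "c \<in> A \<Longrightarrow> p \<in> fst c \<Longrightarrow> G c p \<xi> \<eta> = G c p \<eta> \<xi>"
    and metric_pos: "c \<in> A \<Longrightarrow> p \<in> fst c \<Longrightarrow> \<xi> \<noteq> 0 \<Longrightarrow> G c p \<xi> \<xi> > 0"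
    and metric_smooth: "c \<in> A \<Longrightarrow> smooth_on (\<lambda>x. G c (chart_inv c x) \<xi> \<eta>) (chart_image c)"
    and metric_change: "c \<in> A \<Longrightarrow> d \<in> A \<Longrightarrow> p \<in> fst c \<inter> fst d \<Longrightarrow>
          G c p \<xi> \<eta> =
            G d p (frechet_derivative (snd d \<circ> chart_inv c) (at (snd c p)) \<xi>)
                  (frechet_derivative (snd d \<circ> chart_inv c) (at (snd c p)) \<eta>)"

definition Ck_on_product ::
  "('m, 'a::euclidean_space) chart set \<Rightarrow> nat \<Rightarrow> ('m \<Rightarrow> real \<Rightarrow> real) \<Rightarrow> real set \<Rightarrow> bool" where
  "Ck_on_product A k L I \<longleftrightarrow>
     (\<forall>c\<in>A. Ck_on k (\<lambda>(x, l). L (chart_inv c x) l) (chart_image c \<times> I))"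

definition smooth_curve_on ::
  "('m::topological_space, 'a::euclidean_space) chart set \<Rightarrow> (real \<Rightarrow> 'm) \<Rightarrow> real set \<Rightarrow> bool" where
  "smooth_curve_on A \<theta> I \<longleftrightarrow>
     continuous_on I \<theta> \<and> (\<forall>c\<in>A. smooth_on (snd c \<circ> \<theta>) {l \<in> I. \<theta> l \<in> fst c})"

definition coord_deriv ::
  "('m, 'a::euclidean_space) chart \<Rightarrow> ('m \<Rightarrow> real) \<Rightarrow> 'm \<Rightarrow> 'a \<Rightarrow> real" where
  "coord_deriv c f p = frechet_derivative (f \<circ> chart_inv c) (at (snd c p))"

definition riem_grad ::
  "(('m, 'a::euclidean_space) chart \<Rightarrow> 'm \<Rightarrow> 'a \<Rightarrow> 'a \<Rightarrow> real) \<Rightarrow> ('m, 'a) chart \<Rightarrow>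
   ('m \<Rightarrow> real) \<Rightarrow> 'm \<Rightarrow> 'a" where
  "riem_grad G c f p = (THE \<zeta>. \<forall>\<xi>. G c p \<zeta> \<xi> = coord_deriv c f p \<xi>)"

text \<open>Christoffel term of the Levi-Civita connection, given by the Koszul formula.\<close>

definition christoffel ::
  "(('m, 'a::euclidean_space) chart \<Rightarrow> 'm \<Rightarrow> 'a \<Rightarrow> 'a \<Rightarrow> real) \<Rightarrow> ('m, 'a) chart \<Rightarrow>
   'm \<Rightarrow> 'a \<Rightarrow> 'a \<Rightarrow> 'a" where
  "christoffel G c p \<xi> \<eta> =
     (THE \<gamma>. \<forall>\<zeta>. G c p \<gamma> \<zeta> =
        (coord_deriv c (\<lambda>q. G c q \<eta> \<zeta>) p \<xi> + coord_deriv c (\<lambda>q. G c q \<xi> \<zeta>) p \<eta>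
          - coord_deriv c (\<lambda>q. G c q \<xi> \<eta>) p \<zeta>) / 2)"

text \<open>
  The Hessian as the self-adjoint operator \<open>\<xi> \<mapsto> \<nabla>\<^sub>\<xi> grad f\<close>, in components:
  its inner product with \<open>\<eta>\<close> is \<open>D\<^sup>2f(\<xi>,\<eta>) - Df(\<Gamma>(\<xi>,\<eta>))\<close>.
\<close>

definition riem_hess ::
  "(('m, 'a::euclidean_space) chart \<Rightarrow> 'm \<Rightarrow> 'a \<Rightarrow> 'a \<Rightarrow> real) \<Rightarrow> ('m, 'a) chart \<Rightarrow>
   ('m \<Rightarrow> real) \<Rightarrow> 'm \<Rightarrow> 'a \<Rightarrow> 'a" where
  "riem_hess G c f p \<xi> =
     (THE \<zeta>. \<forall>\<eta>. G c p \<zeta> \<eta> =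
        coord_deriv c (\<lambda>q. coord_deriv c f q \<eta>) p \<xi> - coord_deriv c f p (christoffel G c p \<xi> \<eta>))"

text \<open>Negative eigenvalues of the Hessian are counted with multiplicity.\<close>

definition morse_index ::
  "(('m, 'a::euclidean_space) chart \<Rightarrow> 'm \<Rightarrow> 'a \<Rightarrow> 'a \<Rightarrow> real) \<Rightarrow> ('m, 'a) chart \<Rightarrow>
   ('m \<Rightarrow> real) \<Rightarrow> 'm \<Rightarrow> nat" where
  "morse_index G c f p =
     (\<Sum>r \<in> {r. r < 0 \<and> (\<exists>\<xi>. \<xi> \<noteq> 0 \<and> riem_hess G c f p \<xi> = r *\<^sub>R \<xi>)}.
        dim {\<xi>. riem_hess G c f p \<xi> = r *\<^sub>R \<xi>})"


section \<open>Straightened coordinates\<close>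

text \<open>
  The straightened coordinate u depends smoothly on the point of the manifold and on \<open>\<mu>\<close>. It is
  given here by the inverse map \<open>(u, \<mu>) \<mapsto> \<Psi> u \<mu>\<close>, read in the chart c. Bijectivity of the
  u-derivative and injectivity of \<open>(u, \<mu>) \<mapsto> (\<Psi> u \<mu>, \<mu>)\<close> make the latter a diffeomorphism from V
  onto an open set. The u-derivative of \<open>\<Psi> u 0\<close> at 0 identifies the u-space with the tangent space;
  gradients and orthogonality in the u-space refer to its Euclidean inner product, and this
  identification is allowed, but not required, to be an isometry.
\<close>

definition straightening ::
  "('m, 'a::euclidean_space) chart \<Rightarrow> (real \<Rightarrow> 'm) \<Rightarrow> real set \<Rightarrow> real \<Rightarrow>
   ('a \<times> real) set \<Rightarrow> ('a \<Rightarrow> real \<Rightarrow> 'm) \<Rightarrow> bool" where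
  "straightening c \<theta>\<^sub>0 I ls V \<Psi> \<longleftrightarrow>
     open V \<and> (0, 0) \<in> V \<and>
     (\<forall>(u, \<mu>)\<in>V. ls + \<mu> \<in> I \<and> \<Psi> u \<mu> \<in> fst c) \<and>
     smooth_on (\<lambda>(u, \<mu>). snd c (\<Psi> u \<mu>)) V \<and>
     inj_on (\<lambda>(u, \<mu>). (\<Psi> u \<mu>, \<mu>)) V \<and>
     (\<forall>(u, \<mu>)\<in>V. bij (frechet_derivative (\<lambda>u. snd c (\<Psi> u \<mu>)) (at u))) \<and>
     (\<forall>\<mu>. (0, \<mu>) \<in> V \<longrightarrow> \<Psi> 0 \<mu> = \<theta>\<^sub>0 (ls + \<mu>))"

definition straightened_objective ::
  "('m \<Rightarrow> real \<Rightarrow> real) \<Rightarrow> real \<Rightarrow> ('a \<Rightarrow> real \<Rightarrow> 'm) \<Rightarrow> 'a \<Rightarrow> real \<Rightarrow> real" where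
  "straightened_objective L ls \<Psi> u \<mu> = L (\<Psi> u \<mu>) (ls + \<mu>)"


section \<open>Lyapunov--Schmidt reduction\<close>

text \<open>
  \<open>v\<^sub>0\<close> is a unit vector; \<open>proj_ker v\<^sub>0\<close> and \<open>proj_range v\<^sub>0\<close> are the orthogonal projections onto
  its span and onto the orthogonal complement of its span.
\<close>

definition proj_ker :: "'a::real_inner \<Rightarrow> 'a \<Rightarrow> 'a" where
  "proj_ker v\<^sub>0 x = (x \<bullet> v\<^sub>0) *\<^sub>R v\<^sub>0"

definition proj_range :: "'a::real_inner \<Rightarrow> 'a \<Rightarrow> 'a" where
  "proj_range v\<^sub>0 x = x - proj_ker v\<^sub>0 x"

text \<open>
  The order of differentiability of w is the one supplied by the implicit function theorem for an
  objective of class C^k. That theorem also shows that the germ of w at the origin is unique.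
\<close>

definition reduction_solution ::
  "nat \<Rightarrow> ('a::euclidean_space \<Rightarrow> real \<Rightarrow> real) \<Rightarrow> ('a \<times> real) set \<Rightarrow> 'a \<Rightarrow>
   (real \<Rightarrow> real \<Rightarrow> 'a) \<Rightarrow> bool" where
  "reduction_solution k Lt V v\<^sub>0 w \<longleftrightarrow>
     w 0 0 = 0 \<and>
     (\<exists>W. open W \<and> (0, 0) \<in> W \<and> Ck_on (k - 1) (\<lambda>(a, \<mu>). w a \<mu>) W \<and>
        (\<forall>(a, \<mu>)\<in>W. (a *\<^sub>R v\<^sub>0 + w a \<mu>, \<mu>) \<in> V \<and> w a \<mu> \<in> (span {v\<^sub>0})\<^sup>\<bottom> \<and>
           proj_range v\<^sub>0 (gradient (\<lambda>u. Lt u \<mu>) (a *\<^sub>R v\<^sub>0 + w a \<mu>)) = 0))"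

definition reduced_potential ::
  "('a::euclidean_space \<Rightarrow> real \<Rightarrow> real) \<Rightarrow> 'a \<Rightarrow> (real \<Rightarrow> real \<Rightarrow> 'a) \<Rightarrow> real \<Rightarrow> real \<Rightarrow> real" where
  "reduced_potential Lt v\<^sub>0 w a \<mu> = Lt (a *\<^sub>R v\<^sub>0 + w a \<mu>) \<mu>"

text \<open>
  Near the origin this is the a-derivative of \<open>reduced_potential\<close>, since w is a reduction solution.
\<close>

definition reduced_function ::
  "('a::euclidean_space \<Rightarrow> real \<Rightarrow> real) \<Rightarrow> 'a \<Rightarrow> (real \<Rightarrow> real \<Rightarrow> 'a) \<Rightarrow> real \<Rightarrow> real \<Rightarrow> real" where
  "reduced_function Lt v\<^sub>0 w a \<mu> =
     proj_ker v\<^sub>0 (gradient (\<lambda>u. Lt u \<mu>) (a *\<^sub>R v\<^sub>0 + w a \<mu>)) \<bullet> v\<^sub>0"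


section \<open>Pitchforks\<close>

text \<open>
  Strong (contact) equivalence of bifurcation problems at the origin: the parameter \<open>\<mu>\<close> is kept, and
  the equation is multiplied by a positive factor. As the problems here are only finitely
  differentiable, the coordinate change is of class C^1 and the factor continuous.
\<close>

definition locally_equivalent :: "(real \<Rightarrow> real \<Rightarrow> real) \<Rightarrow> (real \<Rightarrow> real \<Rightarrow> real) \<Rightarrow> bool" where
  "locally_equivalent g h \<longleftrightarrow>
     (\<exists>W S X. open W \<and> (0, 0) \<in> W \<and>
        continuous_on W (\<lambda>(a, \<mu>). S a \<mu>) \<and> Ck_on 1 (\<lambda>(a, \<mu>). X a \<mu>) W \<and> X 0 0 = 0 \<and>
        (\<forall>(a, \<mu>)\<in>W. S a \<mu> > 0 \<and> deriv (\<lambda>a. X a \<mu>) a > 0 \<and> g a \<mu> = S a \<mu> * h (X a \<mu>) \<mu>))"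

text \<open>
  Higher-order terms are understood with respect to the pitchfork scaling \<open>\<mu> \<sim> a\<^sup>2\<close>. The term
  \<open>e \<mu>\<close>, which does not depend on a, accounts for the value \<open>\<phi> 0 \<mu>\<close> of the objective along the
  trivial branch: it may have a linear part in \<open>\<mu>\<close>, but does not enter the reduced equation.
\<close>

definition pitchfork_expansion :: "(real \<Rightarrow> real \<Rightarrow> real) \<Rightarrow> real \<Rightarrow> real \<Rightarrow> bool" where
  "pitchfork_expansion \<phi> \<alpha> \<beta> \<longleftrightarrow>
     (\<exists>e. e 0 = 0 \<and>
        (\<lambda>(a, \<mu>). \<phi> a \<mu> - (\<phi> 0 0 + e \<mu> + 1/2 * \<alpha> * \<mu> * a^2 + 1/4 * \<beta> * a^4))
          \<in> o[at (0, 0)](\<lambda>(a, \<mu>). (\<bar>\<mu>\<bar> + a^2)^2))"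

end

theory Submission imports Defs begin

text \<open>
  The implicit solution \<open>w\<close> takes values in the complement of \<open>v\<^sub>0\<close>, so \<open>g\<close> is the derivative of \<open>\<phi>\<close>
  in \<open>a\<close>, and it is odd because \<open>\<phi>\<close> is even. Hence \<open>g a \<mu> = a q(a,\<mu>)\<close> with \<open>q\<close> even in \<open>a\<close>, and as
  \<open>q\<close> has derivative \<open>\<alpha> \<noteq> 0\<close> in \<open>\<mu>\<close>, its zeros form a curve \<open>\<mu> = m(a) \<approx> - \<beta> a\<^sup>2 / \<alpha>\<close>. Rescaling \<open>a\<close> so
  that this curve becomes exactly a parabola gives the equivalence with the normal form, and
  inverting the rescaling gives the two branches.

  For the Morse index, the Hessian of a function at a critical point transforms as a bilinear form,
  so its index can be computed in the straightened coordinates, from any splitting into a negative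
  definite and a positive semidefinite subspace. Differentiating the reduction equation in \<open>a\<close> yields
  a vector \<open>z\<close> close to \<open>v\<^sub>0\<close> which the Hessian at \<open>(0,\<mu>)\<close> maps to \<open>g\<^sub>a(0,\<mu>) v\<^sub>0\<close>. On the complement of
  \<open>v\<^sub>0\<close> the signature does not change near the origin, so the index jumps with the sign of
  \<open>g\<^sub>a(0,\<mu>) \<approx> \<alpha> \<mu>\<close>.
\<close>

section \<open>Calculus of functions of class \<open>C^k\<close>\<close>

text \<open>Two obstacles shape the proof. First, dividing the reduced function by a costs a
  derivative, yet the coordinate change of the normal form must be of class C^1 with positive
  derivative at a = 0. The zero curve is therefore found pointwise by the intermediate value
  theorem, and its continuity and derivative come from one exact difference formula with a
  continuous denominator. At a = 0, where that formula says too little, Taylor estimates along the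
  curve take over. Second, \<open>w\<close> is only known to be some solution of the projected
  equation. That \<open>w 0 \<mu> = 0\<close>, hence that a = 0 is the given branch, has to be
  derived from the nondegeneracy of the Hessian on the complement of \<open>v\<^sub>0\<close>. For
  the Morse index, the metric enters only through the definition of eigenvalues: at a critical point
  the Christoffel term vanishes, and Sylvester's law makes the number of negative eigenvalues the
  same for every inner product. The number \<open>m\<close> of the final conclusion is the dimension
  of a negative definite subspace for the Hessian at \<mu> = 0, which is why one \<open>m\<close>
  serves both signs of \<mu>.\<close>

lemma Ck_on_cong:
  assumes "open S" "\<And>x. x \<in> S \<Longrightarrow> f x = g x" "Ck_on k f S"
  shows "Ck_on k g S"
  using assms(2,3)
proof (induction k arbitrary: f g)
  case 0
  then show ?case by (simp cong: continuous_on_cong)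
next
  case (Suc k)
  have D: "(g has_derivative frechet_derivative f (at x)) (at x)" if "x \<in> S" for x
  proof -
    have "(f has_derivative frechet_derivative f (at x)) (at x)"
      using Suc.prems(2) that frechet_derivative_works by auto
    then show ?thesis
      using has_derivative_transform_within_open[OF _ assms(1) that] Suc.prems(1) by blast
  qed
  have eq: "frechet_derivative f (at x) = frechet_derivative g (at x)" if "x \<in> S" for x
    using frechet_derivative_at[OF D[OF that]] .
  have "Ck_on k (\<lambda>x. frechet_derivative g (at x) v) S" for v
    by (rule Suc.IH[of "\<lambda>x. frechet_derivative f (at x) v"]) (use Suc.prems eq in auto)
  then show ?case using D by (auto simp: differentiable_def)
qed

text \<open>\<open>frechet_derivative\<close> is a choice and awkward to compute; this rule accepts
  any explicit derivative, and most closure properties below go through it.\<close>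

lemma Ck_on_SucI:
  assumes "open S" "\<And>x. x \<in> S \<Longrightarrow> (f has_derivative f' x) (at x)" "\<And>v. Ck_on k (\<lambda>x. f' x v) S"
  shows "Ck_on (Suc k) f S"
proof -
  have "Ck_on k (\<lambda>x. frechet_derivative f (at x) v) S" for v
  proof (rule Ck_on_cong[OF assms(1) _ assms(3)[of v]])
    show "f' x v = frechet_derivative f (at x) v" if "x \<in> S" for x
      using frechet_derivative_at[OF assms(2)[OF that]] by simp
  qed
  then show ?thesis using assms(2) by (auto simp: differentiable_def)
qed

lemma Ck_on_Suc_has_derivative:
  assumes "Ck_on (Suc k) f S" "x \<in> S"
  shows "(f has_derivative frechet_derivative f (at x)) (at x)"
  using assms frechet_derivative_works by auto

lemma Ck_on_SucD: "Ck_on (Suc k) f S \<Longrightarrow> Ck_on k f S"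
proof (induction k arbitrary: f)
  case 0
  then show ?case
    by (auto intro!: continuous_at_imp_continuous_on differentiable_imp_continuous_within)
next
  case (Suc k)
  then show ?case by (metis Ck_on.simps(2))
qed

lemma Ck_on_le: "Ck_on k f S \<Longrightarrow> j \<le> k \<Longrightarrow> Ck_on j f S"
  by (induction k) (auto simp: le_Suc_eq simp del: Ck_on.simps intro: Ck_on_SucD)

lemma Ck_on_imp_continuous_on: "Ck_on k f S \<Longrightarrow> continuous_on S f"
  using Ck_on_le[of k f S 0] by simp

lemma Ck_on_subset: "Ck_on k f S \<Longrightarrow> T \<subseteq> S \<Longrightarrow> Ck_on k f T"
  by (induction k arbitrary: f) (auto intro: continuous_on_subset)

lemma Ck_on_const: "Ck_on k (\<lambda>x. c) S"
proof (induction k arbitrary: c)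
  case (Suc k)
  have "frechet_derivative (\<lambda>x. c) (at x) = (\<lambda>v. 0)" for x
    by (rule frechet_derivative_at[OF has_derivative_const, symmetric])
  with Suc show ?case by simp
qed simp

lemma Ck_on_bounded_linear_compose:
  assumes "bounded_linear h" "open S" "Ck_on k f S"
  shows "Ck_on k (\<lambda>x. h (f x)) S"
  using assms(3)
proof (induction k arbitrary: f)
  case 0
  then show ?case
    by (auto intro: continuous_on_compose2[OF linear_continuous_on[OF assms(1), of UNIV]])
next
  case (Suc k)
  show ?case
  proof (rule Ck_on_SucI[OF assms(2)])
    fix x assume "x \<in> S"
    show "((\<lambda>x. h (f x)) has_derivative (\<lambda>v. h (frechet_derivative f (at x) v))) (at x)"
      by (rule bounded_linear.has_derivative[OF assms(1) Ck_on_Suc_has_derivative[OF Suc.prems \<open>x \<in> S\<close>]])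
  next
    fix v show "Ck_on k (\<lambda>x. h (frechet_derivative f (at x) v)) S"
      using Suc by simp
  qed
qed

lemma Ck_on_bounded_linear:
  assumes "bounded_linear h" "open S"
  shows "Ck_on k h S"
\<comment> \<open>Proving one order more replaces an induction: the first derivative in direction v
  is the constant \<open>h v\<close>.\<close>
proof (rule Ck_on_le)
  show "Ck_on (Suc k) h S"
    by (rule Ck_on_SucI[OF assms(2)])
      (auto intro: bounded_linear_imp_has_derivative assms Ck_on_const)
qed simp

lemma Ck_on_add:
  assumes "open S" "Ck_on k f S" "Ck_on k g S"
  shows "Ck_on k (\<lambda>x. f x + g x) S"
  using assms(2,3)
proof (induction k arbitrary: f g)
  case 0
  then show ?case by (auto intro: continuous_intros)
next
  case (Suc k)
  show ?case
  proof (rule Ck_on_SucI[OF assms(1)])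
    fix x assume x: "x \<in> S"
    show "((\<lambda>x. f x + g x) has_derivative
       (\<lambda>v. frechet_derivative f (at x) v + frechet_derivative g (at x) v)) (at x)"
      by (intro has_derivative_add Ck_on_Suc_has_derivative[OF Suc.prems(1) x]
          Ck_on_Suc_has_derivative[OF Suc.prems(2) x])
  next
    fix v show "Ck_on k (\<lambda>x. frechet_derivative f (at x) v + frechet_derivative g (at x) v) S"
      using Suc by simp
  qed
qed

lemma Ck_on_sum:
  assumes "open S" "\<And>i. i \<in> J \<Longrightarrow> Ck_on k (f i) S"
  shows "Ck_on k (\<lambda>x. \<Sum>i\<in>J. f i x) S"
  using assms(2)
  by (induction J rule: infinite_finite_induct) (auto intro: Ck_on_const Ck_on_add[OF assms(1)])

lemma Ck_on_bilinear:
  assumes "bounded_bilinear p" "open S" "Ck_on k f S" "Ck_on k g S"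
  shows "Ck_on k (\<lambda>x. p (f x) (g x)) S"
  using assms(3,4)
proof (induction k arbitrary: f g)
  case 0
  then show ?case by (auto intro: bounded_bilinear.continuous_on[OF assms(1)])
next
  case (Suc k)
  show ?case
  proof (rule Ck_on_SucI[OF assms(2)])
    fix x assume x: "x \<in> S"
    show "((\<lambda>x. p (f x) (g x)) has_derivative
       (\<lambda>v. p (f x) (frechet_derivative g (at x) v) + p (frechet_derivative f (at x) v) (g x))) (at x)"
      by (intro bounded_bilinear.FDERIV[OF assms(1)] Ck_on_Suc_has_derivative[OF Suc.prems(1) x]
          Ck_on_Suc_has_derivative[OF Suc.prems(2) x])
  next
    fix v
    show "Ck_on k (\<lambda>x. p (f x) (frechet_derivative g (at x) v) + p (frechet_derivative f (at x) v) (g x)) S"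
    proof (intro Ck_on_add[OF assms(2)] Suc.IH)
      show "Ck_on k f S" "Ck_on k g S" by (rule Ck_on_SucD[OF Suc.prems(1)], rule Ck_on_SucD[OF Suc.prems(2)])
      show "Ck_on k (\<lambda>x. frechet_derivative f (at x) v) S"
        "Ck_on k (\<lambda>x. frechet_derivative g (at x) v) S" using Suc.prems by simp_all
    qed
  qed
qed

lemma Ck_on_Pair:
  assumes "open S" "Ck_on k f S" "Ck_on k g S"
  shows "Ck_on k (\<lambda>x. (f x, g x)) S"
proof -
  have "Ck_on k (\<lambda>x. (f x, 0) + (0, g x)) S"
    by (intro Ck_on_add assms Ck_on_bounded_linear_compose[of "\<lambda>y. (y, 0)"]
         Ck_on_bounded_linear_compose[of "\<lambda>y. (0, y)"] bounded_linear_Pair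
         bounded_linear_ident bounded_linear_zero)
  then show ?thesis by simp
qed

text \<open>\<open>Ck_on\<close> speaks only of derivatives in fixed directions. The chain rule
  produces a direction that varies with the point; this expansion reduces it to finitely many fixed
  ones.\<close>

lemma linear_Basis_expansion:
  assumes "linear h"
  shows "h (v::'a::euclidean_space) = (\<Sum>b\<in>Basis. (v \<bullet> b) *\<^sub>R h b)"
proof -
  have "h v = h (\<Sum>b\<in>Basis. (v \<bullet> b) *\<^sub>R b)" by (simp add: euclidean_representation)
  then show ?thesis using assms by (simp add: linear_sum linear_cmul)
qed

lemma Ck_on_compose:
  fixes f :: "'b::euclidean_space \<Rightarrow> 'c::real_normed_vector" and h :: "'a::euclidean_space \<Rightarrow> 'b"
  assumes "open S" "Ck_on k f T" "Ck_on k h S" "h ` S \<subseteq> T"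
  shows "Ck_on k (\<lambda>x. f (h x)) S"
  using assms(2,3)
proof (induction k arbitrary: f)
  case 0
  then show ?case using continuous_on_compose2[OF _ _ assms(4), of f] by simp
next
  case (Suc k)
  let ?f' = "\<lambda>y. frechet_derivative f (at y)" and ?h' = "\<lambda>x. frechet_derivative h (at x)"
  have h': "(h has_derivative ?h' x) (at x)" if "x \<in> S" for x
    by (rule Ck_on_Suc_has_derivative[OF Suc.prems(2) that])
  have f': "(f has_derivative ?f' (h x)) (at (h x))" if "x \<in> S" for x
    using Ck_on_Suc_has_derivative[OF Suc.prems(1)] assms(4) that by auto
  show ?case
  proof (rule Ck_on_SucI[OF assms(1)])
    fix x assume x: "x \<in> S"
    show "((\<lambda>x. f (h x)) has_derivative (\<lambda>v. ?f' (h x) (?h' x v))) (at x)"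
      using diff_chain_at[OF h'[OF x] f'[OF x]] by (simp add: o_def)
  next
    fix v
    have *: "Ck_on k (\<lambda>x. \<Sum>b\<in>Basis. (?h' x v \<bullet> b) *\<^sub>R ?f' (h x) b) S"
    proof (intro Ck_on_sum[OF assms(1)] Ck_on_bilinear[OF bounded_bilinear_scaleR assms(1)])
      fix b :: 'b
      show "Ck_on k (\<lambda>x. ?h' x v \<bullet> b) S"
        by (rule Ck_on_bounded_linear_compose[OF bounded_linear_inner_left assms(1)])
          (use Suc.prems(2) in simp)
      have "Ck_on k (\<lambda>y. ?f' y b) T" using Suc.prems(1) by simp
      then show "Ck_on k (\<lambda>x. ?f' (h x) b) S"
        by (rule Suc.IH[OF _ Ck_on_SucD[OF Suc.prems(2)]])
    qed
    show "Ck_on k (\<lambda>x. ?f' (h x) (?h' x v)) S"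
    proof (rule Ck_on_cong[OF assms(1) _ *])
      fix x assume "x \<in> S"
      show "(\<Sum>b\<in>Basis. (?h' x v \<bullet> b) *\<^sub>R ?f' (h x) b) = ?f' (h x) (?h' x v)"
        by (rule linear_Basis_expansion[OF has_derivative_linear[OF f'[OF \<open>x \<in> S\<close>]], symmetric])
    qed
  qed
qed

lemma Ck_on_has_field_derivative:
  fixes f :: "'a::euclidean_space \<Rightarrow> real"
  assumes "Ck_on (Suc k) f S" "p t \<in> S" "(p has_vector_derivative v) (at t)"
  shows "((\<lambda>s. f (p s)) has_real_derivative frechet_derivative f (at (p t)) v) (at t)"
proof -
  have "(f has_derivative frechet_derivative f (at (p t))) (at (p t))"
    by (rule Ck_on_Suc_has_derivative[OF assms(1,2)])
  then have "((f \<circ> p) has_vector_derivative frechet_derivative f (at (p t)) v) (at t)"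
    by (intro vector_derivative_diff_chain_within assms(3))
      (use has_derivative_at_withinI in blast)
  then show ?thesis
    by (simp add: o_def has_real_derivative_iff_has_vector_derivative)
qed

section \<open>Symmetry of second derivatives\<close>

text \<open>The mean value theorem is applied twice: in s to the increment across w, then in t to
  the derivative in direction v. Exchanging v and w only rearranges the left side, which is what the
  symmetry proof exploits.\<close>

lemma second_difference:
  fixes f :: "'a::euclidean_space \<Rightarrow> real"
  assumes f: "Ck_on (Suc (Suc k)) f S" and h: "h > 0"
    and S: "\<And>s t. 0 \<le> s \<Longrightarrow> s \<le> h \<Longrightarrow> 0 \<le> t \<Longrightarrow> t \<le> h \<Longrightarrow> x + s *\<^sub>R v + t *\<^sub>R w \<in> S"
  obtains s t where "0 < s" "s < h" "0 < t" "t < h"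
    "f (x + h *\<^sub>R v + h *\<^sub>R w) - f (x + h *\<^sub>R v) - (f (x + h *\<^sub>R w) - f x)
      = h * (h * frechet_derivative (\<lambda>y. frechet_derivative f (at y) v) (at (x + s *\<^sub>R v + t *\<^sub>R w)) w)"
proof -
  define f' where "f' y = frechet_derivative f (at y) v" for y
  have f'_C: "Ck_on (Suc k) f' S" using f unfolding f'_def[abs_def] Ck_on.simps(2)[of "Suc k"] by blast
  have "\<exists>s. 0 < s \<and> s < h \<and>
     (f (x + h *\<^sub>R v + h *\<^sub>R w) - f (x + h *\<^sub>R v + 0 *\<^sub>R w)) - (f (x + 0 *\<^sub>R v + h *\<^sub>R w) - f (x + 0 *\<^sub>R v + 0 *\<^sub>R w))
      = (h - 0) * (f' (x + s *\<^sub>R v + h *\<^sub>R w) - f' (x + s *\<^sub>R v + 0 *\<^sub>R w))"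
    by (rule MVT2[OF h, of "\<lambda>s. f (x + s *\<^sub>R v + h *\<^sub>R w) - f (x + s *\<^sub>R v + 0 *\<^sub>R w)"])
      (unfold f'_def, intro DERIV_diff Ck_on_has_field_derivative[OF f] S
        derivative_eq_intros | use h in \<open>auto intro!: derivative_eq_intros\<close>)+
  then obtain s where s: "0 < s" "s < h"
     "f (x + h *\<^sub>R v + h *\<^sub>R w) - f (x + h *\<^sub>R v) - (f (x + h *\<^sub>R w) - f x)
      = h * (f' (x + s *\<^sub>R v + h *\<^sub>R w) - f' (x + s *\<^sub>R v))" by auto
  have "\<exists>t. 0 < t \<and> t < h \<and> f' (x + s *\<^sub>R v + h *\<^sub>R w) - f' (x + s *\<^sub>R v + 0 *\<^sub>R w)
      = (h - 0) * frechet_derivative f' (at (x + s *\<^sub>R v + t *\<^sub>R w)) w"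
    by (rule MVT2[OF h, of "\<lambda>t. f' (x + s *\<^sub>R v + t *\<^sub>R w)"])
      (intro Ck_on_has_field_derivative[OF f'_C] S | use s h in \<open>auto intro!: derivative_eq_intros\<close>)+
  then show thesis using that s by (auto simp: f'_def[abs_def])
qed

text \<open>One second difference, divided by h^2, equals either mixed derivative, each taken at
  some point of a small parallelogram. Were the two different at x, continuity would keep them apart
  on the whole parallelogram.\<close>

lemma frechet_derivative_commute:
  fixes f :: "'a::euclidean_space \<Rightarrow> real"
  assumes S: "open S" "x \<in> S" and f: "Ck_on (Suc (Suc k)) f S"
  shows "frechet_derivative (\<lambda>y. frechet_derivative f (at y) v) (at x) w
       = frechet_derivative (\<lambda>y. frechet_derivative f (at y) w) (at x) v"
    (is "?D v w x = ?D w v x")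
proof (rule ccontr)
  assume ne: "?D v w x \<noteq> ?D w v x"
  define e where "e = dist (?D v w x) (?D w v x) / 2"
  have e: "e > 0" using ne by (simp add: e_def)
  have cont: "\<exists>d>0. \<forall>y. dist y x < d \<longrightarrow> dist (?D v w y) (?D v w x) < e" for v w
  proof -
    have "Ck_on k (?D v w) S" using f by simp
    then have "isCont (?D v w) x"
      using S Ck_on_imp_continuous_on continuous_on_eq_continuous_at by blast
    then show ?thesis using e unfolding continuous_at_eps_delta by blast
  qed
  obtain d1 where d1: "d1 > 0" "\<And>y. dist y x < d1 \<Longrightarrow> dist (?D v w y) (?D v w x) < e"
    using cont by blast
  obtain d2 where d2: "d2 > 0" "\<And>y. dist y x < d2 \<Longrightarrow> dist (?D w v y) (?D w v x) < e"
    using cont by blast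
  obtain d3 where d3: "d3 > 0" "\<And>y. dist y x < d3 \<Longrightarrow> y \<in> S"
    using S open_dist by metis
  define d where "d = min d1 (min d2 d3)"
  have d: "d > 0" using d1 d2 d3 by (simp add: d_def)
  \<comment> \<open>The summand 1 keeps N positive when v and w vanish; with h = d / (2 N) the whole
    parallelogram lies within d / 2 of x.\<close>
  define N where "N = 1 + norm v + norm w"
  define h where "h = d / (2 * N)"
  have pos: "N > 0" using norm_ge_zero[of v] norm_ge_zero[of w] unfolding N_def by linarith
  have h: "h > 0" using d pos by (simp add: h_def)
  have near: "dist (x + s *\<^sub>R v + t *\<^sub>R w) x < d" if "0 \<le> s" "s \<le> h" "0 \<le> t" "t \<le> h" for s t
  proof -
    have "dist (x + s *\<^sub>R v + t *\<^sub>R w) x = norm (s *\<^sub>R v + t *\<^sub>R w)" by (simp add: dist_norm add.assoc)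
    also have "\<dots> \<le> s * norm v + t * norm w"
      by (rule order_trans[OF norm_triangle_ineq]) (use that in simp)
    also have "\<dots> \<le> h * norm v + h * norm w" by (intro add_mono mult_right_mono that) auto
    also have "\<dots> \<le> h * N" using h by (simp add: N_def algebra_simps)
    also have "\<dots> = d / 2" using pos by (simp add: h_def)
    also have "\<dots> < d" using d by simp
    finally show ?thesis .
  qed
  have nearS: "x + s *\<^sub>R v + t *\<^sub>R w \<in> S" if "0 \<le> s" "s \<le> h" "0 \<le> t" "t \<le> h" for s t
    using near[OF that] d3 by (simp add: d_def)
  obtain s t where st: "0 < s" "s < h" "0 < t" "t < h"
    "f (x + h *\<^sub>R v + h *\<^sub>R w) - f (x + h *\<^sub>R v) - (f (x + h *\<^sub>R w) - f x)
      = h * (h * ?D v w (x + s *\<^sub>R v + t *\<^sub>R w))"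
    using second_difference[OF f h nearS] by blast
  have nearS': "x + s *\<^sub>R w + t *\<^sub>R v \<in> S" if "0 \<le> s" "s \<le> h" "0 \<le> t" "t \<le> h" for s t
    using nearS[of t s] that by (simp add: algebra_simps)
  obtain s' t' where st': "0 < s'" "s' < h" "0 < t'" "t' < h"
    "f (x + h *\<^sub>R w + h *\<^sub>R v) - f (x + h *\<^sub>R w) - (f (x + h *\<^sub>R v) - f x)
      = h * (h * ?D w v (x + s' *\<^sub>R w + t' *\<^sub>R v))"
    using second_difference[OF f h nearS'] by blast
  have "h * (h * ?D v w (x + s *\<^sub>R v + t *\<^sub>R w)) = h * (h * ?D w v (x + s' *\<^sub>R w + t' *\<^sub>R v))"
    unfolding st(5)[symmetric] st'(5)[symmetric] by (simp add: algebra_simps)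
  then have eq: "?D v w (x + s *\<^sub>R v + t *\<^sub>R w) = ?D w v (x + s' *\<^sub>R w + t' *\<^sub>R v)" using h by simp
  have "dist (?D v w (x + s *\<^sub>R v + t *\<^sub>R w)) (?D v w x) < e"
    using near[of s t] st by (intro d1) (auto simp: d_def)
  moreover have "dist (?D w v (x + s' *\<^sub>R w + t' *\<^sub>R v)) (?D w v x) < e"
    using near[of t' s'] st' by (intro d2) (auto simp: d_def algebra_simps)
  ultimately have "dist (?D v w x) (?D w v x) < e + e"
    unfolding eq using dist_triangle2[of "?D v w x" "?D w v x" "?D w v (x + s' *\<^sub>R w + t' *\<^sub>R v)"]
    by (simp add: dist_commute)
  then show False by (simp add: e_def)
qed

section \<open>Odd scalar bifurcation problems\<close>

text \<open>Hadamard's lemma: as a mean of the derivative over the segment from y to z, the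
  difference quotient stays continuous where y and z coincide. Convexity of J keeps the segment in
  the domain.\<close>

lemma hadamard_integral:
  fixes f f' :: "'a::topological_space \<Rightarrow> real \<Rightarrow> real"
  assumes f': "\<And>x y. x \<in> U \<Longrightarrow> y \<in> J \<Longrightarrow> (f x has_real_derivative f' x y) (at y)"
    and cont: "continuous_on (U \<times> J) (\<lambda>(x, y). f' x y)" and J: "convex J"
  shows hadamard_integral_eq: "x \<in> U \<Longrightarrow> y \<in> J \<Longrightarrow> z \<in> J \<Longrightarrow>
      f x z - f x y = (z - y) * integral {0..1} (\<lambda>t. f' x (y + t * (z - y)))"
    and hadamard_integral_continuous:
      "continuous_on (U \<times> J \<times> J) (\<lambda>(x, y, z). integral {0..1} (\<lambda>t. f' x (y + t * (z - y))))"
proof -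
  have J': "y + t * (z - y) \<in> J" if "y \<in> J" "z \<in> J" "t \<in> {0..1}" for y z t
  proof -
    have "(1 - t) *\<^sub>R y + t *\<^sub>R z \<in> J" using that by (intro convexD[OF J]) auto
    then show ?thesis by (simp add: algebra_simps)
  qed
  show "f x z - f x y = (z - y) * integral {0..1} (\<lambda>t. f' x (y + t * (z - y)))"
    if "x \<in> U" "y \<in> J" "z \<in> J"
  proof -
    have "((\<lambda>t. (z - y) * f' x (y + t * (z - y))) has_integral
        f x (y + 1 * (z - y)) - f x (y + 0 * (z - y))) {0..1}"
    proof (rule fundamental_theorem_of_calculus)
      fix t :: real assume "t \<in> {0..1}"
      then have "((\<lambda>t. f x (y + t * (z - y))) has_real_derivative f' x (y + t * (z - y)) * (z - y)) (at t)"
        by (intro DERIV_chain2[OF f'] J' that) (auto intro!: derivative_eq_intros)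
      then show "((\<lambda>t. f x (y + t * (z - y))) has_vector_derivative (z - y) * f' x (y + t * (z - y)))
          (at t within {0..1})"
        by (simp add: has_real_derivative_iff_has_vector_derivative mult.commute
            has_vector_derivative_at_within)
    qed simp
    from integral_unique[OF this] show ?thesis by simp
  qed
  have "continuous_on ((U \<times> J \<times> J) \<times> cbox 0 1)
      (\<lambda>(p, t). (\<lambda>p t. f' (fst p) (fst (snd p) + t * (snd (snd p) - fst (snd p)))) p t)"
    unfolding case_prod_unfold
    by (rule continuous_on_compose2[OF cont, unfolded case_prod_unfold, of _
          "\<lambda>p. (fst (fst p), fst (snd (fst p)) + snd p * (snd (snd (fst p)) - fst (snd (fst p))))", simplified])
      (use J' in \<open>auto intro!: continuous_intros\<close>)
  from integral_continuous_on_param[OF this]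
  show "continuous_on (U \<times> J \<times> J) (\<lambda>(x, y, z). integral {0..1} (\<lambda>t. f' x (y + t * (z - y))))"
    by (simp add: case_prod_unfold)
qed

text \<open>The symmetric interval lets one bound serve both signs of a; \<open>taylor\<close> uses
  this to pass estimates from a derivative to its primitive.\<close>

lemma abs_le_of_deriv_bound:
  fixes f :: "real \<Rightarrow> real"
  assumes "\<And>s. \<bar>s\<bar> \<le> \<bar>a\<bar> \<Longrightarrow> (f has_real_derivative f' s) (at s)"
    and "\<And>s. \<bar>s\<bar> \<le> \<bar>a\<bar> \<Longrightarrow> \<bar>f' s\<bar> \<le> C" and "f 0 = 0"
  shows "\<bar>f a\<bar> \<le> C * \<bar>a\<bar>"
proof -
  have "norm (f a - f 0) \<le> C * norm (a - 0)"
    by (rule field_differentiable_bound[of "{- \<bar>a\<bar>..\<bar>a\<bar>}" f f'])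
      (auto intro!: has_field_derivative_at_within assms)
  then show ?thesis using assms(3) by simp
qed

lemma continuous_on_open_imp_isCont:
  "continuous_on S f \<Longrightarrow> open S \<Longrightarrow> x \<in> S \<Longrightarrow> isCont f x"
  by (simp add: continuous_on_eq_continuous_at)

lemma DERIV_mult_isCont:
  fixes f k :: "real \<Rightarrow> real"
  assumes "(f has_real_derivative f') (at x)" "f x = 0" "isCont k x"
  shows "((\<lambda>y. f y * k y) has_real_derivative f' * k x) (at x)"
proof -
  obtain h where h: "\<forall>z. f z - f x = h z * (z - x)" "isCont h x" "h x = f'"
    using assms(1) unfolding CARAT_DERIV by blast
  then show ?thesis unfolding CARAT_DERIV
    by (intro exI[of _ "\<lambda>z. h z * k z"]) (use assms in \<open>auto intro!: continuous_intros\<close>)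
qed

section \<open>Zero set and normal form of an odd scalar problem\<close>

locale odd_bifurcation =
  fixes g g\<^sub>1 g\<^sub>2 g\<^sub>3 g\<^sub>m :: "real \<Rightarrow> real \<Rightarrow> real" and d \<alpha> \<beta> :: real
  assumes d: "d > 0"
    and g1: "\<bar>a\<bar> < d \<Longrightarrow> \<bar>\<mu>\<bar> < d \<Longrightarrow> ((\<lambda>a. g a \<mu>) has_real_derivative g\<^sub>1 a \<mu>) (at a)"
    and g2: "\<bar>a\<bar> < d \<Longrightarrow> \<bar>\<mu>\<bar> < d \<Longrightarrow> ((\<lambda>a. g\<^sub>1 a \<mu>) has_real_derivative g\<^sub>2 a \<mu>) (at a)"
    and g3: "\<bar>a\<bar> < d \<Longrightarrow> \<bar>\<mu>\<bar> < d \<Longrightarrow> ((\<lambda>a. g\<^sub>2 a \<mu>) has_real_derivative g\<^sub>3 a \<mu>) (at a)"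
    and gm: "\<bar>a\<bar> < d \<Longrightarrow> \<bar>\<mu>\<bar> < d \<Longrightarrow> (g\<^sub>1 a has_real_derivative g\<^sub>m a \<mu>) (at \<mu>)"
    and g1_cont: "continuous_on ({-d<..<d} \<times> {-d<..<d}) (\<lambda>(a, \<mu>). g\<^sub>1 a \<mu>)"
    and gm_cont: "continuous_on ({-d<..<d} \<times> {-d<..<d}) (\<lambda>(a, \<mu>). g\<^sub>m a \<mu>)"
    and g3_cont: "isCont (\<lambda>(a, \<mu>). g\<^sub>3 a \<mu>) (0, 0)"
    and odd: "\<bar>a\<bar> < d \<Longrightarrow> \<bar>\<mu>\<bar> < d \<Longrightarrow> g (- a) \<mu> = - g a \<mu>"
    and g1_0: "g\<^sub>1 0 0 = 0" and gm_0: "g\<^sub>m 0 0 = \<alpha>" and g3_0: "g\<^sub>3 0 0 = 6 * \<beta>"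
    and \<alpha>: "\<alpha> \<noteq> 0" and \<beta>: "\<beta> \<noteq> 0"
begin

lemma g_0: "\<bar>\<mu>\<bar> < d \<Longrightarrow> g 0 \<mu> = 0"
  using odd[of 0 \<mu>] d by simp

lemma even1: assumes "\<bar>a\<bar> < d" "\<bar>\<mu>\<bar> < d" shows "g\<^sub>1 (- a) \<mu> = g\<^sub>1 a \<mu>"
proof -
  have "((\<lambda>a. - g (- a) \<mu>) has_real_derivative g\<^sub>1 (- a) \<mu>) (at a)"
  proof -
    have "((\<lambda>a. g a \<mu>) has_real_derivative g\<^sub>1 (- a) \<mu>) (at (- a))" using g1[of "- a" \<mu>] assms by simp
    from DERIV_minus[OF DERIV_mirror[THEN iffD1, OF this]] show ?thesis by simp
  qed
  then have "((\<lambda>a. g a \<mu>) has_real_derivative g\<^sub>1 (- a) \<mu>) (at a)"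
    by (rule has_field_derivative_transform_within_open[where S = "{-d<..<d}"])
      (use assms odd in auto)
  then show ?thesis using g1[OF assms] DERIV_unique by blast
qed

lemma g2_0: assumes "\<bar>\<mu>\<bar> < d" shows "g\<^sub>2 0 \<mu> = 0"
proof -
  have "((\<lambda>a. g\<^sub>1 (- a) \<mu>) has_real_derivative - g\<^sub>2 0 \<mu>) (at 0)"
  proof -
    have "((\<lambda>a. g\<^sub>1 a \<mu>) has_real_derivative g\<^sub>2 0 \<mu>) (at (- 0))" using g2[of 0 \<mu>] assms d by simp
    from DERIV_mirror[THEN iffD1, OF this] show ?thesis .
  qed
  then have "((\<lambda>a. g\<^sub>1 a \<mu>) has_real_derivative - g\<^sub>2 0 \<mu>) (at 0)"
    by (rule has_field_derivative_transform_within_open[where S = "{-d<..<d}"])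
      (use assms d even1 in auto)
  from DERIV_unique[OF this g2[of 0 \<mu>]] show ?thesis using assms d by simp
qed

text \<open>Continuity of \<open>g\<^sub>3\<close> at the origin is integrated three times in a. The
  initial values at a = 0 are \<open>g\<^sub>2 0 \<mu> = 0\<close> and \<open>g 0 \<mu> = 0\<close>
  by oddness, and \<open>g\<^sub>1 0 \<mu>\<close> close to \<alpha> \<mu> by differentiability in
  \<mu>; the last one contributes the term |\<mu>| of the error.\<close>

lemma taylor:
  assumes "e > 0"
  obtains r where "0 < r" "r \<le> d"
    "\<And>a \<mu>. \<bar>a\<bar> < r \<Longrightarrow> \<bar>\<mu>\<bar> < r \<Longrightarrow> \<bar>g\<^sub>1 a \<mu> - (\<alpha> * \<mu> + 3 * \<beta> * a\<^sup>2)\<bar> \<le> e * (\<bar>\<mu>\<bar> + a\<^sup>2)"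
    "\<And>a \<mu>. \<bar>a\<bar> < r \<Longrightarrow> \<bar>\<mu>\<bar> < r \<Longrightarrow> \<bar>g a \<mu> - a * (\<alpha> * \<mu> + \<beta> * a\<^sup>2)\<bar> \<le> e * (\<bar>a\<bar> * (\<bar>\<mu>\<bar> + a\<^sup>2))"
proof -
  obtain r1 where r1: "r1 > 0" "\<And>p. dist p (0, 0) < r1 \<Longrightarrow> dist ((\<lambda>(a, \<mu>). g\<^sub>3 a \<mu>) p) (6 * \<beta>) < e"
    using g3_cont assms g3_0 unfolding continuous_at_eps_delta by force
  have "(g\<^sub>1 0 has_derivative (\<lambda>h. \<alpha> * h)) (at 0)"
    using gm[of 0 0] d gm_0 by (simp add: has_field_derivative_def)
  then obtain r2 where r2: "r2 > 0" "\<And>y. norm (y - 0) < r2 \<Longrightarrow> norm (g\<^sub>1 0 y - g\<^sub>1 0 0 - \<alpha> * (y - 0)) \<le> e * norm (y - 0)"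
    unfolding has_derivative_at_alt using assms by blast
  define r where "r = min d (min (r1 / 2) r2)"
  have r: "0 < r" "r \<le> d" "r \<le> r1 / 2" "r \<le> r2" using d r1 r2 by (auto simp: r_def)
  have g3_bd: "\<bar>g\<^sub>3 a \<mu> - 6 * \<beta>\<bar> \<le> e" if "\<bar>a\<bar> < r" "\<bar>\<mu>\<bar> < r" for a \<mu>
  proof -
    have "dist (a, \<mu>) (0, 0) \<le> \<bar>a\<bar> + \<bar>\<mu>\<bar>"
      using norm_Pair_le[of a \<mu>] by (simp add: dist_norm)
    then have "dist (a, \<mu>) (0, 0) < r1" using that r by linarith
    from r1(2)[OF this] show ?thesis by (simp add: dist_real_def)
  qed
  have g2_bd: "\<bar>g\<^sub>2 a \<mu> - 6 * \<beta> * a\<bar> \<le> e * \<bar>a\<bar>" if "\<bar>a\<bar> < r" "\<bar>\<mu>\<bar> < r" for a \<mu>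
    by (rule abs_le_of_deriv_bound[of a "\<lambda>a. g\<^sub>2 a \<mu> - 6 * \<beta> * a" "\<lambda>a. g\<^sub>3 a \<mu> - 6 * \<beta>"])
      (use that r in \<open>auto intro!: derivative_eq_intros g3 g3_bd simp: g2_0\<close>)
  have g1_bd: "\<bar>g\<^sub>1 a \<mu> - (\<alpha> * \<mu> + 3 * \<beta> * a\<^sup>2)\<bar> \<le> e * (\<bar>\<mu>\<bar> + a\<^sup>2)" if "\<bar>a\<bar> < r" "\<bar>\<mu>\<bar> < r" for a \<mu>
  proof -
    have "\<bar>g\<^sub>1 a \<mu> - g\<^sub>1 0 \<mu> - 3 * \<beta> * a\<^sup>2\<bar> \<le> e * \<bar>a\<bar> * \<bar>a\<bar>"
    proof (rule abs_le_of_deriv_bound[of a "\<lambda>a. g\<^sub>1 a \<mu> - g\<^sub>1 0 \<mu> - 3 * \<beta> * a\<^sup>2" "\<lambda>a. g\<^sub>2 a \<mu> - 6 * \<beta> * a"])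
      fix s assume s: "\<bar>s\<bar> \<le> \<bar>a\<bar>"
      show "((\<lambda>a. g\<^sub>1 a \<mu> - g\<^sub>1 0 \<mu> - 3 * \<beta> * a\<^sup>2) has_real_derivative g\<^sub>2 s \<mu> - 6 * \<beta> * s) (at s)"
        using s that r by (auto intro!: derivative_eq_intros g2)
      show "\<bar>g\<^sub>2 s \<mu> - 6 * \<beta> * s\<bar> \<le> e * \<bar>a\<bar>"
        by (rule order_trans[OF g2_bd]) (use s that assms in auto)
    qed simp
    moreover have "\<bar>g\<^sub>1 0 \<mu> - \<alpha> * \<mu>\<bar> \<le> e * \<bar>\<mu>\<bar>" using r2(2)[of \<mu>] that r g1_0 by simp
    ultimately show ?thesis by (simp add: algebra_simps power2_eq_square)
  qed
  show thesis
  proof (rule that[OF r(1,2) g1_bd])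
    fix a \<mu> assume *: "\<bar>a\<bar> < r" "\<bar>\<mu>\<bar> < r"
    have "\<bar>g a \<mu> - a * (\<alpha> * \<mu> + \<beta> * a\<^sup>2)\<bar> \<le> e * (\<bar>\<mu>\<bar> + a\<^sup>2) * \<bar>a\<bar>"
    proof (rule abs_le_of_deriv_bound[of a "\<lambda>a. g a \<mu> - a * (\<alpha> * \<mu> + \<beta> * a\<^sup>2)"
          "\<lambda>a. g\<^sub>1 a \<mu> - (\<alpha> * \<mu> + 3 * \<beta> * a\<^sup>2)"])
      fix s assume s: "\<bar>s\<bar> \<le> \<bar>a\<bar>"
      show "((\<lambda>a. g a \<mu> - a * (\<alpha> * \<mu> + \<beta> * a\<^sup>2)) has_real_derivative
          g\<^sub>1 s \<mu> - (\<alpha> * \<mu> + 3 * \<beta> * s\<^sup>2)) (at s)"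
        using s * r by (auto intro!: derivative_eq_intros g1 simp: power2_eq_square)
      have "s\<^sup>2 \<le> a\<^sup>2" using s by (simp add: abs_le_square_iff)
      show "\<bar>g\<^sub>1 s \<mu> - (\<alpha> * \<mu> + 3 * \<beta> * s\<^sup>2)\<bar> \<le> e * (\<bar>\<mu>\<bar> + a\<^sup>2)"
        by (rule order_trans[OF g1_bd]) (use s * \<open>s\<^sup>2 \<le> a\<^sup>2\<close> assms in auto)
    qed (use * r in \<open>simp add: g_0\<close>)
    then show "\<bar>g a \<mu> - a * (\<alpha> * \<mu> + \<beta> * a\<^sup>2)\<bar> \<le> e * (\<bar>a\<bar> * (\<bar>\<mu>\<bar> + a\<^sup>2))"
      by (simp add: algebra_simps)
  qed
qed

text \<open>
  \<open>g a \<mu> = a q(a,\<mu>)\<close> where \<open>q\<close> is the mean of \<open>g\<^sub>1(sa,\<mu>)\<close> over \<open>s\<close>; the divided differences of \<open>q\<close>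
  in \<open>\<mu>\<close> extend continuously to the diagonal. Dividing by \<open>\<alpha>\<close> makes their value 1 at the origin.
\<close>

lemma divided:
  obtains q D where
    "\<And>a \<mu>. \<bar>a\<bar> < d \<Longrightarrow> \<bar>\<mu>\<bar> < d \<Longrightarrow> g a \<mu> = \<alpha> * a * q a \<mu>"
    "q 0 0 = (0::real)"
    "continuous_on ({-d<..<d} \<times> {-d<..<d}) (\<lambda>(a, \<mu>). q a \<mu>)"
    "\<And>a \<mu> m. \<bar>a\<bar> < d \<Longrightarrow> \<bar>\<mu>\<bar> < d \<Longrightarrow> \<bar>m\<bar> < d \<Longrightarrow> q a \<mu> - q a m = (\<mu> - m) * D a m \<mu>"
    "continuous_on ({-d<..<d} \<times> {-d<..<d} \<times> {-d<..<d}) (\<lambda>(a, m, \<mu>). D a m \<mu>)"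
    "D 0 0 0 = (1::real)"
proof -
  let ?B = "{-d<..<d}"
  \<comment> \<open>E is the divided difference of \<open>g\<^sub>1\<close> in \<mu>. Averaging it
    over the points s a, just as \<open>q\<close> averages \<open>g\<^sub>1\<close>, gives the
    divided difference of \<open>q\<close>.\<close>
  define E where "E x m \<mu> = integral {0..1} (\<lambda>t. g\<^sub>m x (m + t * (\<mu> - m)))" for x m \<mu>
  define q where "q a \<mu> = integral {0..1} (\<lambda>s. g\<^sub>1 (s * a) \<mu>)" for a \<mu>
  define D where "D a m \<mu> = integral {0..1} (\<lambda>s. E (s * a) m \<mu>)" for a m \<mu>
  have B: "s * a \<in> ?B" if "s \<in> {0..1}" "a \<in> ?B" for s a
  proof -
    have "\<bar>s * a\<bar> \<le> 1 * \<bar>a\<bar>" unfolding abs_mult using that by (intro mult_right_mono) auto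
    then show ?thesis using that by auto
  qed
  have E: "g\<^sub>1 x \<mu> - g\<^sub>1 x m = (\<mu> - m) * E x m \<mu>" if "x \<in> ?B" "m \<in> ?B" "\<mu> \<in> ?B" for x m \<mu>
    unfolding E_def using that
    by (intro hadamard_integral_eq[where U = ?B and J = ?B] gm gm_cont) auto
  have E_cont: "continuous_on (?B \<times> ?B \<times> ?B) (\<lambda>(x, m, \<mu>). E x m \<mu>)"
    unfolding E_def by (intro hadamard_integral_continuous[where f = g\<^sub>1] gm gm_cont) auto
  \<comment> \<open>The arguments are swapped because \<open>hadamard_integral\<close>
    differentiates in its second variable, which here is a.\<close>
  have g1_cont': "continuous_on (?B \<times> ?B) (\<lambda>(\<mu>, a). g\<^sub>1 a \<mu>)"
    unfolding case_prod_unfold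
    by (rule continuous_on_compose2[OF g1_cont, unfolded case_prod_unfold, of _ "\<lambda>p. (snd p, fst p)", simplified])
      (auto intro!: continuous_intros)
  have q: "g a \<mu> = a * q a \<mu>" if "a \<in> ?B" "\<mu> \<in> ?B" for a \<mu>
  proof -
    have "g a \<mu> - g 0 \<mu> = (a - 0) * integral {0..1} (\<lambda>t. g\<^sub>1 (0 + t * (a - 0)) \<mu>)"
      by (rule hadamard_integral_eq[where U = ?B and J = ?B and f = "\<lambda>\<mu> a. g a \<mu>", OF _ g1_cont'])
        (use that d in \<open>auto intro!: g1\<close>)
    then show ?thesis using that by (auto simp: q_def g_0)
  qed
  have "continuous_on ((?B \<times> ?B) \<times> cbox 0 1) (\<lambda>(p, s). (\<lambda>p s. g\<^sub>1 (s * fst p) (snd p)) p s)"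
    unfolding case_prod_unfold
    by (rule continuous_on_compose2[OF g1_cont, unfolded case_prod_unfold, of _ "\<lambda>p. (snd p * fst (fst p), snd (fst p))", simplified])
      (use B in \<open>auto intro!: continuous_intros\<close>)
  from integral_continuous_on_param[OF this] have q_cont: "continuous_on (?B \<times> ?B) (\<lambda>(a, \<mu>). q a \<mu>)"
    by (simp add: q_def case_prod_unfold)
  have "continuous_on ((?B \<times> ?B \<times> ?B) \<times> cbox 0 1)
      (\<lambda>(p, s). (\<lambda>p s. E (s * fst p) (fst (snd p)) (snd (snd p))) p s)"
    unfolding case_prod_unfold
    by (rule continuous_on_compose2[OF E_cont, unfolded case_prod_unfold,
          of _ "\<lambda>p. (snd p * fst (fst p), fst (snd (fst p)), snd (snd (fst p)))", simplified])
      (use B in \<open>auto intro!: continuous_intros\<close>)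
  from integral_continuous_on_param[OF this]
  have D_cont: "continuous_on (?B \<times> ?B \<times> ?B) (\<lambda>(a, m, \<mu>). D a m \<mu>)"
    by (simp add: D_def case_prod_unfold)
  have int: "(\<lambda>s. g\<^sub>1 (s * a) \<mu>) integrable_on {0..1}" if "a \<in> ?B" "\<mu> \<in> ?B" for a \<mu>
  proof (rule integrable_continuous_interval)
    show "continuous_on {0..1} (\<lambda>s. g\<^sub>1 (s * a) \<mu>)"
      by (rule continuous_on_compose2[OF g1_cont, unfolded case_prod_unfold, of _ "\<lambda>s. (s * a, \<mu>)", simplified])
        (use that B in \<open>auto intro!: continuous_intros\<close>)
  qed
  have D: "q a \<mu> - q a m = (\<mu> - m) * D a m \<mu>" if "a \<in> ?B" "m \<in> ?B" "\<mu> \<in> ?B" for a m \<mu>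
  proof -
    have "q a \<mu> - q a m = integral {0..1} (\<lambda>s. g\<^sub>1 (s * a) \<mu> - g\<^sub>1 (s * a) m)"
      unfolding q_def by (rule integral_diff[symmetric]) (use that int in auto)
    also have "\<dots> = integral {0..1} (\<lambda>s. (\<mu> - m) * E (s * a) m \<mu>)"
      by (rule integral_cong) (use E B that in blast)
    finally show ?thesis by (simp add: D_def)
  qed
  show thesis
  proof (rule that[of "\<lambda>a \<mu>. q a \<mu> / \<alpha>" "\<lambda>a m \<mu>. D a m \<mu> / \<alpha>"])
    show "g a \<mu> = \<alpha> * a * (q a \<mu> / \<alpha>)" if "\<bar>a\<bar> < d" "\<bar>\<mu>\<bar> < d" for a \<mu>
      using q[of a \<mu>] that \<alpha> by (auto simp: abs_less_iff)
    show "q 0 0 / \<alpha> = 0" by (simp add: q_def g1_0)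
    show "continuous_on (?B \<times> ?B) (\<lambda>(a, \<mu>). q a \<mu> / \<alpha>)"
      using q_cont \<alpha> by (auto simp: case_prod_unfold intro!: continuous_intros)
    show "q a \<mu> / \<alpha> - q a m / \<alpha> = (\<mu> - m) * (D a m \<mu> / \<alpha>)"
      if "\<bar>a\<bar> < d" "\<bar>\<mu>\<bar> < d" "\<bar>m\<bar> < d" for a \<mu> m
      using D[of a m \<mu>] that by (auto simp: diff_divide_distrib[symmetric] abs_less_iff)
    show "continuous_on (?B \<times> ?B \<times> ?B) (\<lambda>(a, m, \<mu>). D a m \<mu> / \<alpha>)"
      using D_cont \<alpha> by (auto simp: case_prod_unfold intro!: continuous_intros)
    show "D 0 0 0 / \<alpha> = 1" using \<alpha> by (simp add: D_def E_def gm_0)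
  qed
qed


text \<open>
  The nontrivial zeros of \<open>g\<close> form a curve \<open>\<mu> = m a\<close>, on which \<open>\<alpha> m a = - \<beta> a\<^sup>2 + o(a\<^sup>2)\<close>. Putting
  \<open>X a = sgn a \<surd>(- \<alpha> m a / \<beta>)\<close> turns \<open>\<alpha> \<mu> + \<beta> X\<^sup>2\<close> into \<open>\<alpha> (\<mu> - m a)\<close>; as \<open>X\<close> depends on \<open>a\<close> only, it
  is of class C^1 although \<open>g\<close> has just three derivatives.
\<close>

lemma normal_form:
  obtains r X X' S where
    "0 < r" "r \<le> d"
    "\<And>a. \<bar>a\<bar> < r \<Longrightarrow> (X has_real_derivative X' a) (at a)"
    "\<And>a. \<bar>a\<bar> < r \<Longrightarrow> X' a > 0" "continuous_on {-r<..<r} X'" "X 0 = (0::real)" "X' 0 = 1"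
    "continuous_on ({-r<..<r} \<times> {-r<..<r}) (\<lambda>(a, \<mu>). S a \<mu>)"
    "\<And>a \<mu>. \<bar>a\<bar> < r \<Longrightarrow> \<bar>\<mu>\<bar> < r \<Longrightarrow> S a \<mu> > 0"
    "\<And>a \<mu>. \<bar>a\<bar> < r \<Longrightarrow> \<bar>\<mu>\<bar> < r \<Longrightarrow> g a \<mu> = S a \<mu> * (X a * (\<alpha> * \<mu> + \<beta> * (X a)\<^sup>2))"
    "\<And>a. \<bar>a\<bar> < r \<Longrightarrow> X (- a) = - X a"
proof -
  let ?B = "{-d<..<d}"
  obtain q D where gq: "\<And>a \<mu>. \<bar>a\<bar> < d \<Longrightarrow> \<bar>\<mu>\<bar> < d \<Longrightarrow> g a \<mu> = \<alpha> * a * q a \<mu>"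
    and q0: "q 0 0 = 0"
    and q_cont: "continuous_on (?B \<times> ?B) (\<lambda>(a, \<mu>). q a \<mu>)"
    and qD: "\<And>a \<mu> m. \<bar>a\<bar> < d \<Longrightarrow> \<bar>\<mu>\<bar> < d \<Longrightarrow> \<bar>m\<bar> < d \<Longrightarrow> q a \<mu> - q a m = (\<mu> - m) * D a m \<mu>"
    and D_cont: "continuous_on (?B \<times> ?B \<times> ?B) (\<lambda>(a, m, \<mu>). D a m \<mu>)"
    and D0: "D 0 0 0 = 1"
    by (rule divided) blast
  have q_isCont: "isCont (\<lambda>(a, \<mu>). q a \<mu>) (a, \<mu>)" if "\<bar>a\<bar> < d" "\<bar>\<mu>\<bar> < d" for a \<mu>
    by (rule continuous_on_open_imp_isCont[OF q_cont]) (use that in \<open>auto simp: open_Times\<close>)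
  have q_isCont1: "isCont (\<lambda>a. q a \<mu>) a" if "\<bar>a\<bar> < d" "\<bar>\<mu>\<bar> < d" for a \<mu>
    using isCont_o2[where f = "\<lambda>a. (a, \<mu>)" and g = "\<lambda>(a, \<mu>). q a \<mu>" and a = a] q_isCont[OF that] by simp
  have D_isCont: "isCont (\<lambda>(a, m, \<mu>). D a m \<mu>) (a, m, \<mu>)" if "\<bar>a\<bar> < d" "\<bar>m\<bar> < d" "\<bar>\<mu>\<bar> < d" for a m \<mu>
    by (rule continuous_on_open_imp_isCont[OF D_cont]) (use that in \<open>auto simp: open_Times\<close>)
  obtain r\<^sub>D where r\<^sub>D: "r\<^sub>D > 0" "\<And>p. dist p (0, 0, 0) < r\<^sub>D \<Longrightarrow> dist ((\<lambda>(a, m, \<mu>). D a m \<mu>) p) 1 < 1 / 2"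
    using D_isCont[of 0 0 0] d D0 unfolding continuous_at_eps_delta
    by (force dest: spec[of _ "1 / 2 :: real"])
  \<comment> \<open>A quarter of \<open>r\<^sub>D\<close>, so that three coordinates of this size
    add up to less than \<open>r\<^sub>D\<close>; the bound d / 2 keeps the closed interval up to
    \<open>r\<^sub>0\<close> inside the domain.\<close>
  define r\<^sub>0 where "r\<^sub>0 = min (d / 2) (r\<^sub>D / 4)"
  have r\<^sub>0: "0 < r\<^sub>0" "r\<^sub>0 < d" "r\<^sub>0 \<le> r\<^sub>D / 4" using d r\<^sub>D(1) by (auto simp: r\<^sub>0_def)
  have D_half: "D a m \<mu> > 1 / 2" if "\<bar>a\<bar> \<le> r\<^sub>0" "\<bar>m\<bar> \<le> r\<^sub>0" "\<bar>\<mu>\<bar> \<le> r\<^sub>0" for a m \<mu>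
  proof -
    have "dist (a, m, \<mu>) (0, 0, 0) \<le> \<bar>a\<bar> + (\<bar>m\<bar> + \<bar>\<mu>\<bar>)"
      using norm_Pair_le[of a "(m, \<mu>)"] norm_Pair_le[of m \<mu>] by (simp add: dist_norm)
    then have "dist (a, m, \<mu>) (0, 0, 0) < r\<^sub>D" using that r\<^sub>0 by linarith
    from r\<^sub>D(2)[OF this] have "\<bar>D a m \<mu> - 1\<bar> < 1 / 2" by (simp add: dist_real_def)
    then show ?thesis by linarith
  qed
  have q_pos: "q 0 r\<^sub>0 > 0" "q 0 (- r\<^sub>0) < 0"
    using qD[of 0 r\<^sub>0 0] qD[of 0 "- r\<^sub>0" 0] D_half[of 0 0 r\<^sub>0] D_half[of 0 0 "- r\<^sub>0"] r\<^sub>0 d q0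
    by (auto simp: zero_less_mult_iff mult_less_0_iff)
  have "\<forall>\<^sub>F a in at 0. q a r\<^sub>0 > 0 \<and> q a (- r\<^sub>0) < 0"
    using q_isCont1[of 0 r\<^sub>0] q_isCont1[of 0 "- r\<^sub>0"] r\<^sub>0 d q_pos unfolding isCont_def
    by (auto intro!: eventually_conj order_tendstoD)
  then obtain r\<^sub>q where r\<^sub>q: "r\<^sub>q > 0" "\<And>a. a \<noteq> 0 \<Longrightarrow> \<bar>a\<bar> < r\<^sub>q \<Longrightarrow> q a r\<^sub>0 > 0 \<and> q a (- r\<^sub>0) < 0"
    unfolding eventually_at by (auto simp: dist_real_def)
  define r\<^sub>1 where "r\<^sub>1 = min r\<^sub>0 r\<^sub>q"
  have r\<^sub>1: "0 < r\<^sub>1" "r\<^sub>1 \<le> r\<^sub>0" using r\<^sub>0 r\<^sub>q by (auto simp: r\<^sub>1_def)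
  \<comment> \<open>As D > 1/2, q(0, .) has opposite signs at the two ends of the interval, and
    continuity in a preserves this for small a; the intermediate value theorem does the rest. The
    guard stands under the quantifier so that \<open>m\<close> can be chosen as a total
    function.\<close>
  have "\<exists>m. \<bar>a\<bar> < r\<^sub>1 \<longrightarrow> \<bar>m\<bar> < r\<^sub>0 \<and> q a m = 0" for a
  proof (cases "\<bar>a\<bar> < r\<^sub>1")
    case True
    have signs: "q a r\<^sub>0 > 0" "q a (- r\<^sub>0) < 0"
      using r\<^sub>q(2)[of a] q_pos True by (cases "a = 0"; auto simp: r\<^sub>1_def)+
    have "continuous_on {-r\<^sub>0..r\<^sub>0} (\<lambda>\<mu>. q a \<mu>)"
      by (rule continuous_on_compose2[OF q_cont, unfolded case_prod_unfold, of _ "\<lambda>\<mu>. (a, \<mu>)", simplified])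
        (use True r\<^sub>1 r\<^sub>0 in \<open>auto intro!: continuous_intros\<close>)
    then obtain m where "- r\<^sub>0 \<le> m" "m \<le> r\<^sub>0" "q a m = 0"
      using IVT'[of "q a" "- r\<^sub>0" 0 r\<^sub>0] signs r\<^sub>0 by force
    moreover from this have "m \<noteq> r\<^sub>0" "m \<noteq> - r\<^sub>0" using signs by auto
    ultimately show ?thesis by (intro exI[of _ m]) auto
  qed simp
  then obtain m where m_bd: "\<And>a. \<bar>a\<bar> < r\<^sub>1 \<Longrightarrow> \<bar>m a\<bar> < r\<^sub>0" and qm: "\<And>a. \<bar>a\<bar> < r\<^sub>1 \<Longrightarrow> q a (m a) = 0"
    by metis
  have q_eq: "q a \<mu> = (\<mu> - m a) * D a (m a) \<mu>" if "\<bar>a\<bar> < r\<^sub>1" "\<bar>\<mu>\<bar> \<le> r\<^sub>0" for a \<mu>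
    using qD[of a \<mu> "m a"] qm[OF that(1)] m_bd[OF that(1)] that r\<^sub>0 r\<^sub>1 by simp
  have m_unique: "\<mu> = m a" if "\<bar>a\<bar> < r\<^sub>1" "\<bar>\<mu>\<bar> \<le> r\<^sub>0" "q a \<mu> = 0" for a \<mu>
    using q_eq[OF that(1,2)] that D_half[of a "m a" \<mu>] m_bd[of a] r\<^sub>1 by auto
  have m0: "m 0 = 0" using m_unique[of 0 0] q0 r\<^sub>0 r\<^sub>1 by simp
  \<comment> \<open>For nonzero a, oddness of g makes q even in a, so m(-a) is a zero of q(a, .) as
    well and uniqueness applies.\<close>
  have m_even: "m (- a) = m a" if "\<bar>a\<bar> < r\<^sub>1" for a
  proof (cases "a = 0")
    case False
    have "\<alpha> * a * q a (m (- a)) = 0"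
      using gq[of "- a" "m (- a)"] gq[of a "m (- a)"] odd[of a "m (- a)"] qm[of "- a"] m_bd[of "- a"] that r\<^sub>0 r\<^sub>1
      by simp
    then have "q a (m (- a)) = 0" using False \<alpha> by simp
    then show ?thesis using m_unique[of a "m (- a)"] that m_bd[of "- a"] by simp
  qed simp
  \<comment> \<open>The implicit function theorem in difference form: \<open>qD\<close> between m b
    and m a, where q(a, m a) = 0. Continuity and differentiability of \<open>m\<close> are both read
    off from this formula.\<close>
  have m_diff: "m a - m b = - q a (m b) / D a (m b) (m a)" if "\<bar>a\<bar> < r\<^sub>1" "\<bar>b\<bar> < r\<^sub>1" for a b
    using qD[of a "m a" "m b"] D_half[of a "m b" "m a"] qm[of a] m_bd[OF that(1)] m_bd[OF that(2)] that r\<^sub>0 r\<^sub>1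
    by (simp add: field_simps)
  have m_cont: "isCont m b" if b: "\<bar>b\<bar> < r\<^sub>1" for b
  proof -
    have "((\<lambda>a. q a (m b)) \<longlongrightarrow> 0) (at b)"
      using q_isCont1[of b "m b"] m_bd[OF b] qm[OF b] b r\<^sub>0 r\<^sub>1 by (simp add: isCont_def)
    then have lim: "((\<lambda>a. 2 * \<bar>q a (m b)\<bar>) \<longlongrightarrow> 0) (at b)"
      by (auto intro!: tendsto_eq_intros)
    have "((\<lambda>a. m a - m b) \<longlongrightarrow> 0) (at b)"
    proof (rule Lim_null_comparison[OF _ lim])
      have "\<forall>\<^sub>F a in at b. a \<in> {-r\<^sub>1<..<r\<^sub>1}"
        using b by (intro eventually_at_in_open') auto
      then show "\<forall>\<^sub>F a in at b. norm (m a - m b) \<le> 2 * \<bar>q a (m b)\<bar>"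
      proof (rule eventually_mono)
        fix a assume "a \<in> {-r\<^sub>1<..<r\<^sub>1}"
        then have a: "\<bar>a\<bar> < r\<^sub>1" by auto
        have D: "D a (m b) (m a) > 1 / 2" using D_half[of a "m b" "m a"] m_bd[OF a] m_bd[OF b] a r\<^sub>1 by simp
        have "\<bar>m a - m b\<bar> = \<bar>q a (m b)\<bar> / D a (m b) (m a)"
          unfolding m_diff[OF a b] using D by simp
        also have "\<dots> \<le> \<bar>q a (m b)\<bar> / (1 / 2)"
          using D by (intro divide_left_mono) auto
        finally show "norm (m a - m b) \<le> 2 * \<bar>q a (m b)\<bar>" by simp
      qed
    qed
    then show ?thesis by (simp add: isCont_def LIM_zero_iff)
  qed
  have Dm_cont: "isCont (\<lambda>a. D a (m b) (m a)) b" "isCont (\<lambda>a. D a (m a) (m a)) b" if "\<bar>b\<bar> < r\<^sub>1" for b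
    using isCont_o2[where f = "\<lambda>a. (a, m b, m a)" and g = "\<lambda>(a, m, \<mu>). D a m \<mu>" and a = b]
      isCont_o2[where f = "\<lambda>a. (a, m a, m a)" and g = "\<lambda>(a, m, \<mu>). D a m \<mu>" and a = b]
      D_isCont[of b "m b" "m b"] m_cont[OF that] m_bd[OF that] that r\<^sub>0 r\<^sub>1
    by (simp_all add: isCont_Pair)
  \<comment> \<open>At a zero of g the a-derivative of q is \<open>g\<^sub>1\<close> / (\<alpha> a),
    and D on the diagonal is its \<mu>-derivative; so this is the usual quotient from implicit
    differentiation.\<close>
  define m' where "m' a = - (g\<^sub>1 a (m a) / (\<alpha> * a)) / D a (m a) (m a)" for a
  have m': "(m has_real_derivative m' b) (at b)" if b: "\<bar>b\<bar> < r\<^sub>1" "b \<noteq> 0" for b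
  proof -
    have mb: "\<bar>m b\<bar> < d" "\<bar>b\<bar> < d" using m_bd[OF b(1)] b r\<^sub>0 r\<^sub>1 by auto
    have Db: "D b (m b) (m b) > 1 / 2" using D_half[of b "m b" "m b"] m_bd[OF b(1)] b r\<^sub>1 by simp
    have gb: "g b (m b) = 0" using gq[OF mb(2,1)] qm[OF b(1)] by simp
    have "((\<lambda>a. - g a (m b) / (\<alpha> * a)) has_real_derivative - (g\<^sub>1 b (m b) / (\<alpha> * b))) (at b)"
      using b(2) \<alpha> mb gb by (auto intro!: derivative_eq_intros g1 simp: divide_simps power2_eq_square)
    then have "((\<lambda>a. - q a (m b)) has_real_derivative - (g\<^sub>1 b (m b) / (\<alpha> * b))) (at b)"
    proof (rule has_field_derivative_transform_within_open[where S = "{-d<..<d} - {0}"])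
      fix a assume "a \<in> {-d<..<d} - {0}"
      then show "- g a (m b) / (\<alpha> * a) = - q a (m b)" using gq[of a "m b"] mb \<alpha> by auto
    qed (use mb b in auto)
    then have "((\<lambda>a. - q a (m b) * (1 / D a (m b) (m a))) has_real_derivative m' b) (at b)"
      unfolding m'_def using Dm_cont(1)[OF b(1)] qm[OF b(1)] Db
      by (intro DERIV_mult_isCont[THEN DERIV_cong]) (auto intro!: continuous_intros)
    from DERIV_add[OF DERIV_const[of "m b"] this]
    have "((\<lambda>a. m b + - q a (m b) * (1 / D a (m b) (m a))) has_real_derivative m' b) (at b)" by simp
    then show ?thesis
    proof (rule has_field_derivative_transform_within_open[where S = "{-r\<^sub>1<..<r\<^sub>1}"])
      fix a assume "a \<in> {-r\<^sub>1<..<r\<^sub>1}"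
      then have "\<bar>a\<bar> < r\<^sub>1" by auto
      then show "m b + - q a (m b) * (1 / D a (m b) (m a)) = m a" using m_diff[of a b] b by simp
    qed (use b in auto)
  qed
  have lims: "((\<lambda>a. \<alpha> * m a / a\<^sup>2) \<longlongrightarrow> - \<beta>) (at 0)" "((\<lambda>a. g\<^sub>1 a (m a) / a\<^sup>2) \<longlongrightarrow> 2 * \<beta>) (at 0)"
  proof -
    \<comment> \<open>K is the constant in the a priori bound |m a| <= K a^2. It results from
      absorbing half of |\<alpha>| |m a| into the left side of the Taylor estimate along the
      curve.\<close>
    define K where "K = 2 * \<bar>\<beta>\<bar> / \<bar>\<alpha>\<bar> + 1"
    have K: "K > 0" by (simp add: K_def add_nonneg_pos)
    have \<alpha>K: "\<bar>\<alpha>\<bar> * K = 2 * \<bar>\<beta>\<bar> + \<bar>\<alpha>\<bar>" using \<alpha> by (simp add: K_def field_simps)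
    have bound: "\<forall>\<^sub>F a in at 0. \<bar>\<alpha> * m a / a\<^sup>2 + \<beta>\<bar> \<le> e \<and> \<bar>g\<^sub>1 a (m a) / a\<^sup>2 - 2 * \<beta>\<bar> \<le> 2 * e" if e: "e > 0" for e
    proof -
      \<comment> \<open>The bound |\<alpha>| / 2 permits this absorption; the bound e / (K + 1)
        turns the error e' (|m a| + a^2) into at most e a^2.\<close>
      define e' where "e' = min (\<bar>\<alpha>\<bar> / 2) (e / (K + 1))"
      have e': "e' > 0" "e' \<le> \<bar>\<alpha>\<bar> / 2" "e' \<le> e / (K + 1)"
        unfolding e'_def using e K \<alpha> by (simp, intro min.cobounded1, intro min.cobounded2)
      then have e'K: "e' * (K + 1) \<le> e" using K by (simp add: pos_le_divide_eq)
      obtain r where r: "0 < r" "r \<le> d"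
        "\<And>a \<mu>. \<bar>a\<bar> < r \<Longrightarrow> \<bar>\<mu>\<bar> < r \<Longrightarrow> \<bar>g\<^sub>1 a \<mu> - (\<alpha> * \<mu> + 3 * \<beta> * a\<^sup>2)\<bar> \<le> e' * (\<bar>\<mu>\<bar> + a\<^sup>2)"
        "\<And>a \<mu>. \<bar>a\<bar> < r \<Longrightarrow> \<bar>\<mu>\<bar> < r \<Longrightarrow> \<bar>g a \<mu> - a * (\<alpha> * \<mu> + \<beta> * a\<^sup>2)\<bar> \<le> e' * (\<bar>a\<bar> * (\<bar>\<mu>\<bar> + a\<^sup>2))"
        using taylor[OF e'(1)] by metis
      have "(m \<longlongrightarrow> 0) (at 0)" using m_cont[of 0] r\<^sub>1 m0 by (simp add: isCont_def)
      then have ev_m: "\<forall>\<^sub>F a in at 0. \<bar>m a\<bar> < r" using tendstoD[of m 0 "at 0" r] r by (simp add: dist_real_def)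
      have ev_a: "\<forall>\<^sub>F a in at 0. \<bar>a::real\<bar> < min r r\<^sub>1"
        using r r\<^sub>1 by (auto simp: eventually_at dist_real_def intro!: exI[of _ "min r r\<^sub>1"])
      have ev_0: "\<forall>\<^sub>F a in at 0. (a::real) \<noteq> 0" by (simp add: eventually_at_filter)
      show ?thesis using ev_m ev_a ev_0
      proof eventually_elim
        case (elim a)
        have "g a (m a) = 0" using gq[of a "m a"] qm[of a] elim r by simp
        then have "\<bar>a\<bar> * \<bar>\<alpha> * m a + \<beta> * a\<^sup>2\<bar> \<le> \<bar>a\<bar> * (e' * (\<bar>m a\<bar> + a\<^sup>2))"
          using r(4)[of a "m a"] elim by (simp add: abs_mult mult_ac)
        then have *: "\<bar>\<alpha> * m a + \<beta> * a\<^sup>2\<bar> \<le> e' * (\<bar>m a\<bar> + a\<^sup>2)" using elim by simp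
        have "\<bar>\<alpha>\<bar> * \<bar>m a\<bar> \<le> \<bar>\<alpha> * m a + \<beta> * a\<^sup>2\<bar> + \<bar>\<beta>\<bar> * a\<^sup>2"
          using abs_triangle_ineq4[of "\<alpha> * m a + \<beta> * a\<^sup>2" "\<beta> * a\<^sup>2"] by (simp add: abs_mult)
        also have "\<dots> \<le> \<bar>\<alpha>\<bar> / 2 * (\<bar>m a\<bar> + a\<^sup>2) + \<bar>\<beta>\<bar> * a\<^sup>2"
          using mult_right_mono[OF e'(2), of "\<bar>m a\<bar> + a\<^sup>2"] * by simp
        finally have "\<bar>\<alpha>\<bar> * \<bar>m a\<bar> \<le> \<bar>\<alpha>\<bar> * (K * a\<^sup>2)"
          unfolding mult.assoc[symmetric] \<alpha>K by (simp add: algebra_simps)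
        then have "\<bar>m a\<bar> \<le> K * a\<^sup>2" using \<alpha> by simp
        then have "e' * (\<bar>m a\<bar> + a\<^sup>2) \<le> e' * ((K + 1) * a\<^sup>2)"
          using e'(1) by (intro mult_left_mono) (auto simp: algebra_simps)
        also have "\<dots> \<le> e * a\<^sup>2" using mult_right_mono[OF e'K, of "a\<^sup>2"] by (simp add: mult.assoc)
        finally have **: "e' * (\<bar>m a\<bar> + a\<^sup>2) \<le> e * a\<^sup>2" .
        have a2: "a\<^sup>2 > 0" using elim by simp
        have "\<bar>\<alpha> * m a + \<beta> * a\<^sup>2\<bar> \<le> e * a\<^sup>2" using * ** by simp
        \<comment> \<open>On the curve \<alpha> m a is close to - \<beta> a^2, so \<alpha> m a + 3
          \<beta> a^2 is close to 2 \<beta> a^2; the two errors are at most e a^2 each.\<close>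
        moreover have "\<bar>g\<^sub>1 a (m a) - 2 * \<beta> * a\<^sup>2\<bar> \<le> 2 * e * a\<^sup>2"
          using r(3)[of a "m a"] elim * ** by (simp add: algebra_simps abs_le_iff)
        moreover have "\<alpha> * m a / a\<^sup>2 + \<beta> = (\<alpha> * m a + \<beta> * a\<^sup>2) / a\<^sup>2"
          "g\<^sub>1 a (m a) / a\<^sup>2 - 2 * \<beta> = (g\<^sub>1 a (m a) - 2 * \<beta> * a\<^sup>2) / a\<^sup>2"
          using a2 by (simp_all add: field_simps)
        ultimately show ?case using a2 by (simp add: abs_div_pos[symmetric] pos_divide_le_eq)
      qed
    qed
    show "((\<lambda>a. \<alpha> * m a / a\<^sup>2) \<longlongrightarrow> - \<beta>) (at 0)"
    proof (rule tendstoI)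
      fix e :: real assume "e > 0"
      from bound[of "e / 2"] this show "\<forall>\<^sub>F a in at 0. dist (\<alpha> * m a / a\<^sup>2) (- \<beta>) < e"
        by (auto simp: dist_real_def elim!: eventually_mono)
    qed
    show "((\<lambda>a. g\<^sub>1 a (m a) / a\<^sup>2) \<longlongrightarrow> 2 * \<beta>) (at 0)"
    proof (rule tendstoI)
      fix e :: real assume "e > 0"
      from bound[of "e / 4"] this show "\<forall>\<^sub>F a in at 0. dist (g\<^sub>1 a (m a) / a\<^sup>2) (2 * \<beta>) < e"
        by (auto simp: dist_real_def elim!: eventually_mono)
    qed
  qed
  \<comment> \<open>h is (X a / a)^2. Division by zero would give h 0 = 0, so \<open>\<xi>\<close>
    takes the limit value 1 there; writing X as a times a positive factor gives it the sign of
    a.\<close>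
  define h where "h a = - \<alpha> * m a / (\<beta> * a\<^sup>2)" for a
  define \<xi> where "\<xi> a = (if a = 0 then 1 else sqrt (h a))" for a
  define X where "X a = a * \<xi> a" for a
  \<comment> \<open>Differentiating \<beta> X^2 = - \<alpha> m gives 2 \<beta> X X' = - \<alpha> m';
    inserting \<open>m'\<close> and X = a \<open>\<xi>\<close> yields this formula.\<close>
  define X' where "X' a = (if a = 0 then 1 else g\<^sub>1 a (m a) / a\<^sup>2 / (\<beta> * D a (m a) (m a)) / (2 * \<xi> a))" for a
  have h_lim: "(h \<longlongrightarrow> 1) (at 0)"
  proof -
    have "((\<lambda>a. - (\<alpha> * m a / a\<^sup>2) / \<beta>) \<longlongrightarrow> - (- \<beta>) / \<beta>) (at 0)"
      using \<beta> by (intro tendsto_intros lims)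
    then show ?thesis using \<beta> by (simp add: h_def[abs_def] mult.commute)
  qed
  have \<xi>_lim: "(\<xi> \<longlongrightarrow> 1) (at 0)"
  proof -
    have "((\<lambda>a. sqrt (h a)) \<longlongrightarrow> 1) (at 0)" using tendsto_real_sqrt[OF h_lim] by simp
    then show ?thesis
      by (rule Lim_transform_eventually) (auto simp: \<xi>_def eventually_at_filter)
  qed
  have X'_lim: "(X' \<longlongrightarrow> 1) (at 0)"
  proof -
    have "((\<lambda>a. D a (m a) (m a)) \<longlongrightarrow> 1) (at 0)"
      using Dm_cont(2)[of 0] r\<^sub>1 m0 D0 by (simp add: isCont_def)
    then have "((\<lambda>a. g\<^sub>1 a (m a) / a\<^sup>2 / (\<beta> * D a (m a) (m a)) / (2 * \<xi> a)) \<longlongrightarrow>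
        2 * \<beta> / (\<beta> * 1) / (2 * 1)) (at 0)"
      using \<beta> by (intro tendsto_intros lims \<xi>_lim) auto
    then have "((\<lambda>a. g\<^sub>1 a (m a) / a\<^sup>2 / (\<beta> * D a (m a) (m a)) / (2 * \<xi> a)) \<longlongrightarrow> 1) (at 0)"
      using \<beta> by simp
    then show ?thesis
      by (rule Lim_transform_eventually) (auto simp: X'_def eventually_at_filter)
  qed
  have "\<forall>\<^sub>F a in at 0. h a > 0 \<and> X' a > 0"
    using order_tendstoD(1)[OF h_lim, of 0] order_tendstoD(1)[OF X'_lim, of 0]
    by (auto intro: eventually_conj)
  then obtain r\<^sub>2 where r\<^sub>2: "r\<^sub>2 > 0" "\<And>a. a \<noteq> 0 \<Longrightarrow> \<bar>a\<bar> < r\<^sub>2 \<Longrightarrow> h a > 0 \<and> X' a > 0"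
    unfolding eventually_at by (auto simp: dist_real_def)
  define r where "r = min r\<^sub>1 r\<^sub>2"
  have r: "0 < r" "r \<le> r\<^sub>1" "r \<le> r\<^sub>0" "r \<le> d" "r \<le> r\<^sub>2" using r\<^sub>0 r\<^sub>1 r\<^sub>2 by (auto simp: r_def)
  have \<xi>_pos: "\<xi> a > 0" if "\<bar>a\<bar> < r" for a
    using r\<^sub>2(2)[of a] that r by (auto simp: \<xi>_def)
  have \<xi>_cont: "isCont \<xi> a" if "\<bar>a\<bar> < r" for a
  proof (cases "a = 0")
    case True
    then show ?thesis using \<xi>_lim by (simp add: isCont_def \<xi>_def)
  next
    case False
    have "isCont (\<lambda>a. sqrt (h a)) a"
      unfolding h_def using False \<beta> that r by (auto intro!: continuous_intros m_cont)
    moreover have "\<forall>\<^sub>F x in nhds a. x \<in> - {0}"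
      using False by (intro eventually_nhds_in_open) auto
    then have "\<forall>\<^sub>F x in nhds a. \<xi> x = sqrt (h x)"
      by (rule eventually_mono) (auto simp: \<xi>_def)
    moreover note isCont_cong[OF this]
    ultimately show ?thesis by blast
  qed
  have X': "(X has_real_derivative X' a) (at a)" if "\<bar>a\<bar> < r" for a
  proof (cases "a = 0")
    case True
    \<comment> \<open>At 0 only continuity of \<open>\<xi>\<close> is at hand, and it suffices
      because the factor a vanishes there.\<close>
    have "((\<lambda>a. a * \<xi> a) has_real_derivative 1 * \<xi> 0) (at 0)"
      using \<xi>_cont[of 0] r by (intro DERIV_mult_isCont) (auto intro!: derivative_eq_intros)
    then show ?thesis using True by (simp add: X_def[abs_def] X'_def \<xi>_def)
  next
    case False
    have ha: "h a > 0" using r\<^sub>2(2)[OF False] that r by simp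
    have Da: "D a (m a) (m a) > 1 / 2" using D_half[of a "m a" "m a"] m_bd[of a] that r r\<^sub>1 by simp
    have "(h has_real_derivative - \<alpha> * m' a / (\<beta> * a\<^sup>2) - 2 * h a / a) (at a)"
      unfolding h_def[abs_def] using False \<beta> that r
      by (auto intro!: derivative_eq_intros m' simp: divide_simps power2_eq_square) (simp add: algebra_simps)
    then have "((\<lambda>a. a * sqrt (h a)) has_real_derivative
        sqrt (h a) + a * ((- \<alpha> * m' a / (\<beta> * a\<^sup>2) - 2 * h a / a) * (inverse (sqrt (h a)) / 2))) (at a)"
      using ha by (auto intro!: derivative_eq_intros)
    moreover have "sqrt (h a) + a * ((- \<alpha> * m' a / (\<beta> * a\<^sup>2) - 2 * h a / a) * (inverse (sqrt (h a)) / 2)) = X' a"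
    proof -
      have s: "sqrt (h a) > 0" using ha by simp
      have "a * ((- \<alpha> * m' a / (\<beta> * a\<^sup>2) - 2 * h a / a) * (inverse (sqrt (h a)) / 2))
         = - \<alpha> * m' a / (\<beta> * a) / (2 * sqrt (h a)) - h a / sqrt (h a)"
        using False s \<beta> by (simp add: divide_simps power2_eq_square)
      also have "h a / sqrt (h a) = sqrt (h a)" using ha by (simp add: real_div_sqrt)
      also have "- \<alpha> * m' a / (\<beta> * a) = g\<^sub>1 a (m a) / a\<^sup>2 / (\<beta> * D a (m a) (m a))"
        using False \<alpha> \<beta> Da by (simp add: m'_def divide_simps power2_eq_square)
      finally have "a * ((- \<alpha> * m' a / (\<beta> * a\<^sup>2) - 2 * h a / a) * (inverse (sqrt (h a)) / 2))
         = g\<^sub>1 a (m a) / a\<^sup>2 / (\<beta> * D a (m a) (m a)) / (2 * sqrt (h a)) - sqrt (h a)" .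
      moreover have "X' a = g\<^sub>1 a (m a) / a\<^sup>2 / (\<beta> * D a (m a) (m a)) / (2 * sqrt (h a))"
        by (simp only: X'_def \<xi>_def False if_False)
      ultimately show ?thesis by linarith
    qed
    ultimately have "((\<lambda>a. a * sqrt (h a)) has_real_derivative X' a) (at a)" by simp
    then show ?thesis
      by (rule has_field_derivative_transform_within_open[where S = "- {0}"])
        (use False in \<open>auto simp: X_def \<xi>_def\<close>)
  qed
  have X'_cont: "isCont X' a" if "\<bar>a\<bar> < r" for a
  proof (cases "a = 0")
    case True
    then show ?thesis using X'_lim by (simp add: isCont_def X'_def)
  next
    case False
    have Da: "D a (m a) (m a) > 1 / 2" using D_half[of a "m a" "m a"] m_bd[of a] that r r\<^sub>1 by simp
    have "isCont (\<lambda>(a, \<mu>). g\<^sub>1 a \<mu>) (a, m a)"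
      by (rule continuous_on_open_imp_isCont[OF g1_cont])
        (use that r m_bd[of a] r\<^sub>0 in \<open>auto simp: open_Times\<close>)
    then have "isCont (\<lambda>a. g\<^sub>1 a (m a)) a"
      using isCont_o2[where a = a and f = "\<lambda>a. (a, m a)" and g = "\<lambda>(a, \<mu>). g\<^sub>1 a \<mu>"] m_cont[of a] that r by (simp add: isCont_Pair)
    then have "isCont (\<lambda>a. g\<^sub>1 a (m a) / a\<^sup>2 / (\<beta> * D a (m a) (m a)) / (2 * \<xi> a)) a"
      using False \<beta> that r Da \<xi>_pos[OF that] by (auto intro!: continuous_intros Dm_cont \<xi>_cont)
    moreover have "\<forall>\<^sub>F x in nhds a. x \<in> - {0}"
      using False by (intro eventually_nhds_in_open) auto
    then have "\<forall>\<^sub>F x in nhds a. X' x = g\<^sub>1 x (m x) / x\<^sup>2 / (\<beta> * D x (m x) (m x)) / (2 * \<xi> x)"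
      by (rule eventually_mono) (auto simp: X'_def)
    moreover note isCont_cong[OF this]
    ultimately show ?thesis by blast
  qed
  have X_sq: "\<beta> * (X a)\<^sup>2 = - \<alpha> * m a" if "\<bar>a\<bar> < r" for a
    using r\<^sub>2(2)[of a] that r m0 \<beta> by (cases "a = 0") (auto simp: X_def \<xi>_def h_def power_mult_distrib)
  show thesis
  \<comment> \<open>From g = \<alpha> a (\<mu> - m a) D and X a = a \<open>\<xi> a\<close>, the
    positive factor in front of X (\<alpha> \<mu> + \<beta> X^2) must be D /
    \<open>\<xi>\<close>.\<close>
  proof (rule that[of r X X' "\<lambda>a \<mu>. D a (m a) \<mu> / \<xi> a"])
    show "X' a > 0" if "\<bar>a\<bar> < r" for a using r\<^sub>2(2)[of a] that r by (cases "a = 0") (auto simp: X'_def)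
    show "continuous_on {-r<..<r} X'"
      by (rule continuous_at_imp_continuous_on) (auto intro!: X'_cont)
    show "continuous_on ({-r<..<r} \<times> {-r<..<r}) (\<lambda>(a, \<mu>). D a (m a) \<mu> / \<xi> a)"
    proof (rule continuous_at_imp_continuous_on, safe)
      fix a \<mu> assume "a \<in> {-r<..<r}" "\<mu> \<in> {-r<..<r}"
      then have *: "\<bar>a\<bar> < r" "\<bar>\<mu>\<bar> < r" by auto
      have "isCont (\<lambda>p. (fst p, m (fst p), snd p)) (a, \<mu>)"
        using * r by (intro isCont_Pair isCont_fst isCont_snd isCont_o2[OF _ m_cont]) auto
      moreover have "isCont (\<lambda>(a, m, \<mu>). D a m \<mu>) (a, m a, \<mu>)"
        using * r r\<^sub>0 m_bd[of a] by (intro D_isCont) auto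
      ultimately have "isCont (\<lambda>p. D (fst p) (m (fst p)) (snd p)) (a, \<mu>)"
        using isCont_o2[where f = "\<lambda>p. (fst p, m (fst p), snd p)" and g = "\<lambda>(a, m, \<mu>). D a m \<mu>"
            and a = "(a, \<mu>)"] by simp
      moreover have "isCont (\<lambda>p. \<xi> (fst p)) (a, \<mu>)"
        using * by (intro isCont_o2[OF _ \<xi>_cont]) (auto intro!: continuous_intros)
      ultimately show "isCont (\<lambda>(a, \<mu>). D a (m a) \<mu> / \<xi> a) (a, \<mu>)"
        using \<xi>_pos[OF *(1)] by (auto simp: case_prod_unfold intro!: continuous_intros)
    qed
    show "D a (m a) \<mu> / \<xi> a > 0" if "\<bar>a\<bar> < r" "\<bar>\<mu>\<bar> < r" for a \<mu>
      using D_half[of a "m a" \<mu>] m_bd[of a] \<xi>_pos[OF that(1)] that r by simp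
    show "g a \<mu> = D a (m a) \<mu> / \<xi> a * (X a * (\<alpha> * \<mu> + \<beta> * (X a)\<^sup>2))" if "\<bar>a\<bar> < r" "\<bar>\<mu>\<bar> < r" for a \<mu>
    proof -
      have "g a \<mu> = \<alpha> * a * ((\<mu> - m a) * D a (m a) \<mu>)"
        using gq[of a \<mu>] q_eq[of a \<mu>] that r by simp
      then show ?thesis
        unfolding X_sq[OF that(1)] using \<xi>_pos[OF that(1)] by (simp add: X_def algebra_simps)
    qed
    show "X (- a) = - X a" if "\<bar>a\<bar> < r" for a
      using m_even[of a] that r by (simp add: X_def \<xi>_def h_def)
  qed (use r X' in \<open>auto simp: X_def X'_def\<close>)
qed


lemma leading_terms:
  "(\<lambda>(a, \<mu>). g a \<mu> - a * (\<alpha> * \<mu> + \<beta> * a^2)) \<in> o[at (0, 0)](\<lambda>(a, \<mu>). \<bar>a\<bar> * (\<bar>\<mu>\<bar> + a^2))"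
proof (rule landau_o.smallI)
  fix e :: real assume "e > 0"
  then obtain r where r: "0 < r"
    "\<And>a \<mu>. \<bar>a\<bar> < r \<Longrightarrow> \<bar>\<mu>\<bar> < r \<Longrightarrow> \<bar>g a \<mu> - a * (\<alpha> * \<mu> + \<beta> * a\<^sup>2)\<bar> \<le> e * (\<bar>a\<bar> * (\<bar>\<mu>\<bar> + a\<^sup>2))"
    by (rule taylor) blast
  have "\<forall>\<^sub>F p in at (0, 0). p \<in> {-r<..<r} \<times> {-r<..<r}"
    using r by (intro eventually_at_in_open') (auto simp: open_Times)
  then show "\<forall>\<^sub>F p in at (0, 0). norm (case p of (a, \<mu>) \<Rightarrow> g a \<mu> - a * (\<alpha> * \<mu> + \<beta> * a^2))
      \<le> e * norm (case p of (a, \<mu>) \<Rightarrow> \<bar>a\<bar> * (\<bar>\<mu>\<bar> + a^2))"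
  proof (rule eventually_mono)
    fix p assume "p \<in> {-r<..<r} \<times> {-r<..<r}"
    then have "\<bar>fst p\<bar> < r" "\<bar>snd p\<bar> < r" by auto
    from r(2)[OF this] show "norm (case p of (a, \<mu>) \<Rightarrow> g a \<mu> - a * (\<alpha> * \<mu> + \<beta> * a^2))
      \<le> e * norm (case p of (a, \<mu>) \<Rightarrow> \<bar>a\<bar> * (\<bar>\<mu>\<bar> + a^2))"
      by (simp add: case_prod_unfold abs_mult)
  qed
qed

lemma equivalent_to_pitchfork: "locally_equivalent g (\<lambda>a \<mu>. a * (\<alpha> * \<mu> + \<beta> * a^2))"
proof -
  obtain r X X' S where r: "0 < r"
    and X': "\<And>a. \<bar>a\<bar> < r \<Longrightarrow> (X has_real_derivative X' a) (at a)"
    and X'_pos: "\<And>a. \<bar>a\<bar> < r \<Longrightarrow> X' a > 0" and X'_cont: "continuous_on {-r<..<r} X'"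
    and X0: "X 0 = (0::real)"
    and S_cont: "continuous_on ({-r<..<r} \<times> {-r<..<r}) (\<lambda>(a, \<mu>). S a \<mu>)"
    and S_pos: "\<And>a \<mu>. \<bar>a\<bar> < r \<Longrightarrow> \<bar>\<mu>\<bar> < r \<Longrightarrow> S a \<mu> > 0"
    and g_eq: "\<And>a \<mu>. \<bar>a\<bar> < r \<Longrightarrow> \<bar>\<mu>\<bar> < r \<Longrightarrow> g a \<mu> = S a \<mu> * (X a * (\<alpha> * \<mu> + \<beta> * (X a)\<^sup>2))"
    by (rule normal_form) blast
  let ?W = "{-r<..<r} \<times> {-r<..<r}"
  have W: "open ?W" by (simp add: open_Times)
  have "Ck_on (Suc 0) (\<lambda>(a, \<mu>). X a) ?W"
  proof (rule Ck_on_SucI[OF W, where f' = "\<lambda>p v. X' (fst p) * fst v"])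
    fix p :: "real \<times> real" assume "p \<in> ?W"
    then have "\<bar>fst p\<bar> < r" by auto
    then have "(X has_derivative (\<lambda>h. X' (fst p) * h)) (at (fst p))"
      using X' by (simp add: has_field_derivative_def)
    from has_derivative_compose[OF has_derivative_fst[OF has_derivative_ident] this]
    show "((\<lambda>(a, \<mu>). X a) has_derivative (\<lambda>v. X' (fst p) * fst v)) (at p)"
      by (simp add: case_prod_unfold)
  next
    fix v :: "real \<times> real"
    have "continuous_on ?W (\<lambda>p. X' (fst p))"
      by (rule continuous_on_compose2[OF X'_cont]) (auto intro!: continuous_intros)
    then show "Ck_on 0 (\<lambda>p. X' (fst p) * fst v) ?W" by (auto intro!: continuous_intros)
  qed
  moreover have "deriv X a > 0" if "\<bar>a\<bar> < r" for a
    using DERIV_imp_deriv[OF X'[OF that]] X'_pos[OF that] by simp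
  ultimately show ?thesis
    unfolding locally_equivalent_def
    by (intro exI[of _ ?W] exI[of _ S] exI[of _ "\<lambda>a \<mu>. X a"])
      (use W r X0 S_cont S_pos g_eq in \<open>auto simp: abs_less_iff\<close>)
qed

text \<open>In the coordinate X the nontrivial zeros are X = s and X = - s with s = sqrt(- \<alpha>
  \<mu> / \<beta>). As X is increasing and odd, they pull back to b and - b, and X'(0) = 1 gives b =
  s + o(s). The last two clauses, the sign of \<beta> g on either side of b, prepare a first
  derivative test for the potential.\<close>

lemma branches:
  obtains \<epsilon> \<delta> b where
    "0 < \<epsilon>" "\<epsilon> \<le> d" "0 < \<delta>" "\<delta> \<le> d"
    "\<And>a \<mu>. \<bar>a\<bar> < \<delta> \<Longrightarrow> \<bar>\<mu>\<bar> < \<epsilon> \<Longrightarrow>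
       g a \<mu> = 0 \<longleftrightarrow> a = 0 \<or> - \<alpha> * \<mu> / \<beta> > 0 \<and> (a = b \<mu> \<or> a = - b \<mu>)"
    "\<And>\<mu>. \<bar>\<mu>\<bar> < \<epsilon> \<Longrightarrow> - \<alpha> * \<mu> / \<beta> > 0 \<Longrightarrow> 0 < b \<mu> \<and> b \<mu> < \<delta>"
    "continuous_on {\<mu>. \<bar>\<mu>\<bar> < \<epsilon> \<and> - \<alpha> * \<mu> / \<beta> > 0} b"
    "(\<lambda>\<mu>. b \<mu> - sqrt (- \<alpha> * \<mu> / \<beta>)) \<in> o[at 0 within {\<mu>. - \<alpha> * \<mu> / \<beta> > 0}](\<lambda>\<mu>. \<bar>\<mu>\<bar> powr (1/2))"
    "\<And>a \<mu>. \<bar>\<mu>\<bar> < \<epsilon> \<Longrightarrow> - \<alpha> * \<mu> / \<beta> > 0 \<Longrightarrow> 0 < a \<Longrightarrow> a < b \<mu> \<Longrightarrow> \<beta> * g a \<mu> < 0"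
    "\<And>a \<mu>. \<bar>\<mu>\<bar> < \<epsilon> \<Longrightarrow> - \<alpha> * \<mu> / \<beta> > 0 \<Longrightarrow> b \<mu> < a \<Longrightarrow> a < \<delta> \<Longrightarrow> \<beta> * g a \<mu> > 0"
proof -
  obtain r X X' S where r: "0 < r" "r \<le> d"
    and X': "\<And>a. \<bar>a\<bar> < r \<Longrightarrow> (X has_real_derivative X' a) (at a)"
    and X'_pos: "\<And>a. \<bar>a\<bar> < r \<Longrightarrow> X' a > 0"
    and X0: "X 0 = (0::real)" "X' 0 = 1"
    and S_pos: "\<And>a \<mu>. \<bar>a\<bar> < r \<Longrightarrow> \<bar>\<mu>\<bar> < r \<Longrightarrow> S a \<mu> > 0"
    and g_eq: "\<And>a \<mu>. \<bar>a\<bar> < r \<Longrightarrow> \<bar>\<mu>\<bar> < r \<Longrightarrow> g a \<mu> = S a \<mu> * (X a * (\<alpha> * \<mu> + \<beta> * (X a)\<^sup>2))"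
    and X_odd: "\<And>a. \<bar>a\<bar> < r \<Longrightarrow> X (- a) = - X a"
    by (rule normal_form) blast
  have X_mono: "X a < X b" if "a < b" "\<bar>a\<bar> < r" "\<bar>b\<bar> < r" for a b
  proof (rule DERIV_pos_imp_increasing[OF that(1)])
    fix x assume "a \<le> x" "x \<le> b"
    then have "\<bar>x\<bar> < r" using that by auto
    then show "\<exists>y. (X has_real_derivative y) (at x) \<and> 0 < y" using X' X'_pos by blast
  qed
  have X_inj: "X a = X b \<longleftrightarrow> a = b" if "\<bar>a\<bar> < r" "\<bar>b\<bar> < r" for a b
    using X_mono[of a b] X_mono[of b a] that by (cases a b rule: linorder_cases) auto
  have near: "\<exists>\<eta>>0. \<forall>a. \<bar>a\<bar> < \<eta> \<longrightarrow> \<bar>X a - a\<bar> \<le> e * \<bar>a\<bar>" if "e > 0" for e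
  proof -
    have "(X has_derivative times 1) (at 0)"
      using X'[of 0] r X0 by (simp add: has_field_derivative_def)
    then show ?thesis using that X0 unfolding has_derivative_at_alt by auto
  qed
  obtain \<eta> where \<eta>: "\<eta> > 0" "\<And>a. \<bar>a\<bar> < \<eta> \<Longrightarrow> \<bar>X a - a\<bar> \<le> 1 / 2 * \<bar>a\<bar>"
    using near[of "1 / 2"] by auto
  define \<delta> where "\<delta> = min (r / 2) (\<eta> / 2)"
  have \<delta>: "0 < \<delta>" "\<delta> < r" "\<delta> < \<eta>" using r \<eta> by (auto simp: \<delta>_def)
  define c where "c = \<bar>\<alpha>\<bar> / \<bar>\<beta>\<bar>"
  have c: "c > 0" using \<alpha> \<beta> by (simp add: c_def)
  have X\<delta>: "X \<delta> > 0" using X_mono[of 0 \<delta>] \<delta> X0 by simp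
  \<comment> \<open>Since s^2 = c |\<mu>|, this bound says s < X \<delta>, so that s has a preimage
    under X strictly between 0 and \<delta>.\<close>
  define \<epsilon> where "\<epsilon> = min r ((X \<delta>)\<^sup>2 / c)"
  have \<epsilon>: "0 < \<epsilon>" "\<epsilon> \<le> r" using r c X\<delta> by (auto simp: \<epsilon>_def)
  let ?P = "{\<mu>. \<bar>\<mu>\<bar> < \<epsilon> \<and> - \<alpha> * \<mu> / \<beta> > 0}"
  define s where "s \<mu> = sqrt (- \<alpha> * \<mu> / \<beta>)" for \<mu>
  have s_eq: "s \<mu> = sqrt c * sqrt \<bar>\<mu>\<bar>" if "- \<alpha> * \<mu> / \<beta> > 0" for \<mu>
  proof -
    have "- \<alpha> * \<mu> / \<beta> = \<bar>- \<alpha> * \<mu> / \<beta>\<bar>" by (rule abs_of_pos[OF that, symmetric])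
    also have "\<dots> = c * \<bar>\<mu>\<bar>" by (simp add: c_def abs_mult)
    finally show ?thesis by (simp add: s_def real_sqrt_mult)
  qed
  have s_bd: "0 < s \<mu> \<and> s \<mu> < X \<delta>" if "\<mu> \<in> ?P" for \<mu>
  proof -
    have "c * \<bar>\<mu>\<bar> < (X \<delta>)\<^sup>2"
      using that c by (simp add: \<epsilon>_def pos_less_divide_eq mult.commute)
    then have "sqrt (c * \<bar>\<mu>\<bar>) < sqrt ((X \<delta>)\<^sup>2)" by (rule real_sqrt_less_mono)
    then have "s \<mu> < X \<delta>" using that s_eq[of \<mu>] X\<delta> by (simp add: real_sqrt_mult)
    moreover have "0 < s \<mu>" using that by (simp add: s_def)
    ultimately show ?thesis by simp
  qed
  have X_cont: "continuous_on {0..\<delta>} X"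
  proof (rule DERIV_continuous_on)
    fix x assume "x \<in> {0..\<delta>}"
    then show "(X has_real_derivative X' x) (at x within {0..\<delta>})"
      using \<delta> by (intro has_field_derivative_at_within[OF X']) auto
  qed
  have X_inj_on: "inj_on X {0..\<delta>}"
    using X_inj \<delta> by (auto simp: inj_on_def)
  define b where "b \<mu> = inv_into {0..\<delta>} X (s \<mu>)" for \<mu>
  have s_in: "s \<mu> \<in> X ` {0..\<delta>}" if "\<mu> \<in> ?P" for \<mu>
    using IVT'[of X 0 "s \<mu>" \<delta>] s_bd[OF that] \<delta> X0 X_cont by force
  have Xb: "X (b \<mu>) = s \<mu>" "b \<mu> \<in> {0..\<delta>}" if "\<mu> \<in> ?P" for \<mu>
    using f_inv_into_f[OF s_in[OF that]] inv_into_into[OF s_in[OF that]] by (auto simp: b_def)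
  have b_bd: "0 < b \<mu> \<and> b \<mu> < \<delta>" if "\<mu> \<in> ?P" for \<mu>
    using s_bd[OF that] Xb[OF that] X0 by (cases "b \<mu> = 0"; cases "b \<mu> = \<delta>") auto
  have factor: "\<alpha> * \<mu> + \<beta> * (X a)\<^sup>2 = \<beta> * ((X a)\<^sup>2 - - \<alpha> * \<mu> / \<beta>)" for a \<mu>
    using \<beta> by (simp add: field_simps)
  have factor': "\<alpha> * \<mu> + \<beta> * (X a)\<^sup>2 = \<beta> * ((X a - s \<mu>) * (X a + s \<mu>))" if "\<mu> \<in> ?P" for a \<mu>
  proof -
    have "- \<alpha> * \<mu> / \<beta> \<ge> 0" using that by (simp only: mem_Collect_eq less_imp_le)
    from real_sqrt_pow2[OF this] have "- \<alpha> * \<mu> / \<beta> = s \<mu> * s \<mu>"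
      by (simp only: s_def power2_eq_square)
    then show ?thesis unfolding factor by (simp add: power2_eq_square algebra_simps)
  qed
  have b_cont: "continuous_on ?P b"
  proof -
    have "continuous_on (X ` {0..\<delta>}) (inv_into {0..\<delta>} X)"
      by (rule continuous_on_inv[OF X_cont]) (simp_all add: inv_into_f_f[OF X_inj_on])
    moreover have "continuous_on ?P s" unfolding s_def using \<beta> by (intro continuous_intros) auto
    ultimately show ?thesis
      unfolding b_def by (rule continuous_on_compose2) (use s_in in blast)
  qed
  have b_small: "(\<lambda>\<mu>. b \<mu> - s \<mu>) \<in> o[at 0 within {\<mu>. - \<alpha> * \<mu> / \<beta> > 0}](\<lambda>\<mu>. \<bar>\<mu>\<bar> powr (1/2))"
  proof (rule landau_o.smallI)
    fix e :: real assume e: "e > 0"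
    \<comment> \<open>Chosen so that e' (2 s) = e sqrt |\<mu>|, using s = sqrt c sqrt |\<mu>| and b
      <= 2 s.\<close>
    define e' where "e' = e / (2 * sqrt c)"
    have e': "e' > 0" using e c by (simp add: e'_def)
    obtain \<rho> where \<rho>: "\<rho> > 0" "\<And>a. \<bar>a\<bar> < \<rho> \<Longrightarrow> \<bar>X a - a\<bar> \<le> e' * \<bar>a\<bar>"
      using near[OF e'] by auto
    \<comment> \<open>Forces s < \<rho> / 2, hence b <= 2 s < \<rho>, where the finer estimate of X
      applies.\<close>
    define \<tau> where "\<tau> = min \<epsilon> ((\<rho> / 2)\<^sup>2 / c)"
    have \<tau>: "\<tau> > 0" using \<epsilon> \<rho> c by (simp add: \<tau>_def)
    show "\<forall>\<^sub>F \<mu> in at 0 within {\<mu>. - \<alpha> * \<mu> / \<beta> > 0}. norm (b \<mu> - s \<mu>) \<le> e * norm (\<bar>\<mu>\<bar> powr (1/2))"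
      unfolding eventually_at
    proof (intro exI[of _ \<tau>] conjI \<tau> ballI impI)
      fix \<mu> assume "\<mu> \<in> {\<mu>. - \<alpha> * \<mu> / \<beta> > 0}" "\<mu> \<noteq> 0 \<and> dist \<mu> 0 < \<tau>"
      then have \<mu>: "\<mu> \<in> ?P" "\<bar>\<mu>\<bar> < (\<rho> / 2)\<^sup>2 / c" by (auto simp: \<tau>_def dist_real_def)
      have "c * \<bar>\<mu>\<bar> < (\<rho> / 2)\<^sup>2" using \<mu>(2) c by (simp add: pos_less_divide_eq mult.commute)
      then have "sqrt (c * \<bar>\<mu>\<bar>) < sqrt ((\<rho> / 2)\<^sup>2)" by (rule real_sqrt_less_mono)
      then have s\<rho>: "s \<mu> < \<rho> / 2" using \<mu> s_eq[of \<mu>] \<rho>(1) by (simp add: real_sqrt_mult)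
      have "\<bar>s \<mu> - b \<mu>\<bar> \<le> 1 / 2 * b \<mu>"
        using \<eta>(2)[of "b \<mu>"] b_bd[OF \<mu>(1)] \<delta> Xb(1)[OF \<mu>(1)] by simp
      then have b2: "b \<mu> \<le> 2 * s \<mu>" by linarith
      have "\<bar>b \<mu> - s \<mu>\<bar> \<le> e' * b \<mu>"
        using \<rho>(2)[of "b \<mu>"] b2 s\<rho> b_bd[OF \<mu>(1)] Xb(1)[OF \<mu>(1)] by (simp add: abs_minus_commute)
      also have "\<dots> \<le> e' * (2 * s \<mu>)" using b2 e' by simp
      also have "\<dots> = e * sqrt \<bar>\<mu>\<bar>" using s_eq[of \<mu>] \<mu>(1) c by (simp add: e'_def)
      finally show "norm (b \<mu> - s \<mu>) \<le> e * norm (\<bar>\<mu>\<bar> powr (1/2))" by (simp add: powr_half_sqrt)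
    qed
  qed
  show thesis
  proof (rule that[of \<epsilon> \<delta> b])
    fix a \<mu> assume *: "\<bar>a\<bar> < \<delta>" "\<bar>\<mu>\<bar> < \<epsilon>"
    then have "\<bar>a\<bar> < r" "\<bar>\<mu>\<bar> < r" using \<delta> \<epsilon> by auto
    then have "g a \<mu> = 0 \<longleftrightarrow> X a = 0 \<or> \<alpha> * \<mu> + \<beta> * (X a)\<^sup>2 = 0"
      using g_eq S_pos[of a \<mu>] by simp
    also have "X a = 0 \<longleftrightarrow> a = 0" using X_inj[of a 0] X0 \<open>\<bar>a\<bar> < r\<close> r by simp
    finally have zero: "g a \<mu> = 0 \<longleftrightarrow> a = 0 \<or> \<alpha> * \<mu> + \<beta> * (X a)\<^sup>2 = 0" .
    show "g a \<mu> = 0 \<longleftrightarrow> a = 0 \<or> - \<alpha> * \<mu> / \<beta> > 0 \<and> (a = b \<mu> \<or> a = - b \<mu>)"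
    proof (cases "- \<alpha> * \<mu> / \<beta> > 0")
      case True
      then have \<mu>: "\<mu> \<in> ?P" using * by simp
      have "\<bar>b \<mu>\<bar> < r" "\<bar>- b \<mu>\<bar> < r" using b_bd[OF \<mu>] \<delta> by auto
      then have "X a = s \<mu> \<longleftrightarrow> a = b \<mu>" "X a = - s \<mu> \<longleftrightarrow> a = - b \<mu>"
        using X_inj[of a "b \<mu>"] X_inj[of a "- b \<mu>"] X_odd[of "b \<mu>"] Xb(1)[OF \<mu>] \<open>\<bar>a\<bar> < r\<close> by simp_all
      then show ?thesis
        unfolding zero factor'[OF \<mu>] using \<beta> True by (auto simp: eq_neg_iff_add_eq_0)
    next
      case False
      have "a = 0" if "\<alpha> * \<mu> + \<beta> * (X a)\<^sup>2 = 0"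
      proof -
        have eq: "(X a)\<^sup>2 = - \<alpha> * \<mu> / \<beta>" using that \<beta> unfolding factor by simp
        have "(X a)\<^sup>2 \<le> 0" unfolding eq using False by linarith
        then have "X a = 0" by simp
        then show ?thesis using X_inj[of a 0] X0 \<open>\<bar>a\<bar> < r\<close> r by simp
      qed
      then show ?thesis using zero False by auto
    qed
  next
    fix a \<mu> assume *: "\<bar>\<mu>\<bar> < \<epsilon>" "- \<alpha> * \<mu> / \<beta> > 0" "0 < a" "a < b \<mu>"
    then have \<mu>: "\<mu> \<in> ?P" by simp
    have ar: "\<bar>a\<bar> < r" "\<bar>\<mu>\<bar> < r" "\<bar>b \<mu>\<bar> < r" using * b_bd[OF \<mu>] \<delta> \<epsilon> by auto
    have "0 < X a" "X a < s \<mu>" using X_mono[of 0 a] X_mono[of a "b \<mu>"] * ar X0 r Xb(1)[OF \<mu>] by auto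
    \<comment> \<open>Multiplying by \<beta> makes the coefficient a square, so the sign is that of
      X a - s whatever the sign of \<beta>.\<close>
    moreover have "\<beta> * g a \<mu> = (\<beta>\<^sup>2 * S a \<mu> * X a * (X a + s \<mu>)) * (X a - s \<mu>)"
      unfolding g_eq[OF ar(1,2)] factor'[OF \<mu>] by (simp add: power2_eq_square algebra_simps)
    ultimately show "\<beta> * g a \<mu> < 0"
      using S_pos[OF ar(1,2)] \<beta>
      by (simp only:) (intro mult_pos_neg mult_pos_pos; simp)
  next
    fix a \<mu> assume *: "\<bar>\<mu>\<bar> < \<epsilon>" "- \<alpha> * \<mu> / \<beta> > 0" "b \<mu> < a" "a < \<delta>"
    then have \<mu>: "\<mu> \<in> ?P" by simp
    have ar: "\<bar>a\<bar> < r" "\<bar>\<mu>\<bar> < r" "\<bar>b \<mu>\<bar> < r" using * b_bd[OF \<mu>] \<delta> \<epsilon> by auto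
    have "0 < s \<mu>" "s \<mu> < X a" using X_mono[of "b \<mu>" a] * ar s_bd[OF \<mu>] Xb(1)[OF \<mu>] by auto
    moreover have "\<beta> * g a \<mu> = (\<beta>\<^sup>2 * S a \<mu> * X a * (X a + s \<mu>)) * (X a - s \<mu>)"
      unfolding g_eq[OF ar(1,2)] factor'[OF \<mu>] by (simp add: power2_eq_square algebra_simps)
    ultimately show "\<beta> * g a \<mu> > 0"
      using S_pos[OF ar(1,2)] \<beta>
      by (simp only:) (intro mult_pos_pos; simp)
  qed (use \<epsilon> \<delta> r b_bd b_cont b_small in \<open>auto simp: s_def\<close>)
qed

end

section \<open>Inertia of symmetric bilinear forms\<close>

text \<open>If b x y were nonzero, a small step from x along y against its sign would make the form
  negative, since b x x = 0 leaves a linear leading term. The denominator q + 1 keeps the step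
  defined when b y y = 0.\<close>

lemma psd_null:
  fixes b :: "'a::real_vector \<Rightarrow> 'a \<Rightarrow> real"
  assumes "bilinear b" and sym: "\<And>x y. b x y = b y x" and U: "subspace U"
    and psd: "\<And>x. x \<in> U \<Longrightarrow> b x x \<ge> 0" and x: "x \<in> U" "b x x = 0" and y: "y \<in> U"
  shows "b x y = 0"
proof (rule ccontr)
  assume k: "b x y \<noteq> 0"
  define q where "q = b y y"
  have q: "q \<ge> 0" using psd y by (simp add: q_def)
  define s where "s = - b x y / (q + 1)"
  have "0 \<le> b (x + s *\<^sub>R y) (x + s *\<^sub>R y)"
    by (intro psd subspace_add[OF U] subspace_scale[OF U] x y)
  also have "\<dots> = 2 * s * b x y + s\<^sup>2 * q"
    using x(2) sym[of y x] assms(1)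
    by (simp add: bilinear_ladd bilinear_radd bilinear_lmul bilinear_rmul q_def power2_eq_square)
  also have "\<dots> = - (b x y)\<^sup>2 * (q + 2) / (q + 1)\<^sup>2"
  proof -
    have "q + 1 \<noteq> 0" using q by simp
    then show ?thesis by (simp add: s_def divide_simps) (simp add: power2_eq_square algebra_simps)
  qed
  also have "\<dots> < 0" using k q by (intro divide_neg_pos mult_neg_pos) auto
  finally show False by simp
qed

lemma continuous_on_bilinear_diag:
  fixes b :: "'a::euclidean_space \<Rightarrow> 'a \<Rightarrow> real"
  assumes "bilinear b"
  shows "continuous_on S (\<lambda>x. b x x)"
  using assms unfolding bilinear_conv_bounded_bilinear
  by (rule bounded_bilinear.continuous_on) (auto intro: continuous_intros)

lemma compact_unit_sphere_Int: "subspace S \<Longrightarrow> compact {x \<in> S. norm x = (1::real)}"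
  for S :: "'a::euclidean_space set"
proof -
  assume "subspace S"
  then have "compact (sphere 0 1 \<inter> S)" by (intro compact_Int_closed closed_subspace) auto
  moreover have "sphere 0 1 \<inter> S = {x \<in> S. norm x = 1}" by (auto simp: dist_norm)
  ultimately show ?thesis by simp
qed

text \<open>The constant is the minimum of b x x on the compact unit sphere of S. A trivial S has an
  empty sphere and is treated apart.\<close>

lemma bilinear_coercive:
  fixes b :: "'a::euclidean_space \<Rightarrow> 'a \<Rightarrow> real"
  assumes b: "bilinear b" and S: "subspace S" and pos: "\<And>x. x \<in> S \<Longrightarrow> x \<noteq> 0 \<Longrightarrow> b x x > 0"
  obtains c where "c > 0" "\<And>x. x \<in> S \<Longrightarrow> b x x \<ge> c * (norm x)\<^sup>2"
proof (cases "{x \<in> S. norm x = 1} = {}")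
  case True
  have "x = 0" if "x \<in> S" for x
  proof (rule ccontr)
    assume "x \<noteq> 0"
    then have "x /\<^sub>R norm x \<in> {x \<in> S. norm x = 1}" using that S by (simp add: subspace_scale)
    then show False using True by blast
  qed
  then show ?thesis using that[of 1] bilinear_lzero[OF b] by force
next
  case False
  then obtain e where e: "e \<in> {x \<in> S. norm x = 1}" "\<And>y. y \<in> {x \<in> S. norm x = 1} \<Longrightarrow> b e e \<le> b y y"
    using continuous_attains_inf[OF compact_unit_sphere_Int[OF S] False continuous_on_bilinear_diag[OF b]]
    by blast
  have "b x x \<ge> b e e * (norm x)\<^sup>2" if x: "x \<in> S" for x
  proof (cases "x = 0")
    case False
    have "b e e \<le> b (x /\<^sub>R norm x) (x /\<^sub>R norm x)"
      using False x S by (intro e(2)) (simp add: subspace_scale)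
    then show ?thesis using False
      by (simp add: bilinear_lmul[OF b] bilinear_rmul[OF b] field_simps power2_eq_square)
  qed (simp add: bilinear_lzero[OF b])
  moreover have "b e e > 0" using e(1) by (intro pos) auto
  ultimately show ?thesis using that by blast
qed

lemma dim_disjoint_subspaces:
  fixes S T :: "'a::euclidean_space set"
  assumes "subspace S" "subspace T" "S \<inter> T \<subseteq> {0}"
  shows "dim S + dim T \<le> DIM('a)"
proof -
  have "dim (S \<inter> T) = 0" using assms(3) by simp
  then have "dim {x + y |x y. x \<in> S \<and> y \<in> T} = dim S + dim T"
    using dim_sums_Int[OF assms(1,2)] by linarith
  then show ?thesis using dim_subset_UNIV[of "{x + y |x y. x \<in> S \<and> y \<in> T}"] by simp
qed

section \<open>Representation and complements for an inner product other than the Euclidean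
  one\<close>

locale inner_form =
  fixes G :: "'a::euclidean_space \<Rightarrow> 'a \<Rightarrow> real"
  assumes bilinear_G: "bilinear G" and G_sym: "G x y = G y x" and G_pos: "x \<noteq> 0 \<Longrightarrow> G x x > 0"
begin

lemma G_zero: "(\<And>y. G x y = 0) \<Longrightarrow> x = 0"
  using G_pos[of x] by auto

text \<open>The sum is the Gram operator of G applied to x. It turns statements about G into
  statements about the Euclidean product.\<close>

lemma G_representation: "G x y = (\<Sum>b\<in>Basis. G x b *\<^sub>R b) \<bullet> y"
proof -
  have "G x y = (\<Sum>b\<in>Basis. (y \<bullet> b) *\<^sub>R G x b)"
    using bilinear_G by (intro linear_Basis_expansion) (simp add: bilinear_def)
  then show ?thesis by (simp add: inner_sum_left inner_commute[of y] mult.commute)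
qed

lemma linear_G_dual: "linear (\<lambda>x. \<Sum>b\<in>Basis. G x b *\<^sub>R b)"
  using bilinear_G
  by (intro linearI) (simp_all add: bilinear_ladd bilinear_lmul scaleR_add_left sum.distrib scaleR_sum_right)

text \<open>The Gram operator is injective because G is definite, hence surjective in finite
  dimension. The uniqueness part is what gives meaning to the definite descriptions in
  \<open>riem_grad\<close> and \<open>riem_hess\<close>.\<close>

lemma riesz:
  fixes l :: "'a \<Rightarrow> real"
  assumes "linear l"
  shows "\<exists>!z. \<forall>y. G z y = l y"
proof -
  let ?J = "\<lambda>x. \<Sum>b\<in>Basis. G x b *\<^sub>R b"
  have "inj ?J"
    unfolding linear_injective_0[OF linear_G_dual]
  proof (intro allI impI)
    fix x assume "?J x = 0"
    then have "G x y = 0" for y unfolding G_representation[of x y] by simp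
    then show "x = 0" by (rule G_zero)
  qed
  then have "surj ?J" by (rule linear_inj_imp_surj[OF linear_G_dual])
  from surjD[OF this] obtain z where z: "(\<Sum>b\<in>Basis. l b *\<^sub>R b) = ?J z" ..
  have "G z y = l y" for y
    unfolding G_representation[of z y] z[symmetric]
    by (simp add: linear_Basis_expansion[OF assms, of y] inner_sum_left inner_commute[of y] mult.commute)
  moreover have "x = z" if "\<forall>y. G x y = G z y" for x
  proof -
    have "x - z = 0" by (rule G_zero) (use that in \<open>simp add: bilinear_lsub[OF bilinear_G]\<close>)
    then show ?thesis by simp
  qed
  ultimately show ?thesis by metis
qed

lemma subspace_complement: "subspace {y. \<forall>x\<in>N. G x y = 0}"
  using bilinear_G
  by (auto simp: subspace_def bilinear_radd bilinear_rmul bilinear_rzero)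

text \<open>The G-complement of N is the Euclidean complement of the image of N under the Gram
  operator, whose dimension is at most that of N.\<close>

lemma dim_complement:
  assumes "subspace N"
  shows "dim N + dim {y. \<forall>x\<in>N. G x y = 0} \<ge> DIM('a)"
proof -
  let ?J = "\<lambda>x. \<Sum>b\<in>Basis. G x b *\<^sub>R b"
  have "{y. \<forall>x\<in>N. G x y = 0} = {y \<in> UNIV. \<forall>x\<in>?J ` N. orthogonal x y}"
    by (auto simp: orthogonal_def G_representation[symmetric])
  then have "dim {y. \<forall>x\<in>N. G x y = 0} + dim (?J ` N) = dim (UNIV :: 'a set)"
    using dim_subspace_orthogonal_to_vectors[of "?J ` N" UNIV] linear_subspace_image[OF linear_G_dual assms]
    by simp
  moreover have "dim (?J ` N) \<le> dim N" by (rule dim_image_le[OF linear_G_dual])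
  ultimately show ?thesis by simp
qed

end

section \<open>Index of a symmetric form: eigenspaces and Sylvester's law\<close>

locale symmetric_form = inner_form G for G :: "'a::euclidean_space \<Rightarrow> 'a \<Rightarrow> real" +
  fixes b :: "'a \<Rightarrow> 'a \<Rightarrow> real"
  assumes bilinear_b: "bilinear b" and b_sym: "b x y = b y x"
begin

text \<open>The eigenspace of the self-adjoint operator that represents b with respect to G, phrased
  without constructing that operator.\<close>

definition eigenspace :: "real \<Rightarrow> 'a set" where
  "eigenspace r = {x. \<forall>y. b x y = r * G x y}"

definition negative_eigenvalues :: "real set" where
  "negative_eigenvalues = {r. r < 0 \<and> (\<exists>x. x \<noteq> 0 \<and> x \<in> eigenspace r)}"

definition index :: nat where
  "index = (\<Sum>r\<in>negative_eigenvalues. dim (eigenspace r))"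

lemma subspace_eigenspace: "subspace (eigenspace r)"
  using bilinear_G bilinear_b
  by (auto simp: subspace_def eigenspace_def bilinear_ladd bilinear_lmul bilinear_lzero algebra_simps)

lemma eigenspace_orthogonal:
  assumes "x \<in> eigenspace r" "y \<in> eigenspace s" "r \<noteq> s"
  shows "G x y = 0"
proof -
  have "r * G x y = s * G x y"
    using assms(1,2) b_sym[of x y] G_sym[of x y] by (simp add: eigenspace_def)
  then show ?thesis using assms(3) by simp
qed

lemma span_eigenspaces_orthogonal:
  assumes "x \<in> span (\<Union>r\<in>F. eigenspace r)" "y \<in> eigenspace s" "s \<notin> F"
  shows "G x y = 0"
  using assms(1)
proof (induction rule: span_induct)
  case base
  show ?case using bilinear_G by (auto simp: subspace_def bilinear_ladd bilinear_lmul bilinear_lzero)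
next
  case (step x)
  then show ?case using eigenspace_orthogonal assms(2,3) by blast
qed

text \<open>Distinct eigenspaces are G-orthogonal, so dimensions add up; an eigenvector pairs under
  b with a G-orthogonal vector to zero, so the values of b add up too.\<close>

lemma span_eigenspaces:
  assumes "finite F"
  shows "dim (span (\<Union>r\<in>F. eigenspace r)) = (\<Sum>r\<in>F. dim (eigenspace r)) \<and>
    ((\<forall>r\<in>F. r < 0) \<longrightarrow> (\<forall>x\<in>span (\<Union>r\<in>F. eigenspace r). x \<noteq> 0 \<longrightarrow> b x x < 0))"
  using assms
proof (induction F)
  case empty
  then show ?case by simp
next
  case (insert s F)
  let ?N = "span (\<Union>r\<in>F. eigenspace r)"
  have split: "span (\<Union>r\<in>insert s F. eigenspace r) = {x + y |x y. x \<in> eigenspace s \<and> y \<in> ?N}"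
    by (simp add: span_Un span_eq_iff[THEN iffD2, OF subspace_eigenspace])
  have "eigenspace s \<inter> ?N \<subseteq> {0}"
    using span_eigenspaces_orthogonal insert.hyps(2) G_pos by force
  then have "dim (eigenspace s \<inter> ?N) = 0" by simp
  then have "dim {x + y |x y. x \<in> eigenspace s \<and> y \<in> ?N} = dim (eigenspace s) + dim ?N"
    using dim_sums_Int[OF subspace_eigenspace[of s] subspace_span[of "\<Union>r\<in>F. eigenspace r"]] by linarith
  then have "dim (span (\<Union>r\<in>insert s F. eigenspace r)) = (\<Sum>r\<in>insert s F. dim (eigenspace r))"
    unfolding split using insert by simp
  moreover have "b z z < 0" if neg: "\<forall>r\<in>insert s F. r < 0" and z_in: "z \<in> span (\<Union>r\<in>insert s F. eigenspace r)" and "z \<noteq> 0" for z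
  proof -
    obtain x y where z: "z = x + y" and x: "x \<in> eigenspace s" and y: "y \<in> ?N"
      using z_in unfolding split by blast
    have "G y x = 0" using span_eigenspaces_orthogonal[OF y x] insert.hyps(2) by simp
    then have "b x y = 0" using x G_sym[of x y] by (simp add: eigenspace_def)
    then have "b z z = b x x + b y y"
      unfolding z using b_sym[of y x] bilinear_b by (simp add: bilinear_ladd bilinear_radd)
    moreover have x_neg: "b x x < 0" if "x \<noteq> 0"
    proof -
      have "b x x = s * G x x" using x by (simp add: eigenspace_def)
      then show ?thesis using neg G_pos[OF that] by (simp add: mult_neg_pos)
    qed
    moreover have y_neg: "b y y < 0" if "y \<noteq> 0" using insert.IH neg y that by simp
    moreover have "b 0 0 = 0" by (rule bilinear_lzero[OF bilinear_b])
    ultimately show ?thesis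
      using \<open>z \<noteq> 0\<close> z add_neg_neg[of "b x x" "b y y"] by (cases "x = 0"; cases "y = 0") auto
  qed
  ultimately show ?case by blast
qed

text \<open>Each eigenvalue contributes at least one dimension to a direct sum. Finiteness matters
  because the sum in \<open>index\<close> over an infinite set would default to 0.\<close>

lemma finite_negative_eigenvalues: "finite negative_eigenvalues"
proof (rule finite_if_finite_subsets_card_bdd[THEN conjunct1])
  show "F \<subseteq> negative_eigenvalues \<Longrightarrow> finite F \<Longrightarrow> card F \<le> DIM('a)" for F
  proof -
    assume F: "F \<subseteq> negative_eigenvalues" "finite F"
    have "card F = (\<Sum>r\<in>F. 1)" by simp
    also have "\<dots> \<le> (\<Sum>r\<in>F. dim (eigenspace r))"
    proof (rule sum_mono)
      fix r assume "r \<in> F"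
      then have "\<not> eigenspace r \<subseteq> {0}" using F(1) by (auto simp: negative_eigenvalues_def)
      then have "dim (eigenspace r) \<noteq> 0" using dim_eq_0 by blast
      then show "1 \<le> dim (eigenspace r)" by linarith
    qed
    also have "\<dots> \<le> DIM('a)" using span_eigenspaces[OF F(2)] dim_subset_UNIV by metis
    finally show ?thesis .
  qed
qed

text \<open>Let e minimize b x x / G x x on U, with minimum r. Then b - r G is positive semidefinite
  on U and vanishes at e, so \<open>psd_null\<close> makes e an eigenvector relative to U. The
  Euclidean sphere may be used because the quotient is homogeneous of degree 0.\<close>

lemma rayleigh_minimizer:
  assumes U: "subspace U" and x: "x \<in> U" "b x x < 0"
  obtains e r where "e \<in> U" "e \<noteq> 0" "r < 0" "\<And>y. y \<in> U \<Longrightarrow> b e y = r * G e y"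
proof -
  let ?K = "{x \<in> U. norm x = 1}"
  define q where "q x = b x x / G x x" for x
  have q_scale: "q (c *\<^sub>R x) = q x" if "c \<noteq> 0" for c x
    using that by (simp add: q_def bilinear_lmul[OF bilinear_b] bilinear_rmul[OF bilinear_b]
        bilinear_lmul[OF bilinear_G] bilinear_rmul[OF bilinear_G])
  have K: "x /\<^sub>R norm x \<in> ?K" if "x \<in> U" "x \<noteq> 0" for x
    using that U by (simp add: subspace_scale)
  have "x \<noteq> 0" using x bilinear_lzero[OF bilinear_b] by auto
  then have ne: "?K \<noteq> {}" using K x(1) by blast
  have "continuous_on ?K q"
    unfolding q_def
  proof (intro continuous_on_divide continuous_on_bilinear_diag[OF bilinear_b]
        continuous_on_bilinear_diag[OF bilinear_G] ballI)
    fix x assume "x \<in> ?K"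
    then have "x \<noteq> 0" by auto
    then show "G x x \<noteq> 0" using G_pos[of x] by simp
  qed
  then obtain e where e: "e \<in> ?K" "\<And>y. y \<in> ?K \<Longrightarrow> q e \<le> q y"
    using continuous_attains_inf[OF compact_unit_sphere_Int[OF U] ne] by blast
  have le: "q e \<le> q y" if "y \<in> U" "y \<noteq> 0" for y
    using e(2)[OF K[OF that]] q_scale[of "inverse (norm y)" y] that by simp
  have "q x < 0" using x G_pos[OF \<open>x \<noteq> 0\<close>] by (simp add: q_def divide_neg_pos)
  then have neg: "q e < 0" using le[OF x(1) \<open>x \<noteq> 0\<close>] by simp
  have e0: "e \<in> U" "e \<noteq> 0" using e(1) by auto
  have "b e y = q e * G e y" if "y \<in> U" for y
  proof -
    let ?c = "\<lambda>x y. b x y - q e * G x y"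
    have c: "bilinear ?c"
      unfolding bilinear_def
      by (auto intro!: linearI simp: bilinear_ladd[OF bilinear_b] bilinear_ladd[OF bilinear_G]
          bilinear_radd[OF bilinear_b] bilinear_radd[OF bilinear_G] bilinear_lmul[OF bilinear_b]
          bilinear_lmul[OF bilinear_G] bilinear_rmul[OF bilinear_b] bilinear_rmul[OF bilinear_G] algebra_simps)
    have "?c e y = 0"
    proof (rule psd_null[OF c _ U _ e0(1) _ that])
      show "?c x y = ?c y x" for x y using b_sym[of x y] G_sym[of x y] by simp
      show "0 \<le> ?c z z" if "z \<in> U" for z
        using le[OF that] G_pos[of z] bilinear_lzero[OF bilinear_b] bilinear_lzero[OF bilinear_G]
        by (cases "z = 0") (auto simp: q_def pos_le_divide_eq)
      show "?c e e = 0" using G_pos[OF e0(2)] by (simp add: q_def)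
    qed
    then show ?thesis by simp
  qed
  then show ?thesis using that e0 neg by blast
qed

text \<open>N collects the negative eigenspaces and U is its G-complement. A negative value of b on
  U would give a negative eigenvector inside U, which also lies in N, contradicting definiteness of
  G. The clauses on the kernel of b serve the splitting at a simple degeneracy.\<close>

lemma orthogonal_decomposition:
  obtains N U where "subspace N" "subspace U" "dim N = index" "dim N + dim U \<ge> DIM('a)"
    "\<And>x. x \<in> N \<Longrightarrow> x \<noteq> 0 \<Longrightarrow> b x x < 0" "\<And>x. x \<in> U \<Longrightarrow> b x x \<ge> 0"
    "\<And>x y. x \<in> U \<Longrightarrow> b x x = 0 \<Longrightarrow> b x y = 0"
    "\<And>x y. x \<in> N \<Longrightarrow> (\<And>z. b y z = 0) \<Longrightarrow> G x y = 0"
    "\<And>y. (\<And>z. b y z = 0) \<Longrightarrow> y \<in> U"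
proof -
  let ?N = "span (\<Union>r\<in>negative_eigenvalues. eigenspace r)"
  let ?U = "{y. \<forall>x\<in>?N. G x y = 0}"
  note N = span_eigenspaces[OF finite_negative_eigenvalues]
  have U: "subspace ?U" by (rule subspace_complement)
  have orth: "b x y = 0" if "x \<in> ?U" "y \<in> ?N" for x y
    using that(2)
  proof (induction rule: span_induct)
    case base
    show ?case using bilinear_b by (auto simp: subspace_def bilinear_radd bilinear_rmul bilinear_rzero)
  next
    case (step y)
    then obtain r where r: "r \<in> negative_eigenvalues" "y \<in> eigenspace r" by blast
    then have "y \<in> ?N" by (blast intro: span_base)
    then show ?case using r that(1) b_sym[of x y] by (simp add: eigenspace_def)
  qed
  \<comment> \<open>A relation tested only on U holds everywhere: the defect functional is
    represented by some z, it kills N because x is orthogonal to N for both forms, so z lies in U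
    and G z z = 0.\<close>
  have vanish: "b x y = r * G x y" if x: "x \<in> ?U" and *: "\<And>y. y \<in> ?U \<Longrightarrow> b x y = r * G x y" for x y r
  proof -
    have lin: "linear (\<lambda>y. b x y - r * G x y)"
      using bilinear_b bilinear_G unfolding bilinear_def
      by (auto intro!: linearI simp: linear_add linear_cmul algebra_simps)
    obtain z where z: "\<And>y. G z y = b x y - r * G x y" using riesz[OF lin] by blast
    have "z \<in> ?U"
    proof (intro CollectI ballI)
      fix y assume "y \<in> ?N"
      then have "b x y = 0" "G x y = 0" using orth[OF x] x G_sym[of x y] by auto
      then show "G y z = 0" using z[of y] G_sym[of y z] by simp
    qed
    then have "G z z = 0" using z[of z] * by simp
    then have "z = 0" using G_pos[of z] by (metis less_irrefl)
    then show ?thesis using z[of y] bilinear_lzero[OF bilinear_G] by simp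
  qed
  have psd: "b x x \<ge> 0" if x: "x \<in> ?U" for x
  proof (rule ccontr)
    assume "\<not> b x x \<ge> 0"
    then obtain e r where e: "e \<in> ?U" "e \<noteq> 0" "r < 0" "\<And>y. y \<in> ?U \<Longrightarrow> b e y = r * G e y"
      using rayleigh_minimizer[OF U x, of thesis] by (simp add: not_le)
    then have "e \<in> eigenspace r" using vanish[of e r] by (simp add: eigenspace_def)
    then have "e \<in> ?N" using e(2,3) by (intro span_base) (auto simp: negative_eigenvalues_def)
    then show False using e(1,2) G_pos[of e] by auto
  qed
  \<comment> \<open>The kernel is the eigenspace of 0, and 0 is not a negative eigenvalue.\<close>
  have ker: "G x y = 0" if "x \<in> ?N" "\<And>z. b y z = 0" for x y
    by (rule span_eigenspaces_orthogonal[OF that(1), of _ 0])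
      (use that(2) in \<open>auto simp: eigenspace_def negative_eigenvalues_def\<close>)
  show thesis
  proof (rule that[of ?N ?U])
    show "dim ?N = index" using N by (simp only: index_def)
    show "b x y = 0" if "x \<in> ?U" "b x x = 0" for x y
    proof -
      have "b x y = 0 * G x y"
      proof (rule vanish[OF that(1)])
        show "b x y = 0 * G x y" if "y \<in> ?U" for y
          using psd_null[OF bilinear_b b_sym U psd \<open>x \<in> ?U\<close> \<open>b x x = 0\<close> that] by simp
      qed
      then show ?thesis by simp
    qed
    show "b x x < 0" if "x \<in> ?N" "x \<noteq> 0" for x
      using N that by (auto simp: negative_eigenvalues_def)
  qed (use psd ker U dim_complement[OF subspace_span] in auto)
qed

text \<open>Sylvester's law of inertia by counting dimensions: a negative definite and a positive
  semidefinite subspace meet only in 0. Comparing S with U and N with T gives both inequalities, and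
  no condition relates S and T to G.\<close>

lemma index_eqI:
  assumes S: "subspace S" "\<And>x. x \<in> S \<Longrightarrow> x \<noteq> 0 \<Longrightarrow> b x x < 0"
    and T: "subspace T" "\<And>x. x \<in> T \<Longrightarrow> b x x \<ge> 0" and dim: "DIM('a) \<le> dim S + dim T"
  shows "index = dim S"
proof -
  obtain N U where N: "subspace N" "subspace U" "dim N = index" "dim N + dim U \<ge> DIM('a)"
    "\<And>x. x \<in> N \<Longrightarrow> x \<noteq> 0 \<Longrightarrow> b x x < 0" "\<And>x. x \<in> U \<Longrightarrow> b x x \<ge> 0"
    by (rule orthogonal_decomposition) blast
  have "S \<inter> U \<subseteq> {0}" "N \<inter> T \<subseteq> {0}" using S(2) N(5,6) T(2) by (force simp: not_less[symmetric])+
  then have "dim S + dim U \<le> DIM('a)" "dim N + dim T \<le> DIM('a)"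
    using dim_disjoint_subspaces S(1) T(1) N(1,2) by blast+
  then show ?thesis using N(3,4) dim by simp
qed

end

section \<open>Forms with a one-dimensional kernel and their perturbations\<close>

text \<open>The decomposition is taken for the Euclidean product. A null vector of the semidefinite
  part lies in the kernel, so removing the line of v from U makes b positive definite at the cost of
  one dimension.\<close>

lemma simple_kernel_splitting:
  fixes b :: "'a::euclidean_space \<Rightarrow> 'a \<Rightarrow> real"
  assumes b: "bilinear b" "\<And>x y. b x y = b y x" and ker: "{x. \<forall>y. b x y = 0} = span {v}" and v: "norm v = 1"
  obtains N P where "subspace N" "subspace P" "dim N + dim P + 1 \<ge> DIM('a)"
    "\<And>x. x \<in> N \<Longrightarrow> v \<bullet> x = 0" "\<And>x. x \<in> P \<Longrightarrow> v \<bullet> x = 0"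
    "\<And>x. x \<in> N \<Longrightarrow> x \<noteq> 0 \<Longrightarrow> b x x < 0" "\<And>x. x \<in> P \<Longrightarrow> x \<noteq> 0 \<Longrightarrow> b x x > 0"
proof -
  interpret symmetric_form inner b
    by unfold_locales (use b in \<open>auto simp: bilinear_conv_bounded_bilinear bounded_bilinear_inner inner_commute\<close>)
  obtain N U where N: "subspace N" and U: "subspace U" and dim: "dim N + dim U \<ge> DIM('a)"
    and neg: "\<And>x. x \<in> N \<Longrightarrow> x \<noteq> 0 \<Longrightarrow> b x x < 0" and psd: "\<And>x. x \<in> U \<Longrightarrow> b x x \<ge> 0"
    and null: "\<And>x y. x \<in> U \<Longrightarrow> b x x = 0 \<Longrightarrow> b x y = 0"
    and orth: "\<And>x y. x \<in> N \<Longrightarrow> (\<And>z. b y z = 0) \<Longrightarrow> x \<bullet> y = 0"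
    and kerU: "\<And>y. (\<And>z. b y z = 0) \<Longrightarrow> y \<in> U"
    by (rule orthogonal_decomposition) blast
  have bv: "b v z = 0" for z
    using ker span_base[of v "{v}"] by blast
  let ?P = "{y \<in> U. \<forall>x\<in>span {v}. orthogonal x y}"
  have "v \<noteq> 0" using v by auto
  have P: "subspace ?P"
    using U by (auto simp: subspace_def orthogonal_def inner_simps)
  have perp: "v \<bullet> x = 0" if "x \<in> ?P" for x
    using that span_base[of v "{v}"] by (simp add: orthogonal_def)
  have "span {v} \<subseteq> U" using kerU[OF bv] U by (simp add: span_minimal)
  then have "dim ?P + dim (span {v}) = dim U"
    by (intro dim_subspace_orthogonal_to_vectors U subspace_span)
  moreover have "dim (span {v}) \<le> 1" using dim_le_card'[of "{v}"] by simp
  ultimately have "dim N + dim ?P + 1 \<ge> DIM('a)" using dim by simp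
  moreover have "b x x > 0" if x: "x \<in> ?P" "x \<noteq> 0" for x
  proof (rule ccontr)
    assume "\<not> b x x > 0"
    then have "b x x = 0" using psd[of x] x by auto
    then have "x \<in> span {v}" using null[of x] x ker by auto
    then have "orthogonal x x" using x(1) by blast
    then show False using x(2) by (simp add: orthogonal_def)
  qed
  moreover have "v \<bullet> x = 0" if "x \<in> N" for x
    using orth[OF that bv] by (simp add: inner_commute)
  ultimately show thesis using that[of N ?P] N P neg perp by blast
qed

text \<open>
  The vector \<open>z\<close> is \<open>b'\<close>-orthogonal to the complement of \<open>v\<close>, on which \<open>b'\<close> is a small perturbation
  of the nondegenerate restriction of \<open>b\<close>; so the sign of \<open>h = b' z z\<close> decides the index of \<open>b'\<close>.
\<close>

lemma perturbed_simple_kernel: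
  fixes b :: "'a::euclidean_space \<Rightarrow> 'a \<Rightarrow> real"
  assumes b: "bilinear b" "\<And>x y. b x y = b y x" and ker: "{x. \<forall>y. b x y = 0} = span {v}" and v: "norm v = 1"
  obtains m e where "e > 0"
    "\<And>b' z h. bilinear b' \<Longrightarrow> (\<And>x y. b' x y = b' y x) \<Longrightarrow> (\<And>x. \<bar>b' x x - b x x\<bar> \<le> e * (norm x)\<^sup>2) \<Longrightarrow>
       v \<bullet> z = 1 \<Longrightarrow> (\<And>y. b' z y = h * (v \<bullet> y)) \<Longrightarrow> h \<noteq> 0 \<Longrightarrow>
       \<exists>S T. subspace S \<and> subspace T \<and> (\<forall>x\<in>S. x \<noteq> 0 \<longrightarrow> b' x x < 0) \<and> (\<forall>x\<in>T. b' x x \<ge> 0) \<and>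
         dim S = (if h < 0 then m + 1 else m) \<and> DIM('a) \<le> dim S + dim T"
proof -
  obtain N P where N: "subspace N" and P: "subspace P" and dim: "dim N + dim P + 1 \<ge> DIM('a)"
    and vN: "\<And>x. x \<in> N \<Longrightarrow> v \<bullet> x = 0" and vP: "\<And>x. x \<in> P \<Longrightarrow> v \<bullet> x = 0"
    and neg: "\<And>x. x \<in> N \<Longrightarrow> x \<noteq> 0 \<Longrightarrow> b x x < 0" and pos: "\<And>x. x \<in> P \<Longrightarrow> x \<noteq> 0 \<Longrightarrow> b x x > 0"
    by (rule simple_kernel_splitting[OF b ker v]) blast
  have "bilinear (\<lambda>x y. - b x y)"
    using b(1) unfolding bilinear_def by (auto intro: linear_compose_neg)
  then obtain c where c: "c > 0" "\<And>x. x \<in> N \<Longrightarrow> - b x x \<ge> c * (norm x)\<^sup>2"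
    using bilinear_coercive[of "\<lambda>x y. - b x y" N] N neg by (metis neg_0_less_iff_less)
  obtain c' where c': "c' > 0" "\<And>x. x \<in> P \<Longrightarrow> b x x \<ge> c' * (norm x)\<^sup>2"
    using bilinear_coercive[OF b(1) P pos] by metis
  \<comment> \<open>Half of the smaller coercivity constant, so that the perturbation cannot reverse
    the sign of the form on N or on P.\<close>
  define e where "e = min c c' / 2"
  have e: "e > 0" "e < c" "e < c'" using c(1) c'(1) by (auto simp: e_def min_def)
  show thesis
  proof (rule that[OF e(1), of "dim N"])
    fix b' z and h :: real
    assume b': "bilinear b'" "\<And>x y. b' x y = b' y x" and close: "\<And>x. \<bar>b' x x - b x x\<bar> \<le> e * (norm x)\<^sup>2"
      and z: "v \<bullet> z = 1" "\<And>y. b' z y = h * (v \<bullet> y)" and h: "h \<noteq> 0"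
    have neg': "b' x x < 0" if "x \<in> N" "x \<noteq> 0" for x
    proof -
      have "e * (norm x)\<^sup>2 < c * (norm x)\<^sup>2" using e(2) that by simp
      then show ?thesis using close[of x] c(2)[OF that(1)] by (simp add: abs_le_iff)
    qed
    have pos': "b' x x \<ge> 0" if "x \<in> P" for x
    proof -
      have "e * (norm x)\<^sup>2 \<le> c' * (norm x)\<^sup>2" using e(3) by (intro mult_right_mono) auto
      then show ?thesis using close[of x] c'(2)[OF that(1)] by (simp add: abs_le_iff)
    qed
    have dim_z: "dim (span (insert z S)) = dim S + 1" if "subspace S" "\<And>x. x \<in> S \<Longrightarrow> v \<bullet> x = 0" for S
    proof -
      have "z \<notin> span S" using that z(1) by (metis span_eq_iff zero_neq_one)
      then show ?thesis by (simp add: dim_insert)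
    qed
    \<comment> \<open>On the complement of v the cross terms with z vanish and b' z z = h. Hence z
      may join N when h < 0 and P when h > 0 without spoiling definiteness or
      semidefiniteness.\<close>
    have diag_z: "\<exists>k y. x = k *\<^sub>R z + y \<and> y \<in> S \<and> b' x x = k\<^sup>2 * h + b' y y"
      if S: "subspace S" "\<And>x. x \<in> S \<Longrightarrow> v \<bullet> x = 0" "x \<in> span (insert z S)" for S x
    proof -
      obtain k where k: "x - k *\<^sub>R z \<in> S"
        using S(1,3) by (auto simp: span_breakdown_eq span_eq_iff[THEN iffD2])
      define y where "y = x - k *\<^sub>R z"
      have x: "x = k *\<^sub>R z + y" by (simp add: y_def)
      have "b' z y = 0" "b' y z = 0" "b' z z = h" using z S(2)[OF k] b'(2)[of y z] by (simp_all add: y_def)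
      then have "b' x x = k\<^sup>2 * h + b' y y"
        unfolding x using b'(1)
        by (simp add: bilinear_ladd bilinear_radd bilinear_lmul bilinear_rmul power2_eq_square)
      moreover have "y \<in> S" using k by (simp add: y_def)
      ultimately show ?thesis using x by blast
    qed
    show "\<exists>S T. subspace S \<and> subspace T \<and> (\<forall>x\<in>S. x \<noteq> 0 \<longrightarrow> b' x x < 0) \<and> (\<forall>x\<in>T. b' x x \<ge> 0) \<and>
         dim S = (if h < 0 then dim N + 1 else dim N) \<and> DIM('a) \<le> dim S + dim T"
    proof (cases "h < 0")
      case True
      have "b' x x < 0" if x: "x \<in> span (insert z N)" "x \<noteq> 0" for x
      proof -
        obtain k y where k: "x = k *\<^sub>R z + y" "y \<in> N" "b' x x = k\<^sup>2 * h + b' y y"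
          using diag_z[OF N vN x(1)] by blast
        have "b' y y \<le> 0" using neg'[OF k(2)] bilinear_lzero[OF b'(1)] by (cases "y = 0") auto
        moreover have "k\<^sup>2 * h \<le> 0" "k \<noteq> 0 \<Longrightarrow> k\<^sup>2 * h < 0" using True by (auto simp: mult_le_0_iff mult_less_0_iff)
        ultimately show ?thesis using k x(2) neg'[of y] by (cases "k = 0") auto
      qed
      then show ?thesis using True N P dim dim_z[OF N vN] pos'
        by (intro exI[of _ "span (insert z N)"] exI[of _ P]) auto
    next
      case False
      have "b' x x \<ge> 0" if x: "x \<in> span (insert z P)" for x
        using diag_z[OF P vP x] pos' False by force
      then show ?thesis using False N P dim dim_z[OF P vP] neg'
        by (intro exI[of _ N] exI[of _ "span (insert z P)"]) auto
    qed
  qed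
qed

section \<open>Second derivatives and the Riemannian Hessian\<close>

definition second_derivative ::
  "('a::euclidean_space \<Rightarrow> real) \<Rightarrow> 'a \<Rightarrow> 'a \<Rightarrow> 'a \<Rightarrow> real" where
  "second_derivative f x v w = frechet_derivative (\<lambda>y. frechet_derivative f (at y) v) (at x) w"

lemma second_derivative_commute:
  assumes "open S" "x \<in> S" "Ck_on (Suc (Suc k)) f S"
  shows "second_derivative f x v w = second_derivative f x w v"
  unfolding second_derivative_def by (rule frechet_derivative_commute[OF assms])

lemma bilinear_second_derivative:
  assumes "open S" "x \<in> S" "Ck_on (Suc (Suc k)) f S"
  shows "bilinear (second_derivative f x)"
proof -
  have lin: "linear (second_derivative f x v)" for v
  proof -
    have "Ck_on (Suc k) (\<lambda>y. frechet_derivative f (at y) v) S" using assms(3) by simp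
    from has_derivative_linear[OF Ck_on_Suc_has_derivative[OF this assms(2)]]
    show ?thesis by (simp add: second_derivative_def[abs_def])
  qed
  moreover have "(\<lambda>v. second_derivative f x v w) = second_derivative f x w" for w
    using second_derivative_commute[OF assms] by blast
  ultimately show ?thesis by (simp add: bilinear_def)
qed

lemma Ck_on_has_derivative_frechet:
  assumes "Ck_on (Suc (Suc k)) f S" "x \<in> S"
  shows "((\<lambda>y. frechet_derivative f (at y) v) has_derivative second_derivative f x v) (at x)"
proof -
  have "Ck_on (Suc k) (\<lambda>y. frechet_derivative f (at y) v) S" using assms(1) by simp
  from Ck_on_Suc_has_derivative[OF this assms(2)] show ?thesis
    by (simp add: second_derivative_def[abs_def])
qed

lemma second_derivative_eqI:
  assumes "open S" "x \<in> S" "\<And>y. y \<in> S \<Longrightarrow> frechet_derivative f (at y) v = d y"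
    and "(d has_derivative d') (at x)"
  shows "second_derivative f x v w = d' w"
proof -
  have "((\<lambda>y. frechet_derivative f (at y) v) has_derivative d') (at x)"
    by (rule has_derivative_transform_within_open[OF assms(4,1,2)]) (simp add: assms(3))
  from frechet_derivative_at[OF this] show ?thesis by (simp add: second_derivative_def)
qed

text \<open>At a critical point the second derivative of the coordinate change does not contribute.\<close>

lemma second_derivative_compose_critical:
  fixes \<psi> :: "'a::euclidean_space \<Rightarrow> 'b::euclidean_space"
  assumes S: "open S" "u \<in> S" and f: "Ck_on (Suc (Suc k)) f T" and \<psi>: "Ck_on (Suc (Suc k)) \<psi> S"
    and ST: "\<psi> ` S \<subseteq> T" and T: "open T" and crit: "\<And>y. frechet_derivative f (at (\<psi> u)) y = 0"
  shows "second_derivative (\<lambda>y. f (\<psi> y)) u v w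
       = second_derivative f (\<psi> u) (frechet_derivative \<psi> (at u) v) (frechet_derivative \<psi> (at u) w)"
proof -
  let ?\<psi>' = "\<lambda>y. frechet_derivative \<psi> (at y)" and ?f' = "\<lambda>y. frechet_derivative f (at y)"
  have \<psi>u: "\<psi> u \<in> T" using S ST by blast
  have \<psi>': "(\<psi> has_derivative ?\<psi>' y) (at y)" if "y \<in> S" for y
    by (rule Ck_on_Suc_has_derivative[OF \<psi> that])
  have f': "(f has_derivative ?f' (\<psi> y)) (at (\<psi> y))" if "y \<in> S" for y
    using Ck_on_Suc_has_derivative[OF f] that ST by blast
  have comp: "frechet_derivative (\<lambda>y. f (\<psi> y)) (at y) v = (\<Sum>b\<in>Basis. (?\<psi>' y v \<bullet> b) * ?f' (\<psi> y) b)"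
    if "y \<in> S" for y
  proof -
    have "frechet_derivative (\<lambda>y. f (\<psi> y)) (at y) = (\<lambda>v. ?f' (\<psi> y) (?\<psi>' y v))"
      using frechet_derivative_at[OF has_derivative_compose[OF \<psi>'[OF that] f'[OF that]]] by simp
    then show ?thesis
      using linear_Basis_expansion[OF has_derivative_linear[OF f'[OF that]], of "?\<psi>' y v"] by simp
  qed
  obtain \<psi>'' where \<psi>'': "((\<lambda>y. ?\<psi>' y v) has_derivative \<psi>'') (at u)"
    using Ck_on_Suc_has_derivative[of k "\<lambda>y. ?\<psi>' y v" S u] \<psi> S(2) by auto
  have "((\<lambda>y. \<Sum>b\<in>Basis. (?\<psi>' y v \<bullet> b) * ?f' (\<psi> y) b) has_derivative
      (\<lambda>w. \<Sum>b\<in>Basis. (?\<psi>' u v \<bullet> b) * second_derivative f (\<psi> u) b (?\<psi>' u w) + (\<psi>'' w \<bullet> b) * ?f' (\<psi> u) b)) (at u)"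
    by (intro has_derivative_sum has_derivative_mult has_derivative_inner_left \<psi>''
        has_derivative_compose[OF \<psi>'[OF S(2)] Ck_on_has_derivative_frechet[OF f \<psi>u]])
  from second_derivative_eqI[OF S comp this]
  have "second_derivative (\<lambda>y. f (\<psi> y)) u v w
      = (\<Sum>b\<in>Basis. (?\<psi>' u v \<bullet> b) * second_derivative f (\<psi> u) b (?\<psi>' u w))"
    by (simp add: crit)
  also have "\<dots> = second_derivative f (\<psi> u) (?\<psi>' u v) (?\<psi>' u w)"
    using linear_Basis_expansion[of "\<lambda>v. second_derivative f (\<psi> u) v (?\<psi>' u w)" "?\<psi>' u v"]
      bilinear_second_derivative[OF T \<psi>u f] by (simp add: bilinear_def)
  finally show ?thesis .
qed

lemma (in smooth_manifold) chart_simps: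
  assumes "c \<in> A"
  shows "open (chart_image c)"
    and "p \<in> fst c \<Longrightarrow> chart_inv c (snd c p) = p" and "p \<in> fst c \<Longrightarrow> snd c p \<in> chart_image c"
    and "x \<in> chart_image c \<Longrightarrow> snd c (chart_inv c x) = x"
  using chart[OF assms] by (auto simp: homeomorphism_def chart_image_def)

section \<open>The Riemannian Hessian at a critical point\<close>

context riemannian_manifold
begin

lemma inner_form_metric: "c \<in> A \<Longrightarrow> p \<in> fst c \<Longrightarrow> inner_form (G c p)"
  by unfold_locales (auto intro: metric_bilinear metric_sym metric_pos)

text \<open>A definite description says nothing until unique existence is known;
  \<open>riesz\<close> provides it once the differential is linear, which is why differentiability
  is assumed.\<close>

lemma riem_grad_eq_0D:
  assumes "c \<in> A" "p \<in> fst c" "(f \<circ> chart_inv c) differentiable at (snd c p)" "riem_grad G c f p = 0"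
  shows "coord_deriv c f p \<xi> = 0"
proof -
  interpret inner_form "G c p" by (rule inner_form_metric[OF assms(1,2)])
  have "linear (coord_deriv c f p)"
    unfolding coord_deriv_def using assms(3) by (rule linear_frechet_derivative)
  from theI'[OF riesz[OF this]] have "G c p (riem_grad G c f p) \<xi> = coord_deriv c f p \<xi>"
    by (simp add: riem_grad_def)
  then show ?thesis using assms(4) bilinear_lzero[OF bilinear_G] by simp
qed

context
  fixes c :: "('m, 'a) chart" and p :: 'm and f :: "'m \<Rightarrow> real" and k :: nat
  assumes c: "c \<in> A" and p: "p \<in> fst c" and f: "Ck_on (Suc (Suc k)) (f \<circ> chart_inv c) (chart_image c)"
    and crit: "\<And>\<xi>. coord_deriv c f p \<xi> = 0"
begin

abbreviation "b \<equiv> second_derivative (f \<circ> chart_inv c) (snd c p)"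

text \<open>The differential of f vanishes on every vector, in particular on whatever
  \<open>christoffel\<close> denotes, so the connection never has to be evaluated.\<close>

lemma riem_hess_critical: "G c p (riem_hess G c f p \<xi>) \<eta> = b \<xi> \<eta>"
proof -
  interpret inner_form "G c p" by (rule inner_form_metric[OF c p])
  note chart' = chart_simps[OF c]
  have "coord_deriv c (\<lambda>q. coord_deriv c f q \<eta>) p \<xi> = b \<xi> \<eta>" for \<eta>
  proof -
    let ?d = "\<lambda>x. frechet_derivative (f \<circ> chart_inv c) (at x) \<eta>"
    have "frechet_derivative ?d (at (snd c p))
        = frechet_derivative ((\<lambda>q. coord_deriv c f q \<eta>) \<circ> chart_inv c) (at (snd c p))"
    \<comment> \<open>The two functions agree only on \<open>chart_image c\<close>, where
      \<open>snd c\<close> inverts \<open>chart_inv c\<close>; openness makes that enough.\<close>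
    proof (rule frechet_derivative_transform_within_open[OF _ chart'(1) chart'(3)[OF p]])
      show "?d differentiable at (snd c p)"
        using Ck_on_has_derivative_frechet[OF f chart'(3)[OF p]] by (auto simp: differentiable_def)
    qed (simp add: coord_deriv_def chart'(4))
    then have "coord_deriv c (\<lambda>q. coord_deriv c f q \<eta>) p \<xi> = b \<eta> \<xi>"
      by (simp add: coord_deriv_def[of c "\<lambda>q. coord_deriv c f q \<eta>"] second_derivative_def)
    then show ?thesis using second_derivative_commute[OF chart'(1) chart'(3)[OF p] f] by simp
  qed
  then have "riem_hess G c f p \<xi> = (THE \<zeta>. \<forall>\<eta>. G c p \<zeta> \<eta> = b \<xi> \<eta>)"
    by (simp add: riem_hess_def crit)
  moreover have "linear (b \<xi>)"
    using bilinear_second_derivative[OF chart'(1) chart'(3)[OF p] f] by (simp add: bilinear_def)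
  ultimately show ?thesis using theI'[OF riesz, of "b \<xi>"] by simp
qed

lemma symmetric_form_hessian: "symmetric_form (G c p) b"
proof -
  interpret inner_form "G c p" by (rule inner_form_metric[OF c p])
  note chart' = chart_simps[OF c]
  show ?thesis
    by unfold_locales
      (rule bilinear_second_derivative[OF chart'(1) chart'(3)[OF p] f]
        second_derivative_commute[OF chart'(1) chart'(3)[OF p] f])+
qed

lemma riem_hess_eigen: "riem_hess G c f p \<xi> = r *\<^sub>R \<xi> \<longleftrightarrow> (\<forall>\<eta>. b \<xi> \<eta> = r * G c p \<xi> \<eta>)"
proof -
  interpret inner_form "G c p" by (rule inner_form_metric[OF c p])
  have "riem_hess G c f p \<xi> = r *\<^sub>R \<xi> \<longleftrightarrow> (\<forall>\<eta>. G c p (riem_hess G c f p \<xi> - r *\<^sub>R \<xi>) \<eta> = 0)"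
    using G_zero[of "riem_hess G c f p \<xi> - r *\<^sub>R \<xi>"] bilinear_lzero[OF bilinear_G] by auto
  then show ?thesis
    using bilinear_G by (simp add: bilinear_lsub bilinear_lmul riem_hess_critical)
qed

lemma morse_index_eq_index: "morse_index G c f p = symmetric_form.index (G c p) b"
proof -
  interpret symmetric_form "G c p" b by (rule symmetric_form_hessian)
  show ?thesis
    unfolding morse_index_def index_def negative_eigenvalues_def eigenspace_def riem_hess_eigen by simp
qed

end

end

section \<open>Lyapunov--Schmidt reduction along a critical branch\<close>

lemma open_slice: "open V \<Longrightarrow> open {u. (u, \<mu>) \<in> V}"
  for V :: "('a::topological_space \<times> 'b::topological_space) set"
  using open_vimage[of V "\<lambda>u. (u, \<mu>)"] by (simp add: vimage_def continuous_on_Pair)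

lemma Ck_on_slice_has_derivative:
  fixes f :: "'a::euclidean_space \<times> real \<Rightarrow> real"
  assumes "Ck_on (Suc k) f V" "(u, \<mu>) \<in> V"
  shows "((\<lambda>u. f (u, \<mu>)) has_derivative (\<lambda>y. frechet_derivative f (at (u, \<mu>)) (y, 0))) (at u)"
proof -
  have "((\<lambda>u. (u, \<mu>)) has_derivative (\<lambda>y. (y, 0))) (at u)"
    by (auto intro!: derivative_eq_intros)
  from diff_chain_at[OF this Ck_on_Suc_has_derivative[OF assms]] show ?thesis by (simp add: o_def)
qed

lemma frechet_derivative_slice:
  fixes f :: "'a::euclidean_space \<times> real \<Rightarrow> real"
  assumes "Ck_on (Suc k) f V" "(u, \<mu>) \<in> V"
  shows "frechet_derivative (\<lambda>u. f (u, \<mu>)) (at u) y = frechet_derivative f (at (u, \<mu>)) (y, 0)"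
  using frechet_derivative_at[OF Ck_on_slice_has_derivative[OF assms], symmetric] by simp

lemma second_derivative_slice:
  fixes f :: "'a::euclidean_space \<times> real \<Rightarrow> real"
  assumes V: "open V" "(u, \<mu>) \<in> V" and f: "Ck_on (Suc (Suc k)) f V"
  shows "second_derivative (\<lambda>u. f (u, \<mu>)) u x y = second_derivative f (u, \<mu>) (x, 0) (y, 0)"
proof -
  have "Ck_on (Suc k) (\<lambda>p. frechet_derivative f (at p) (x, 0)) V" using f by simp
  from Ck_on_slice_has_derivative[OF this V(2)] show ?thesis
    unfolding second_derivative_def[of f]
    by (rule second_derivative_eqI[OF open_slice[OF V(1), of \<mu>], rotated 2])
      (use frechet_derivative_slice[OF f] V in auto)
qed

lemma abs_bilinear_le:
  fixes b :: "'a::euclidean_space \<Rightarrow> 'a \<Rightarrow> real"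
  assumes b: "bilinear b" and e: "\<And>i j. i \<in> Basis \<Longrightarrow> j \<in> Basis \<Longrightarrow> \<bar>b i j\<bar> \<le> e"
  shows "\<bar>b x y\<bar> \<le> real (DIM('a) * DIM('a)) * e * (norm x * norm y)"
proof -
  have left: "b x y = (\<Sum>i\<in>Basis. (x \<bullet> i) * b i y)"
    using b linear_Basis_expansion[of "\<lambda>x. b x y" x] by (simp add: bilinear_def)
  have right: "b i y = (\<Sum>j\<in>Basis. (y \<bullet> j) * b i j)" for i
    using b linear_Basis_expansion[of "b i" y] by (simp add: bilinear_def)
  have "b x y = (\<Sum>i\<in>Basis. \<Sum>j\<in>Basis. (x \<bullet> i) * ((y \<bullet> j) * b i j))"
    unfolding left unfolding right sum_distrib_left ..
  also have "\<bar>\<dots>\<bar> \<le> (\<Sum>i\<in>(Basis::'a set). \<Sum>j\<in>(Basis::'a set). norm x * (norm y * e))"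
    by (intro order_trans[OF sum_abs] sum_mono order_trans[OF sum_abs])
      (auto simp: abs_mult intro!: mult_mono Basis_le_norm e)
  finally show ?thesis by (simp add: mult_ac)
qed

text \<open>A bilinear form is determined by finitely many entries, so entrywise convergence is
  uniform relative to the norms of x and y.\<close>

lemma eventually_bilinear_close:
  fixes B :: "'p \<Rightarrow> 'a::euclidean_space \<Rightarrow> 'a \<Rightarrow> real"
  assumes lim: "\<And>i j. ((\<lambda>p. B p i j) \<longlongrightarrow> b i j) F"
    and B: "\<forall>\<^sub>F p in F. bilinear (B p)" and b: "bilinear b" and e: "e > 0"
  shows "\<forall>\<^sub>F p in F. \<forall>x y. \<bar>B p x y - b x y\<bar> \<le> e * (norm x * norm y)"
proof -
  define \<eta> where "\<eta> = e / real (DIM('a) * DIM('a))"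
  have \<eta>: "\<eta> > 0" "real (DIM('a) * DIM('a)) * \<eta> = e" using e by (simp_all add: \<eta>_def)
  have "\<forall>\<^sub>F p in F. \<forall>i\<in>Basis. \<forall>j\<in>Basis. dist (B p i j) (b i j) < \<eta>"
    by (intro eventually_ball_finite ballI finite_Basis tendstoD[OF lim \<eta>(1)])
  with B show ?thesis
  proof eventually_elim
    case (elim p)
    show ?case
    proof (intro allI)
      fix x y
      have bil: "bilinear (\<lambda>x y. B p x y - b x y)"
        using elim(1) b unfolding bilinear_def by (auto intro: linear_compose_sub)
      have "\<bar>B p x y - b x y\<bar> \<le> real (DIM('a) * DIM('a)) * \<eta> * (norm x * norm y)"
        by (rule abs_bilinear_le[OF bil]) (use elim(2) in \<open>simp add: dist_real_def less_imp_le\<close>)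
      then show "\<bar>B p x y - b x y\<bar> \<le> e * (norm x * norm y)" by (simp only: \<eta>(2))
    qed
  qed
qed

lemma open_contains_box:
  fixes W :: "(real \<times> real) set"
  assumes "open W" "(0, 0) \<in> W"
  obtains d where "d > 0" "{-d<..<d} \<times> {-d<..<d} \<subseteq> W"
proof -
  obtain A B where AB: "open A" "open B" "(0, 0) \<in> A \<times> B" "A \<times> B \<subseteq> W"
    by (rule open_prod_elim[OF assms])
  obtain e1 e2 where e: "e1 > 0" "\<And>x. dist x 0 < e1 \<Longrightarrow> x \<in> A" "e2 > 0" "\<And>x. dist x 0 < e2 \<Longrightarrow> x \<in> B"
    using AB(1-3) unfolding open_dist by (metis mem_Sigma_iff)
  have "{- min e1 e2<..<min e1 e2} \<times> {- min e1 e2<..<min e1 e2} \<subseteq> A \<times> B"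
    using e(2,4) by (auto simp: dist_real_def)
  then show thesis using that[of "min e1 e2"] e(1,3) AB(4) by auto
qed

text \<open>Existence of the vector behind the definite description comes from \<open>riesz\<close>
  for the Euclidean product, uniqueness from that of the derivative.\<close>

lemma gradient_inner:
  fixes f :: "'a::euclidean_space \<Rightarrow> real"
  assumes "(f has_derivative f') (at x)"
  shows "gradient f x \<bullet> y = f' y"
proof -
  interpret inner_form "inner :: 'a \<Rightarrow> 'a \<Rightarrow> real"
    by unfold_locales (auto simp: bilinear_conv_bounded_bilinear bounded_bilinear_inner inner_commute)
  obtain D where D: "\<And>y. D \<bullet> y = f' y" using riesz[OF has_derivative_linear[OF assms]] by blast
  then have "(\<lambda>y. y \<bullet> D) = f'" by (auto simp: inner_commute)
  then have GD: "GDERIV f x :> D" using assms by (simp add: gderiv_def)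
  have "gradient f x = D"
    unfolding gradient_def
  proof (rule the_equality[where P = "\<lambda>D. GDERIV f x :> D", OF GD])
    fix E assume "GDERIV f x :> E"
    then have "(\<lambda>y. y \<bullet> E) = (\<lambda>y. y \<bullet> D)"
      using GD unfolding gderiv_def by (rule has_derivative_unique)
    from fun_cong[OF this] have "(E - D) \<bullet> y = 0" for y by (simp add: inner_commute[of _ y] inner_diff_right)
    then have "E - D = 0" by (rule G_zero)
    then show "E = D" by simp
  qed
  then show ?thesis using D by simp
qed

section \<open>The reduction in Euclidean coordinates\<close>

locale lyapunov_schmidt =
  fixes k :: nat and Lt :: "'a::euclidean_space \<Rightarrow> real \<Rightarrow> real" and V :: "('a \<times> real) set"
    and v\<^sub>0 :: 'a and w :: "real \<Rightarrow> real \<Rightarrow> 'a"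
  assumes k: "4 \<le> k" and V: "open V" "(0, 0) \<in> V"
    and Lt_Ck: "Ck_on k (\<lambda>(u, \<mu>). Lt u \<mu>) V" and v\<^sub>0: "norm v\<^sub>0 = 1"
    and solution: "reduction_solution k Lt V v\<^sub>0 w"
    and critical: "(0, \<mu>) \<in> V \<Longrightarrow> frechet_derivative (\<lambda>u. Lt u \<mu>) (at 0) y = 0"
    and kernel: "{x. \<forall>y. second_derivative (\<lambda>u. Lt u 0) 0 x y = 0} = span {v\<^sub>0}"
begin

abbreviation "F \<equiv> \<lambda>p. Lt (fst p) (snd p)"
abbreviation "DF p y \<equiv> frechet_derivative F (at p) (y, 0)"
abbreviation "B \<mu> \<equiv> second_derivative (\<lambda>u. Lt u \<mu>) 0"
abbreviation "\<phi> \<equiv> reduced_potential Lt v\<^sub>0 w"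
abbreviation "g \<equiv> reduced_function Lt v\<^sub>0 w"
abbreviation "point p \<equiv> (fst p *\<^sub>R v\<^sub>0 + w (fst p) (snd p), snd p)"

lemma F_C4: "Ck_on (Suc (Suc (Suc (Suc 0)))) F V"
  using Ck_on_le[OF Lt_Ck, of "Suc (Suc (Suc (Suc 0)))"] k by (simp add: case_prod_unfold del: Ck_on.simps)

lemma DF_C3: "Ck_on (Suc (Suc (Suc 0))) (\<lambda>p. DF p y) V"
  using F_C4 Ck_on.simps(2)[of "Suc (Suc (Suc 0))" F V] by blast

lemma second_derivative_F:
  "(u, \<mu>) \<in> V \<Longrightarrow> second_derivative (\<lambda>u. Lt u \<mu>) u x y = second_derivative F (u, \<mu>) (x, 0) (y, 0)"
  using second_derivative_slice[OF V(1) _ F_C4, of u \<mu>] by simp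

lemma slice_Ck: "Ck_on (Suc (Suc 0)) (\<lambda>u. Lt u \<mu>) {u. (u, \<mu>) \<in> V}"
proof -
  have "Ck_on (Suc (Suc 0)) (\<lambda>u. F (u, \<mu>)) {u. (u, \<mu>) \<in> V}"
  proof (rule Ck_on_compose[OF open_slice[OF V(1)], where f = F and h = "\<lambda>u. (u, \<mu>)"])
    show "Ck_on (Suc (Suc 0)) F V" by (rule Ck_on_le[OF F_C4]) simp
    show "Ck_on (Suc (Suc 0)) (\<lambda>u. (u, \<mu>)) {u. (u, \<mu>) \<in> V}"
      by (intro Ck_on_Pair Ck_on_const Ck_on_bounded_linear bounded_linear_ident open_slice V(1))
  qed auto
  then show ?thesis by simp
qed

lemma bilinear_second_derivative_Lt:
  "(u, \<mu>) \<in> V \<Longrightarrow> bilinear (second_derivative (\<lambda>u. Lt u \<mu>) u)"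
  by (rule bilinear_second_derivative[OF open_slice[OF V(1)] _ slice_Ck]) simp

lemma second_derivative_Lt_commute:
  "(u, \<mu>) \<in> V \<Longrightarrow> second_derivative (\<lambda>u. Lt u \<mu>) u x y = second_derivative (\<lambda>u. Lt u \<mu>) u y x"
  by (rule second_derivative_commute[OF open_slice[OF V(1)] _ slice_Ck]) simp

lemma gradient_Lt:
  assumes "(u, \<mu>) \<in> V"
  shows "gradient (\<lambda>u. Lt u \<mu>) u \<bullet> y = DF (u, \<mu>) y"
proof -
  have "((\<lambda>u. Lt u \<mu>) has_derivative DF (u, \<mu>)) (at u)"
    using Ck_on_slice_has_derivative[OF F_C4 assms] by simp
  then show ?thesis by (rule gradient_inner)
qed

lemma second_derivative_close:
  assumes "e > 0"
  shows "\<forall>\<^sub>F (u, \<mu>) in nhds (0, 0).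
    \<forall>x y. \<bar>second_derivative (\<lambda>u. Lt u \<mu>) u x y - B 0 x y\<bar> \<le> e * (norm x * norm y)"
proof -
  have ev: "\<forall>\<^sub>F p in nhds (0, 0). p \<in> V" using V by (rule eventually_nhds_in_open)
  have "\<forall>\<^sub>F p in nhds (0, 0). \<forall>x y.
     \<bar>second_derivative (\<lambda>u. Lt u (snd p)) (fst p) x y - B 0 x y\<bar> \<le> e * (norm x * norm y)"
  proof (rule eventually_bilinear_close[OF _ _ bilinear_second_derivative_Lt[OF V(2)] assms])
    fix x y
    have "Ck_on (Suc (Suc 0)) (\<lambda>p. second_derivative F p (x, 0) (y, 0)) V"
      using DF_C3[of x] unfolding second_derivative_def Ck_on.simps(2)[of "Suc (Suc 0)"] by blast
    then have "isCont (\<lambda>p. second_derivative F p (x, 0) (y, 0)) (0, 0)"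
      using Ck_on_imp_continuous_on V continuous_on_eq_continuous_at by blast
    then have "((\<lambda>p. second_derivative F p (x, 0) (y, 0)) \<longlongrightarrow> B 0 x y) (nhds (0, 0))"
      unfolding isCont_def second_derivative_F[OF V(2)]
      by (rule tendsto_at_iff_tendsto_nhds[THEN iffD1])
    then show "((\<lambda>p. second_derivative (\<lambda>u. Lt u (snd p)) (fst p) x y) \<longlongrightarrow> B 0 x y) (nhds (0, 0))"
      by (rule Lim_transform_eventually)
        (use ev in \<open>auto elim!: eventually_mono simp: second_derivative_F\<close>)
  next
    show "\<forall>\<^sub>F p in nhds (0, 0). bilinear (second_derivative (\<lambda>u. Lt u (snd p)) (fst p))"
      using ev by (rule eventually_mono) (auto intro: bilinear_second_derivative_Lt)
  qed
  then show ?thesis by (simp add: case_prod_unfold)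
qed

text \<open>A vanishing range projection says that the gradient is a multiple of
  \<open>v\<^sub>0\<close>, and the factor is g. The last clause thus packs the reduction equation
  and the definition of g into one identity.\<close>

lemma reduction:
  obtains W where "open W" "(0, 0) \<in> W" "Ck_on (Suc (Suc (Suc 0))) (\<lambda>p. w (fst p) (snd p)) W"
    "\<And>p. p \<in> W \<Longrightarrow> point p \<in> V" "\<And>a \<mu>. (a, \<mu>) \<in> W \<Longrightarrow> v\<^sub>0 \<bullet> w a \<mu> = 0"
    "\<And>p y. p \<in> W \<Longrightarrow> DF (point p) y = g (fst p) (snd p) * (v\<^sub>0 \<bullet> y)"
proof -
  obtain W where W: "open W" "(0, 0) \<in> W" "Ck_on (k - 1) (\<lambda>(a, \<mu>). w a \<mu>) W"
    and *: "\<forall>(a, \<mu>)\<in>W. (a *\<^sub>R v\<^sub>0 + w a \<mu>, \<mu>) \<in> V \<and> w a \<mu> \<in> (span {v\<^sub>0})\<^sup>\<bottom> \<and>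
           proj_range v\<^sub>0 (gradient (\<lambda>u. Lt u \<mu>) (a *\<^sub>R v\<^sub>0 + w a \<mu>)) = 0"
    using solution unfolding reduction_solution_def by blast
  have v1: "v\<^sub>0 \<bullet> v\<^sub>0 = 1" using v\<^sub>0 by (simp add: norm_eq_1)
  show thesis
  proof (rule that[OF W(1,2)])
    show "Ck_on (Suc (Suc (Suc 0))) (\<lambda>p. w (fst p) (snd p)) W"
      using Ck_on_le[OF W(3), of "Suc (Suc (Suc 0))"] k by (simp add: case_prod_unfold del: Ck_on.simps)
    show "point p \<in> V" if "p \<in> W" for p using * that by auto
    show "v\<^sub>0 \<bullet> w a \<mu> = 0" if "(a, \<mu>) \<in> W" for a \<mu>
      using * that span_base[of v\<^sub>0 "{v\<^sub>0}"] by (auto simp: orthogonal_comp_def orthogonal_def)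
    show "DF (point p) y = g (fst p) (snd p) * (v\<^sub>0 \<bullet> y)" if "p \<in> W" for p y
    proof -
      let ?G = "gradient (\<lambda>u. Lt u (snd p)) (fst p *\<^sub>R v\<^sub>0 + w (fst p) (snd p))"
      have "point p \<in> V" and G: "?G = (?G \<bullet> v\<^sub>0) *\<^sub>R v\<^sub>0"
        using * that by (auto simp: proj_range_def proj_ker_def)
      then have "DF (point p) y = ?G \<bullet> y" by (intro gradient_Lt[symmetric])
      also have "\<dots> = (?G \<bullet> v\<^sub>0) * (v\<^sub>0 \<bullet> y)"
        using arg_cong[OF G, of "\<lambda>G. G \<bullet> y"] by simp
      finally have "DF (point p) y = (?G \<bullet> v\<^sub>0) * (v\<^sub>0 \<bullet> y)" .
      then show ?thesis by (simp add: reduced_function_def proj_ker_def v1)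
    qed
  qed
qed

text \<open>
  \<open>H\<close> is the Hessian at the origin; it is injective on the complement of \<open>v\<^sub>0\<close>. If \<open>x = w 0 \<mu>\<close> were
  nonzero, the derivative in direction \<open>H x\<close> would vanish at \<open>0\<close> and at \<open>x\<close>, and Rolle's theorem
  on the segment between them would contradict \<open>B 0 x (H x) = \<parallel>H x\<parallel>\<^sup>2\<close>.
\<close>

lemma critical_points_near_origin:
  "\<exists>e>0. \<forall>x \<mu>. norm x < e \<longrightarrow> \<bar>\<mu>\<bar> < e \<longrightarrow> v\<^sub>0 \<bullet> x = 0 \<longrightarrow> (\<forall>y. v\<^sub>0 \<bullet> y = 0 \<longrightarrow> DF (x, \<mu>) y = 0) \<longrightarrow> x = 0"
proof -
  have B0: "bilinear (B 0)" by (rule bilinear_second_derivative_Lt[OF V(2)])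
  define H where "H x = (\<Sum>i\<in>Basis. B 0 x i *\<^sub>R i)" for x
  have H: "H x \<bullet> y = B 0 x y" for x y
    using linear_Basis_expansion[of "B 0 x" y] B0
    by (simp add: H_def inner_sum_left bilinear_def inner_commute[of y] mult.commute)
  have linH: "linear H"
    using B0 by (intro linearI) (simp_all add: H_def bilinear_ladd bilinear_lmul scaleR_add_left sum.distrib scaleR_sum_right)
  let ?R = "{x. v\<^sub>0 \<bullet> x = 0}"
  have R: "subspace ?R" by (simp add: subspace_def inner_simps)
  have inj: "\<forall>x\<in>?R. H x = 0 \<longrightarrow> x = 0"
  proof (intro ballI impI)
    fix x assume x: "x \<in> ?R" "H x = 0"
    then have "x \<in> span {v\<^sub>0}" using H[of x] kernel by auto
    then obtain c where "x = c *\<^sub>R v\<^sub>0" by (auto simp: span_singleton)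
    then show "x = 0" using x(1) v\<^sub>0 by (auto simp: norm_eq_1)
  qed
  \<comment> \<open>The closeness c / 2 required below yields |H x| <= (c / 2) |x|, against this
    lower bound.\<close>
  obtain c where c: "c > 0" "\<And>x. x \<in> ?R \<Longrightarrow> norm (H x) \<ge> c * norm x"
    using injective_imp_isometric[OF closed_subspace[OF R] R _ inj] linH by (auto simp: linear_conv_bounded_linear mult.commute)
  \<comment> \<open>By symmetry H maps into the complement of the kernel, so H x is an admissible
    test direction for the projected equation.\<close>
  have HR: "v\<^sub>0 \<bullet> H x = 0" for x
  proof -
    have "B 0 v\<^sub>0 x = 0" using kernel span_base[of v\<^sub>0 "{v\<^sub>0}"] by blast
    then show ?thesis using H[of x v\<^sub>0] second_derivative_Lt_commute[OF V(2)] by (simp add: inner_commute)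
  qed
  have "\<forall>\<^sub>F p in nhds (0, 0). p \<in> V \<and>
      (\<forall>x y. \<bar>second_derivative (\<lambda>u. Lt u (snd p)) (fst p) x y - B 0 x y\<bar> \<le> c / 2 * (norm x * norm y))"
    using eventually_conj[OF eventually_nhds_in_open[OF V] second_derivative_close[of "c / 2"]] c(1)
    by (simp add: case_prod_unfold)
  then obtain e where e: "e > 0"
    and e_V: "\<And>p. dist p (0, 0) < e \<Longrightarrow> p \<in> V"
    and e_close: "\<And>p x y. dist p (0, 0) < e \<Longrightarrow>
      \<bar>second_derivative (\<lambda>u. Lt u (snd p)) (fst p) x y - B 0 x y\<bar> \<le> c / 2 * (norm x * norm y)"
    unfolding eventually_nhds_metric by blast
  show ?thesis
  proof (intro exI[of _ "e / 2"] conjI allI impI)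
    fix x \<mu> assume small: "norm x < e / 2" "\<bar>\<mu>\<bar> < e / 2" and x: "v\<^sub>0 \<bullet> x = 0"
      and DF0: "\<forall>y. v\<^sub>0 \<bullet> y = 0 \<longrightarrow> DF (x, \<mu>) y = 0"
    have near: "dist (t *\<^sub>R x, \<mu>) (0, 0) < e" if "0 \<le> t" "t \<le> 1" for t
    proof -
      have "dist (t *\<^sub>R x, \<mu>) (0, 0) \<le> norm (t *\<^sub>R x) + norm \<mu>"
        using norm_Pair_le[of "t *\<^sub>R x" \<mu>] by (simp add: dist_norm)
      moreover have "norm (t *\<^sub>R x) \<le> norm x" using that by (simp add: mult_left_le_one_le)
      ultimately show ?thesis using small by simp
    qed
    show "x = 0"
    proof (rule ccontr)
      assume "x \<noteq> 0"
      define y where "y = H x"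
      have der: "((\<lambda>t. DF (t *\<^sub>R x, \<mu>) y) has_real_derivative
          second_derivative (\<lambda>u. Lt u \<mu>) (t *\<^sub>R x) y x) (at t)" if "0 \<le> t" "t \<le> 1" for t
      proof -
        have "((\<lambda>t. (t *\<^sub>R x, \<mu>)) has_vector_derivative (x, 0)) (at t)"
          by (auto intro!: derivative_eq_intros has_vector_derivative_Pair)
        from Ck_on_has_field_derivative[OF DF_C3 e_V[OF near[OF that]] this]
        show ?thesis
          by (simp add: second_derivative_F[OF e_V[OF near[OF that]]] second_derivative_def[of F])
      qed
      obtain t where t: "0 < t" "t < 1" "DF (1 *\<^sub>R x, \<mu>) y - DF (0 *\<^sub>R x, \<mu>) y
          = (1 - 0) * second_derivative (\<lambda>u. Lt u \<mu>) (t *\<^sub>R x) y x"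
        using MVT2[of 0 1 "\<lambda>t. DF (t *\<^sub>R x, \<mu>) y", OF zero_less_one der] by blast
      have V0: "(0, \<mu>) \<in> V" using e_V[OF near[of 0]] by simp
      have "DF (0, \<mu>) y = 0"
        using critical[OF V0, of y] frechet_derivative_slice[OF F_C4 V0, of y] by simp
      moreover have "DF (x, \<mu>) y = 0" using DF0 HR by (simp add: y_def)
      ultimately have "second_derivative (\<lambda>u. Lt u \<mu>) (t *\<^sub>R x) y x = 0" using t(3) by simp
      moreover have "B 0 y x = norm y * norm y"
        using H[of x y] second_derivative_Lt_commute[OF V(2), of y x]
        by (simp add: y_def power2_norm_eq_inner[symmetric] power2_eq_square)
      moreover have "\<bar>second_derivative (\<lambda>u. Lt u \<mu>) (t *\<^sub>R x) y x - B 0 y x\<bar> \<le> c / 2 * (norm y * norm x)"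
        using e_close[OF near[of t], of y x] t(1,2) by simp
      ultimately have le: "norm y * norm y \<le> norm y * (c / 2 * norm x)" by (simp add: mult_ac)
      have ge: "norm y \<ge> c * norm x" using c(2)[of x] x by (simp add: y_def)
      have pos: "c * norm x > 0" using c(1) \<open>x \<noteq> 0\<close> by simp
      then have "norm y \<le> c / 2 * norm x" using le ge by (simp only: mult_le_cancel_left_pos)
      then show False using ge pos by linarith
    qed
  qed (use e in simp)
qed

text \<open>Along the path a \<open>v\<^sub>0\<close> + w the tangent is \<open>v\<^sub>0\<close> +
  w' with w' orthogonal to \<open>v\<^sub>0\<close>; the identity of \<open>reduction\<close> tested
  on it gives the derivative g of the potential. Tested on \<open>v\<^sub>0\<close> it expresses g
  through DF, and so g inherits three derivatives.\<close>

lemma reduced_problem: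
  obtains d where "d > 0" "\<And>\<mu>. \<bar>\<mu>\<bar> < d \<Longrightarrow> (0, \<mu>) \<in> V"
    "Ck_on (Suc (Suc (Suc 0))) (\<lambda>p. g (fst p) (snd p)) ({-d<..<d} \<times> {-d<..<d})"
    "\<And>a \<mu>. \<bar>a\<bar> < d \<Longrightarrow> \<bar>\<mu>\<bar> < d \<Longrightarrow> ((\<lambda>a. \<phi> a \<mu>) has_real_derivative g a \<mu>) (at a)"
    "\<And>\<mu>. \<bar>\<mu>\<bar> < d \<Longrightarrow> \<exists>z. v\<^sub>0 \<bullet> z = 1 \<and> (\<forall>y. B \<mu> z y = deriv (\<lambda>a. g a \<mu>) 0 * (v\<^sub>0 \<bullet> y))"
proof -
  obtain W where W: "open W" "(0, 0) \<in> W" and w_C3: "Ck_on (Suc (Suc (Suc 0))) (\<lambda>p. w (fst p) (snd p)) W"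
    and point_V: "\<And>p. p \<in> W \<Longrightarrow> point p \<in> V" and w_perp: "\<And>a \<mu>. (a, \<mu>) \<in> W \<Longrightarrow> v\<^sub>0 \<bullet> w a \<mu> = 0"
    and DF_point: "\<And>p y. p \<in> W \<Longrightarrow> DF (point p) y = g (fst p) (snd p) * (v\<^sub>0 \<bullet> y)"
    by (rule reduction) blast
  have v1: "v\<^sub>0 \<bullet> v\<^sub>0 = 1" using v\<^sub>0 by (simp add: norm_eq_1)
  have g_C3: "Ck_on (Suc (Suc (Suc 0))) (\<lambda>p. g (fst p) (snd p)) W"
  proof (rule Ck_on_cong[OF W(1)])
    show "DF (point p) v\<^sub>0 = g (fst p) (snd p)" if "p \<in> W" for p
      using DF_point[OF that, of v\<^sub>0] v1 by simp
    show "Ck_on (Suc (Suc (Suc 0))) (\<lambda>p. DF (point p) v\<^sub>0) W"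
    proof (rule Ck_on_compose[OF W(1) DF_C3])
      show "Ck_on (Suc (Suc (Suc 0))) point W"
        by (intro Ck_on_Pair Ck_on_add W(1) w_C3 Ck_on_bounded_linear bounded_linear_fst bounded_linear_snd
            bounded_linear_scaleR_const)
    qed (use point_V in auto)
  qed
  have "isCont (\<lambda>p. w (fst p) (snd p)) (0, 0)"
    using Ck_on_imp_continuous_on[OF w_C3] W continuous_on_eq_continuous_at by blast
  then have "isCont (\<lambda>\<mu>. w 0 \<mu>) 0"
    using isCont_o2[where f = "\<lambda>\<mu>. (0, \<mu>)" and g = "\<lambda>p. w (fst p) (snd p)" and a = 0]
    by (simp add: isCont_Pair)
  then have w_lim: "((\<lambda>\<mu>. w 0 \<mu>) \<longlongrightarrow> 0) (nhds 0)"
    using solution by (simp add: isCont_def tendsto_at_iff_tendsto_nhds reduction_solution_def)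
  obtain e where e: "e > 0" and w_zero: "\<And>x \<mu>. norm x < e \<Longrightarrow> \<bar>\<mu>\<bar> < e \<Longrightarrow> v\<^sub>0 \<bullet> x = 0 \<Longrightarrow>
      (\<And>y. v\<^sub>0 \<bullet> y = 0 \<Longrightarrow> DF (x, \<mu>) y = 0) \<Longrightarrow> x = 0"
    using critical_points_near_origin by blast
  obtain d\<^sub>1 where d\<^sub>1: "d\<^sub>1 > 0" "{-d\<^sub>1<..<d\<^sub>1} \<times> {-d\<^sub>1<..<d\<^sub>1} \<subseteq> W"
    using open_contains_box[OF W] by blast
  obtain d\<^sub>2 where d\<^sub>2: "d\<^sub>2 > 0" "\<And>\<mu>. dist \<mu> 0 < d\<^sub>2 \<Longrightarrow> norm (w 0 \<mu>) < e"
    using tendstoD[OF w_lim e] unfolding eventually_nhds_metric by (auto simp: dist_norm)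
  define d where "d = min (min d\<^sub>1 d\<^sub>2) e"
  have d: "d > 0" "d \<le> d\<^sub>1" "d \<le> d\<^sub>2" "d \<le> e" using d\<^sub>1 d\<^sub>2 e by (auto simp: d_def)
  have box: "(a, \<mu>) \<in> W" if "\<bar>a\<bar> < d" "\<bar>\<mu>\<bar> < d" for a \<mu>
    by (rule subsetD[OF d\<^sub>1(2)]) (use d that in auto)
  \<comment> \<open>At a = 0 the point of the reduction is w(0, \<mu>) itself; being small and
    orthogonal to \<open>v\<^sub>0\<close>, it must coincide with the branch u = 0.\<close>
  have w0: "w 0 \<mu> = 0" if "\<bar>\<mu>\<bar> < d" for \<mu>
  proof (rule w_zero)
    have W\<mu>: "(0, \<mu>) \<in> W" using box[of 0 \<mu>] d that by simp
    show "norm (w 0 \<mu>) < e" using d\<^sub>2(2)[of \<mu>] d that by simp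
    show "v\<^sub>0 \<bullet> w 0 \<mu> = 0" by (rule w_perp[OF W\<mu>])
    show "DF (w 0 \<mu>, \<mu>) y = 0" if "v\<^sub>0 \<bullet> y = 0" for y using DF_point[OF W\<mu>, of y] that by simp
  qed (use d that in simp)
  define w' where "w' a \<mu> = frechet_derivative (\<lambda>p. w (fst p) (snd p)) (at (a, \<mu>)) (1, 0)" for a \<mu>
  have path: "((\<lambda>a. point (a, \<mu>)) has_vector_derivative (v\<^sub>0 + w' a \<mu>, 0)) (at a)"
    and w'_perp: "v\<^sub>0 \<bullet> w' a \<mu> = 0" if "\<bar>a\<bar> < d" "\<bar>\<mu>\<bar> < d" for a \<mu>
  proof -
    have "((\<lambda>p. w (fst p) (snd p)) \<circ> (\<lambda>a. (a, \<mu>)) has_vector_derivative w' a \<mu>) (at a)"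
      unfolding w'_def
    proof (rule vector_derivative_diff_chain_within)
      show "((\<lambda>a. (a, \<mu>)) has_vector_derivative (1, 0)) (at a)"
        by (auto intro!: derivative_eq_intros has_vector_derivative_Pair)
    qed (use Ck_on_Suc_has_derivative[OF w_C3 box[OF that]] has_derivative_at_withinI in blast)
    then have der_w: "((\<lambda>a. w a \<mu>) has_vector_derivative w' a \<mu>) (at a)" by (simp add: o_def)
    show "((\<lambda>a. point (a, \<mu>)) has_vector_derivative (v\<^sub>0 + w' a \<mu>, 0)) (at a)"
      by (auto intro!: derivative_eq_intros has_vector_derivative_Pair der_w)
    have "((\<lambda>a. v\<^sub>0 \<bullet> w a \<mu>) has_vector_derivative v\<^sub>0 \<bullet> w' a \<mu>) (at a)"
      by (rule bounded_linear.has_vector_derivative[OF bounded_linear_inner_right der_w])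
    then have "((\<lambda>a. 0::real) has_vector_derivative v\<^sub>0 \<bullet> w' a \<mu>) (at a)"
      by (rule has_vector_derivative_transform_within_open[where S = "{-d<..<d}"])
        (use that w_perp box in auto)
    then show "v\<^sub>0 \<bullet> w' a \<mu> = 0"
      using vector_derivative_at has_vector_derivative_const by metis
  qed
  show thesis
  proof (rule that[OF d(1)])
    show V\<mu>: "(0, \<mu>) \<in> V" if "\<bar>\<mu>\<bar> < d" for \<mu>
      using point_V[OF box[of 0 \<mu>]] w0[OF that] d that by simp
    show g_C3': "Ck_on (Suc (Suc (Suc 0))) (\<lambda>p. g (fst p) (snd p)) ({-d<..<d} \<times> {-d<..<d})"
      by (rule Ck_on_subset[OF g_C3]) (use box in auto)
    show "((\<lambda>a. \<phi> a \<mu>) has_real_derivative g a \<mu>) (at a)" if "\<bar>a\<bar> < d" "\<bar>\<mu>\<bar> < d" for a \<mu>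
    proof -
      have "((\<lambda>a. F (point (a, \<mu>))) has_real_derivative DF (point (a, \<mu>)) (v\<^sub>0 + w' a \<mu>)) (at a)"
        by (rule Ck_on_has_field_derivative[OF F_C4 point_V[OF box[OF that]] path[OF that]])
      moreover have "DF (point (a, \<mu>)) (v\<^sub>0 + w' a \<mu>) = g a \<mu>"
        using DF_point[OF box[OF that], of "v\<^sub>0 + w' a \<mu>"] w'_perp[OF that] v1 by (simp add: inner_add_right)
      ultimately show ?thesis by (simp add: reduced_potential_def)
    qed
    show "\<exists>z. v\<^sub>0 \<bullet> z = 1 \<and> (\<forall>y. B \<mu> z y = deriv (\<lambda>a. g a \<mu>) 0 * (v\<^sub>0 \<bullet> y))" if \<mu>: "\<bar>\<mu>\<bar> < d" for \<mu>
    proof (intro exI[of _ "v\<^sub>0 + w' 0 \<mu>"] conjI allI)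
      have 0: "\<bar>0\<bar> < d" using d by simp
      show "v\<^sub>0 \<bullet> (v\<^sub>0 + w' 0 \<mu>) = 1" using w'_perp[OF 0 \<mu>] v1 by (simp add: inner_add_right)
      fix y
      have "((\<lambda>a. DF (point (a, \<mu>)) y) has_real_derivative
          frechet_derivative (\<lambda>p. DF p y) (at (point (0, \<mu>))) (v\<^sub>0 + w' 0 \<mu>, 0)) (at 0)"
        by (rule Ck_on_has_field_derivative[OF DF_C3 point_V[OF box[OF 0 \<mu>]] path[OF 0 \<mu>]])
      moreover have "frechet_derivative (\<lambda>p. DF p y) (at (point (0, \<mu>))) (v\<^sub>0 + w' 0 \<mu>, 0) = B \<mu> (v\<^sub>0 + w' 0 \<mu>) y"
      proof -
        have "B \<mu> (v\<^sub>0 + w' 0 \<mu>) y = second_derivative F (0, \<mu>) (y, 0) (v\<^sub>0 + w' 0 \<mu>, 0)"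
          using second_derivative_Lt_commute[OF V\<mu>[OF \<mu>], of "v\<^sub>0 + w' 0 \<mu>" y]
            second_derivative_F[OF V\<mu>[OF \<mu>], of y "v\<^sub>0 + w' 0 \<mu>"] by simp
        then show ?thesis by (simp add: w0[OF \<mu>] second_derivative_def[of F])
      qed
      ultimately have der: "((\<lambda>a. DF (point (a, \<mu>)) y) has_real_derivative B \<mu> (v\<^sub>0 + w' 0 \<mu>) y) (at 0)"
        by simp
      have "((\<lambda>a. g (fst (a, \<mu>)) (snd (a, \<mu>))) has_real_derivative
          frechet_derivative (\<lambda>p. g (fst p) (snd p)) (at (0, \<mu>)) (1, 0)) (at 0)"
        by (rule Ck_on_has_field_derivative[where p = "\<lambda>a. (a, \<mu>)", OF g_C3 box[OF 0 \<mu>]])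
          (auto intro!: derivative_eq_intros has_vector_derivative_Pair)
      then have "((\<lambda>a. g a \<mu>) has_real_derivative deriv (\<lambda>a. g a \<mu>) 0) (at 0)"
        using DERIV_imp_deriv by fastforce
      then have "((\<lambda>a. g a \<mu> * (v\<^sub>0 \<bullet> y)) has_real_derivative deriv (\<lambda>a. g a \<mu>) 0 * (v\<^sub>0 \<bullet> y)) (at 0)"
        by (rule DERIV_cmult_right)
      then have "((\<lambda>a. DF (point (a, \<mu>)) y) has_real_derivative deriv (\<lambda>a. g a \<mu>) 0 * (v\<^sub>0 \<bullet> y)) (at 0)"
        by (rule has_field_derivative_transform_within_open[where S = "{-d<..<d}"])
          (use DF_point box \<mu> 0 in auto)
      from DERIV_unique[OF der this] show "B \<mu> (v\<^sub>0 + w' 0 \<mu>) y = deriv (\<lambda>a. g a \<mu>) 0 * (v\<^sub>0 \<bullet> y)" .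
    qed
  qed
qed

text \<open>Test the Hessian identity for z at \<mu> = 0 with \<open>v\<^sub>0\<close>: the left
  side vanishes because \<open>v\<^sub>0\<close> lies in the kernel.\<close>

lemma deriv_reduced_function_origin: "deriv (\<lambda>a. g a 0) 0 = 0"
proof -
  obtain d where d: "d > 0" "\<And>\<mu>. \<bar>\<mu>\<bar> < d \<Longrightarrow> \<exists>z. v\<^sub>0 \<bullet> z = 1 \<and> (\<forall>y. B \<mu> z y = deriv (\<lambda>a. g a \<mu>) 0 * (v\<^sub>0 \<bullet> y))"
    by (rule reduced_problem) blast
  obtain z where "\<forall>y. B 0 z y = deriv (\<lambda>a. g a 0) 0 * (v\<^sub>0 \<bullet> y)" using d(2)[of 0] d(1) by auto
  then have "B 0 z v\<^sub>0 = deriv (\<lambda>a. g a 0) 0 * (v\<^sub>0 \<bullet> v\<^sub>0)" by blast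
  moreover have "B 0 v\<^sub>0 z = 0" using kernel span_base[of v\<^sub>0 "{v\<^sub>0}"] by blast
  ultimately show ?thesis
    using second_derivative_Lt_commute[OF V(2), of z v\<^sub>0] v\<^sub>0[unfolded norm_eq_1] by simp
qed

text \<open>\<open>perturbed_simple_kernel\<close> is applied to the Hessian at (0, \<mu>) as a
  perturbation of the one at the origin, with h the a-derivative of g; m is fixed before \<mu> is
  chosen.\<close>

lemma index_jump:
  obtains m d where "d > 0"
    "\<And>\<mu>. \<bar>\<mu>\<bar> < d \<Longrightarrow> deriv (\<lambda>a. g a \<mu>) 0 \<noteq> 0 \<Longrightarrow> (0, \<mu>) \<in> V \<and>
      (\<exists>S T. subspace S \<and> subspace T \<and> (\<forall>x\<in>S. x \<noteq> 0 \<longrightarrow> B \<mu> x x < 0) \<and> (\<forall>x\<in>T. B \<mu> x x \<ge> 0) \<and>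
        dim S = (if deriv (\<lambda>a. g a \<mu>) 0 < 0 then m + 1 else m) \<and> DIM('a) \<le> dim S + dim T)"
proof -
  obtain e m where e: "e > 0" and jump: "\<And>b' z h. bilinear b' \<Longrightarrow> (\<And>x y. b' x y = b' y x) \<Longrightarrow>
       (\<And>x. \<bar>b' x x - B 0 x x\<bar> \<le> e * (norm x)\<^sup>2) \<Longrightarrow>
       v\<^sub>0 \<bullet> z = 1 \<Longrightarrow> (\<And>y. b' z y = h * (v\<^sub>0 \<bullet> y)) \<Longrightarrow> h \<noteq> 0 \<Longrightarrow>
       \<exists>S T. subspace S \<and> subspace T \<and> (\<forall>x\<in>S. x \<noteq> 0 \<longrightarrow> b' x x < 0) \<and> (\<forall>x\<in>T. b' x x \<ge> 0) \<and>
         dim S = (if h < 0 then m + 1 else m) \<and> DIM('a) \<le> dim S + dim T"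
    by (rule perturbed_simple_kernel[OF bilinear_second_derivative_Lt[OF V(2)]
          second_derivative_Lt_commute[OF V(2)] kernel v\<^sub>0]) blast
  obtain d\<^sub>1 where d\<^sub>1: "d\<^sub>1 > 0" "\<And>p. dist p (0, 0) < d\<^sub>1 \<Longrightarrow>
      \<forall>x y. \<bar>second_derivative (\<lambda>u. Lt u (snd p)) (fst p) x y - B 0 x y\<bar> \<le> e * (norm x * norm y)"
    using second_derivative_close[OF e] unfolding eventually_nhds_metric by (auto simp: case_prod_unfold)
  obtain d\<^sub>2 where d\<^sub>2: "d\<^sub>2 > 0" "\<And>\<mu>. \<bar>\<mu>\<bar> < d\<^sub>2 \<Longrightarrow> (0, \<mu>) \<in> V"
    "\<And>\<mu>. \<bar>\<mu>\<bar> < d\<^sub>2 \<Longrightarrow> \<exists>z. v\<^sub>0 \<bullet> z = 1 \<and> (\<forall>y. B \<mu> z y = deriv (\<lambda>a. g a \<mu>) 0 * (v\<^sub>0 \<bullet> y))"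
    by (rule reduced_problem) blast
  show thesis
  proof (rule that[of "min d\<^sub>1 d\<^sub>2" m])
    fix \<mu> assume \<mu>: "\<bar>\<mu>\<bar> < min d\<^sub>1 d\<^sub>2" and h: "deriv (\<lambda>a. g a \<mu>) 0 \<noteq> 0"
    then have V\<mu>: "(0, \<mu>) \<in> V" using d\<^sub>2(2) by simp
    obtain z where z: "v\<^sub>0 \<bullet> z = 1" "\<And>y. B \<mu> z y = deriv (\<lambda>a. g a \<mu>) 0 * (v\<^sub>0 \<bullet> y)"
      using d\<^sub>2(3)[of \<mu>] \<mu> by auto
    have "\<bar>B \<mu> x x - B 0 x x\<bar> \<le> e * (norm x)\<^sup>2" for x
      using d\<^sub>1(2)[of "(0, \<mu>)"] \<mu> by (simp add: dist_norm power2_eq_square)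
    from jump[OF bilinear_second_derivative_Lt[OF V\<mu>] second_derivative_Lt_commute[OF V\<mu>] this z h]
    show "(0, \<mu>) \<in> V \<and>
      (\<exists>S T. subspace S \<and> subspace T \<and> (\<forall>x\<in>S. x \<noteq> 0 \<longrightarrow> B \<mu> x x < 0) \<and> (\<forall>x\<in>T. B \<mu> x x \<ge> 0) \<and>
        dim S = (if deriv (\<lambda>a. g a \<mu>) 0 < 0 then m + 1 else m) \<and> DIM('a) \<le> dim S + dim T)"
      using V\<mu> by blast
  qed (use d\<^sub>1 d\<^sub>2 in simp)
qed

end

section \<open>The pitchfork bifurcation\<close>

text \<open>Bridges the iterated \<open>deriv\<close> of the hypotheses and the partial derivatives
  of the locale; oddness of g is the derivative of the evenness of \<phi>.\<close>

lemma odd_bifurcationI: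
  fixes g \<phi> :: "real \<Rightarrow> real \<Rightarrow> real"
  assumes d: "d > 0" and C3: "Ck_on (Suc (Suc (Suc 0))) (\<lambda>p. g (fst p) (snd p)) ({-d<..<d} \<times> {-d<..<d})"
    and \<phi>: "\<And>a \<mu>. \<bar>a\<bar> < d \<Longrightarrow> \<bar>\<mu>\<bar> < d \<Longrightarrow> ((\<lambda>a. \<phi> a \<mu>) has_real_derivative g a \<mu>) (at a)"
    and sym: "\<And>a \<mu>. \<bar>a\<bar> < d \<Longrightarrow> \<bar>\<mu>\<bar> < d \<Longrightarrow> \<phi> (- a) \<mu> = \<phi> a \<mu>"
    and g1_0: "deriv (\<lambda>a. g a 0) 0 = 0"
    and \<alpha>: "\<alpha> = deriv (\<lambda>\<mu>. deriv (\<lambda>a. g a \<mu>) 0) 0" "\<alpha> \<noteq> 0"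
    and \<beta>: "\<beta> = 1/6 * (deriv ^^ 3) (\<lambda>a. g a 0) 0" "(deriv ^^ 3) (\<lambda>a. g a 0) 0 \<noteq> 0"
  obtains g\<^sub>1 g\<^sub>2 g\<^sub>3 g\<^sub>m where "odd_bifurcation g g\<^sub>1 g\<^sub>2 g\<^sub>3 g\<^sub>m d \<alpha> \<beta>"
    "\<And>\<mu>. \<bar>\<mu>\<bar> < d \<Longrightarrow> deriv (\<lambda>a. g a \<mu>) 0 = g\<^sub>1 0 \<mu>"
proof -
  let ?W = "{-d<..<d} \<times> {-d<..<d}"
  define G where "G p = g (fst p) (snd p)" for p
  define G1 where "G1 p = frechet_derivative G (at p) (1, 0)" for p
  define G2 where "G2 p = frechet_derivative G1 (at p) (1, 0)" for p
  define G3 where "G3 p = frechet_derivative G2 (at p) (1, 0)" for p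
  define Gm where "Gm p = frechet_derivative G1 (at p) (0, 1)" for p
  have G: "Ck_on (Suc (Suc (Suc 0))) G ?W" using C3 by (simp add: G_def[abs_def] del: Ck_on.simps)
  have G1: "Ck_on (Suc (Suc 0)) G1 ?W"
    using G unfolding G1_def[abs_def] Ck_on.simps(2)[of "Suc (Suc 0)"] by blast
  have G2: "Ck_on (Suc 0) G2 ?W" and Gm: "Ck_on (Suc 0) Gm ?W"
    using G1 unfolding G2_def[abs_def] Gm_def[abs_def] Ck_on.simps(2)[of "Suc 0"] by blast+
  have G3: "Ck_on 0 G3 ?W"
    using G2 unfolding G3_def[abs_def] Ck_on.simps(2)[of 0] by blast
  have W: "open ?W" by (simp add: open_Times)
  have in_W: "(a, \<mu>) \<in> ?W" if "\<bar>a\<bar> < d" "\<bar>\<mu>\<bar> < d" for a \<mu> using that by auto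
  have horizontal: "((\<lambda>a. (a, \<mu>)) has_vector_derivative (1, 0)) (at a)"
    and vertical: "((\<lambda>\<mu>. (a, \<mu>)) has_vector_derivative (0, 1)) (at \<mu>)" for a \<mu> :: real
    by (auto intro!: derivative_eq_intros has_vector_derivative_Pair)
  have d1: "((\<lambda>a. g a \<mu>) has_real_derivative G1 (a, \<mu>)) (at a)" if "\<bar>a\<bar> < d" "\<bar>\<mu>\<bar> < d" for a \<mu>
    using Ck_on_has_field_derivative[where p = "\<lambda>a. (a, \<mu>)", OF G in_W[OF that] horizontal]
    by (simp add: G1_def) (simp add: G_def)
  have d2: "((\<lambda>a. G1 (a, \<mu>)) has_real_derivative G2 (a, \<mu>)) (at a)" if "\<bar>a\<bar> < d" "\<bar>\<mu>\<bar> < d" for a \<mu>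
    using Ck_on_has_field_derivative[where p = "\<lambda>a. (a, \<mu>)", OF G1 in_W[OF that] horizontal]
    by (simp add: G2_def)
  have d3: "((\<lambda>a. G2 (a, \<mu>)) has_real_derivative G3 (a, \<mu>)) (at a)" if "\<bar>a\<bar> < d" "\<bar>\<mu>\<bar> < d" for a \<mu>
    using Ck_on_has_field_derivative[where p = "\<lambda>a. (a, \<mu>)", OF G2 in_W[OF that] horizontal]
    by (simp add: G3_def)
  have dm: "((\<lambda>\<mu>. G1 (a, \<mu>)) has_real_derivative Gm (a, \<mu>)) (at \<mu>)" if "\<bar>a\<bar> < d" "\<bar>\<mu>\<bar> < d" for a \<mu>
    using Ck_on_has_field_derivative[where p = "\<lambda>\<mu>. (a, \<mu>)", OF G1 in_W[OF that] vertical]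
    by (simp add: Gm_def)
  have 0: "\<bar>0::real\<bar> < d" using d by simp
  have deriv1: "deriv (\<lambda>a. g a \<mu>) a = G1 (a, \<mu>)" if "\<bar>a\<bar> < d" "\<bar>\<mu>\<bar> < d" for a \<mu>
    by (rule DERIV_imp_deriv[OF d1[OF that]])
  \<comment> \<open>\<open>deriv\<close> at a point depends on nearby values, so each identity is
    proved on the whole interval before the next derivative is taken.\<close>
  have deriv2: "deriv (deriv (\<lambda>a. g a 0)) a = G2 (a, 0)" if "\<bar>a\<bar> < d" for a
    by (rule DERIV_imp_deriv, rule has_field_derivative_transform_within_open[OF d2[OF that 0], where S = "{-d<..<d}"])
      (use that deriv1 0 in auto)
  have deriv3: "deriv (deriv (deriv (\<lambda>a. g a 0))) 0 = G3 (0, 0)"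
    by (rule DERIV_imp_deriv, rule has_field_derivative_transform_within_open[OF d3[OF 0 0], where S = "{-d<..<d}"])
      (use 0 deriv2 in auto)
  have derivm: "deriv (\<lambda>\<mu>. deriv (\<lambda>a. g a \<mu>) 0) 0 = Gm (0, 0)"
    by (rule DERIV_imp_deriv, rule has_field_derivative_transform_within_open[OF dm[OF 0 0], where S = "{-d<..<d}"])
      (use 0 deriv1 in auto)
  have g_odd: "g (- a) \<mu> = - g a \<mu>" if "\<bar>a\<bar> < d" "\<bar>\<mu>\<bar> < d" for a \<mu>
  proof -
    have "((\<lambda>a. \<phi> a \<mu>) has_real_derivative g (- a) \<mu>) (at (- a))" using \<phi>[of "- a" \<mu>] that by simp
    then have "((\<lambda>a. \<phi> (- a) \<mu>) has_real_derivative - g (- a) \<mu>) (at a)" by (simp only: DERIV_mirror)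
    then have "((\<lambda>a. \<phi> a \<mu>) has_real_derivative - g (- a) \<mu>) (at a)"
      by (rule has_field_derivative_transform_within_open[where S = "{-d<..<d}"]) (use that sym in auto)
    from DERIV_unique[OF this \<phi>[OF that]] show ?thesis by simp
  qed
  have third: "(deriv ^^ 3) (\<lambda>a. g a 0) 0 = G3 (0, 0)"
    using deriv3 by (simp add: numeral_3_eq_3)
  show thesis
  proof (rule that)
    show "odd_bifurcation g (\<lambda>a \<mu>. G1 (a, \<mu>)) (\<lambda>a \<mu>. G2 (a, \<mu>)) (\<lambda>a \<mu>. G3 (a, \<mu>)) (\<lambda>a \<mu>. Gm (a, \<mu>)) d \<alpha> \<beta>"
    proof
      show "continuous_on ?W (\<lambda>(a, \<mu>). G1 (a, \<mu>))" "continuous_on ?W (\<lambda>(a, \<mu>). Gm (a, \<mu>))"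
        using Ck_on_imp_continuous_on[OF G1] Ck_on_imp_continuous_on[OF Gm] by simp_all
      show "isCont (\<lambda>(a, \<mu>). G3 (a, \<mu>)) (0, 0)"
        using continuous_on_open_imp_isCont[OF _ W in_W[OF 0 0], of G3] G3 by simp
      show "G1 (0, 0) = 0" using g1_0 deriv1[OF 0 0] by simp
      show "Gm (0, 0) = \<alpha>" using \<alpha> derivm by simp
      show "G3 (0, 0) = 6 * \<beta>" "\<beta> \<noteq> 0" using \<beta> third by simp_all
    qed (use d d1 d2 d3 dm g_odd \<alpha> in auto)
    show "deriv (\<lambda>a. g a \<mu>) 0 = G1 (0, \<mu>)" if "\<bar>\<mu>\<bar> < d" for \<mu> by (rule deriv1[OF 0 that])
  qed
qed

lemma min_of_deriv_sign:
  fixes f f' :: "real \<Rightarrow> real"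
  assumes "\<And>x. l < x \<Longrightarrow> x < r \<Longrightarrow> (f has_real_derivative f' x) (at x)"
    and "l < b" "b < r" "\<And>x. l < x \<Longrightarrow> x \<le> b \<Longrightarrow> f' x \<le> 0" "\<And>x. b \<le> x \<Longrightarrow> x < r \<Longrightarrow> f' x \<ge> 0"
    and "l < a" "a < r"
  shows "f b \<le> f a"
proof (cases "a \<le> b")
  case True
  show ?thesis
  proof (rule DERIV_nonpos_imp_nonincreasing[OF True])
    fix x assume "a \<le> x" "x \<le> b"
    then show "\<exists>y. (f has_real_derivative y) (at x) \<and> y \<le> 0"
      using assms by (intro exI[of _ "f' x"] conjI) auto
  qed
next
  case False
  then have "b \<le> a" by simp
  then show ?thesis
  proof (rule DERIV_nonneg_imp_nondecreasing)
    fix x assume "b \<le> x" "x \<le> a"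
    then show "\<exists>y. (f has_real_derivative y) (at x) \<and> y \<ge> 0"
      using assms by (intro exI[of _ "f' x"] conjI) auto
  qed
qed

section \<open>Transfer between the manifold and the straightened coordinates\<close>

text \<open>In the chart, f composed with \<open>\<Phi>\<close> is h composed with \<psi>, and at a
  critical point its second derivative is that of h with both arguments moved by D. Bijectivity of D
  then matches null spaces and preserves the dimensions of a splitting, and \<open>index_eqI\<close>
  converts the splitting into an index for the metric.\<close>

lemma (in riemannian_manifold) critical_pullback:
  fixes \<Phi> :: "'a \<Rightarrow> 'm"
  assumes c: "c \<in> A" and S: "open S" "u \<in> S" and \<Phi>: "\<And>y. y \<in> S \<Longrightarrow> \<Phi> y \<in> fst c"
    and \<Phi>_C2: "Ck_on (Suc (Suc 0)) (\<lambda>y. snd c (\<Phi> y)) S"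
    and D: "D = frechet_derivative (\<lambda>y. snd c (\<Phi> y)) (at u)" "bij D"
    and f: "Ck_on (Suc (Suc 0)) (f \<circ> chart_inv c) (chart_image c)" and crit: "riem_grad G c f (\<Phi> u) = 0"
  shows critical_pullback_derivative: "frechet_derivative (\<lambda>y. f (\<Phi> y)) (at u) v = 0"
    and critical_pullback_kernel: "{x. \<forall>y. second_derivative (\<lambda>y. f (\<Phi> y)) u x y = 0}
        = {x. riem_hess G c f (\<Phi> u) (D x) = 0}"
    and critical_pullback_index: "subspace N \<Longrightarrow> subspace P \<Longrightarrow>
        (\<And>x. x \<in> N \<Longrightarrow> x \<noteq> 0 \<Longrightarrow> second_derivative (\<lambda>y. f (\<Phi> y)) u x x < 0) \<Longrightarrow>
        (\<And>x. x \<in> P \<Longrightarrow> second_derivative (\<lambda>y. f (\<Phi> y)) u x x \<ge> 0) \<Longrightarrow>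
        DIM('a) \<le> dim N + dim P \<Longrightarrow> morse_index G c f (\<Phi> u) = dim N"
proof -
  define h where "h = f \<circ> chart_inv c"
  define \<psi> where "\<psi> y = snd c (\<Phi> y)" for y
  note chart' = chart_simps[OF c]
  have p: "\<Phi> u \<in> fst c" using \<Phi> S by blast
  have \<psi>_C2: "Ck_on (Suc (Suc 0)) \<psi> S" using \<Phi>_C2 by (simp add: \<psi>_def[abs_def] del: Ck_on.simps)
  have h: "Ck_on (Suc (Suc 0)) h (chart_image c)" using f by (simp only: h_def)
  have \<psi>_in: "\<psi> ` S \<subseteq> chart_image c" using \<Phi> chart' by (auto simp: \<psi>_def)
  have pull: "h (\<psi> y) = f (\<Phi> y)" if "y \<in> S" for y
    using chart'(2)[OF \<Phi>[OF that]] by (simp add: h_def \<psi>_def)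
  have h': "(h has_derivative frechet_derivative h (at (\<psi> u))) (at (\<psi> u))"
    using Ck_on_Suc_has_derivative[OF h] \<psi>_in S by blast
  have crit': "coord_deriv c f (\<Phi> u) \<xi> = 0" for \<xi>
    by (rule riem_grad_eq_0D[OF c p _ crit]) (use h' in \<open>auto simp: differentiable_def h_def \<psi>_def\<close>)
  then have crit_h: "frechet_derivative h (at (\<psi> u)) \<xi> = 0" for \<xi>
    by (simp add: coord_deriv_def h_def \<psi>_def)
  have D': "(\<psi> has_derivative D) (at u)"
    using Ck_on_Suc_has_derivative[OF \<psi>_C2 S(2)] by (simp add: D(1) \<psi>_def[abs_def])
  have linD: "linear D" by (rule has_derivative_linear[OF D'])
  have injD: "inj D" using D(2) by (rule bij_is_inj)
  have hp: "Ck_on (Suc (Suc 0)) (\<lambda>y. h (\<psi> y)) S" by (rule Ck_on_compose[OF S(1) h \<psi>_C2 \<psi>_in])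
  have fd_eq: "frechet_derivative (\<lambda>y. h (\<psi> y)) (at y) = frechet_derivative (\<lambda>y. f (\<Phi> y)) (at y)" if "y \<in> S" for y
    by (rule frechet_derivative_transform_within_open[OF _ S(1) that pull])
      (use Ck_on_Suc_has_derivative[OF hp that] in \<open>auto simp: differentiable_def\<close>)
  show "frechet_derivative (\<lambda>y. f (\<Phi> y)) (at u) v = 0"
    using frechet_derivative_at[OF has_derivative_compose[OF D' h'], symmetric] fd_eq[OF S(2)] by (simp add: crit_h)
  have second: "second_derivative (\<lambda>y. f (\<Phi> y)) u x y = second_derivative h (\<psi> u) (D x) (D y)" for x y
  proof -
    have "second_derivative (\<lambda>y. f (\<Phi> y)) u x y = second_derivative (\<lambda>y. h (\<psi> y)) u x y"
      by (rule second_derivative_eqI[OF S _ Ck_on_has_derivative_frechet[OF hp S(2)]]) (simp add: fd_eq)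
    also have "\<dots> = second_derivative h (\<psi> u) (D x) (D y)"
      using second_derivative_compose_critical[OF S h \<psi>_C2 \<psi>_in chart'(1) crit_h]
      by (simp add: D(1) \<psi>_def[abs_def])
    finally show ?thesis .
  qed
  have hess: "riem_hess G c f (\<Phi> u) \<xi> = 0 \<longleftrightarrow> (\<forall>\<eta>. second_derivative h (\<psi> u) \<xi> \<eta> = 0)" for \<xi>
    using riem_hess_eigen[OF c p f crit', of \<xi> 0] by (simp add: h_def \<psi>_def)
  \<comment> \<open>By surjectivity of D the vectors D y exhaust all test vectors.\<close>
  have "(\<forall>y. second_derivative h (\<psi> u) (D x) (D y) = 0) \<longleftrightarrow> (\<forall>\<eta>. second_derivative h (\<psi> u) (D x) \<eta> = 0)" for x
    using bij_is_surj[OF D(2)] by (metis surjD)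
  then show "{x. \<forall>y. second_derivative (\<lambda>y. f (\<Phi> y)) u x y = 0} = {x. riem_hess G c f (\<Phi> u) (D x) = 0}"
    by (simp add: second hess)
  assume N: "subspace N" "\<And>x. x \<in> N \<Longrightarrow> x \<noteq> 0 \<Longrightarrow> second_derivative (\<lambda>y. f (\<Phi> y)) u x x < 0"
    and P: "subspace P" "\<And>x. x \<in> P \<Longrightarrow> second_derivative (\<lambda>y. f (\<Phi> y)) u x x \<ge> 0"
    and dim: "DIM('a) \<le> dim N + dim P"
  interpret symmetric_form "G c (\<Phi> u)" "second_derivative h (\<psi> u)"
    using symmetric_form_hessian[OF c p f crit'] by (simp add: h_def \<psi>_def)
  have dim_D: "dim (D ` U) = dim U" for U
    by (rule dim_image_eq[OF linD]) (use injD in \<open>auto intro: inj_on_subset\<close>)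
  have "index = dim (D ` N)"
  proof (rule index_eqI)
    show "subspace (D ` N)" "subspace (D ` P)" using linear_subspace_image[OF linD] N(1) P(1) by auto
    show "second_derivative h (\<psi> u) x x < 0" if x: "x \<in> D ` N" "x \<noteq> 0" for x
    proof -
      obtain y where "y \<in> N" "x = D y" using x(1) by blast
      moreover have "y \<noteq> 0" using \<open>x = D y\<close> x(2) linear_0[OF linD] by auto
      ultimately show ?thesis using N(2)[of y] by (simp add: second)
    qed
    show "second_derivative h (\<psi> u) x x \<ge> 0" if "x \<in> D ` P" for x
      using that P(2) by (auto simp: second)
    show "DIM('a) \<le> dim (D ` N) + dim (D ` P)" using dim by (simp add: dim_D)
  qed
  moreover have "morse_index G c f (\<Phi> u) = index"
    using morse_index_eq_index[OF c p f crit'] by (simp add: h_def \<psi>_def)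
  ultimately show "morse_index G c f (\<Phi> u) = dim N" by (simp add: dim_D)
qed

theorem corollary5p4:
  fixes A :: "('m::{t2_space, second_countable_topology}, 'a::euclidean_space) chart set"
    and G :: "('m, 'a) chart \<Rightarrow> 'm \<Rightarrow> 'a \<Rightarrow> 'a \<Rightarrow> real"
    and L :: "'m \<Rightarrow> real \<Rightarrow> real" and \<theta>\<^sub>0 :: "real \<Rightarrow> 'm"
    and I :: "real set" and k :: nat and ls :: real
    and c :: "('m, 'a) chart" and V :: "('a \<times> real) set" and \<Psi> :: "'a \<Rightarrow> real \<Rightarrow> 'm"
    and v\<^sub>0 :: 'a and w :: "real \<Rightarrow> real \<Rightarrow> 'a"
    and Lt :: "'a \<Rightarrow> real \<Rightarrow> real" and \<phi> g :: "real \<Rightarrow> real \<Rightarrow> real" and \<alpha> \<beta> :: real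
  assumes manifold: "riemannian_manifold A G"
    and interval: "open I" "is_interval I" "{0..1} \<subseteq> I"
    and objective: "k \<ge> 4" "Ck_on_product A k L I"
    and branch: "smooth_curve_on A \<theta>\<^sub>0 I"
      "\<forall>l\<in>I. \<forall>d\<in>A. \<theta>\<^sub>0 l \<in> fst d \<longrightarrow> riem_grad G d (\<lambda>\<theta>. L \<theta> l) (\<theta>\<^sub>0 l) = 0"
    and parameter: "0 < ls" "ls < 1"
    and coordinates: "c \<in> A" "\<theta>\<^sub>0 ls \<in> fst c" "straightening c \<theta>\<^sub>0 I ls V \<Psi>"
    and degeneracy: "norm v\<^sub>0 = 1"
      "{\<xi>. riem_hess G c (\<lambda>\<theta>. L \<theta> ls) (\<theta>\<^sub>0 ls) \<xi> = 0}
         = span {frechet_derivative (\<lambda>u. snd c (\<Psi> u 0)) (at 0) v\<^sub>0}"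
    and Lt: "Lt = straightened_objective L ls \<Psi>"
    and reduction: "reduction_solution k Lt V v\<^sub>0 w"
    and \<phi>: "\<phi> = reduced_potential Lt v\<^sub>0 w"
    and g: "g = reduced_function Lt v\<^sub>0 w"
    and symmetry: "\<forall>\<^sub>F (a, \<mu>) in nhds (0, 0). \<phi> (- a) \<mu> = \<phi> a \<mu>"
    and \<alpha>: "\<alpha> = deriv (\<lambda>\<mu>. deriv (\<lambda>a. g a \<mu>) 0) 0" "\<alpha> \<noteq> 0"
    and \<beta>: "\<beta> = 1/6 * (deriv ^^ 3) (\<lambda>a. g a 0) 0" "(deriv ^^ 3) (\<lambda>a. g a 0) 0 \<noteq> 0"
  shows "(\<lambda>(a, \<mu>). g a \<mu> - a * (\<alpha> * \<mu> + \<beta> * a^2))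
           \<in> o[at (0, 0)](\<lambda>(a, \<mu>). \<bar>a\<bar> * (\<bar>\<mu>\<bar> + a^2))
       \<and> locally_equivalent g (\<lambda>a \<mu>. a * (\<alpha> * \<mu> + \<beta> * a^2))
       \<and> (\<exists>\<epsilon>>0. \<exists>\<delta>>0. \<exists>a\<^sub>p a\<^sub>m :: real \<Rightarrow> real.
            (\<forall>a \<mu>. \<bar>a\<bar> < \<delta> \<and> \<bar>\<mu>\<bar> < \<epsilon> \<longrightarrow>
               (g a \<mu> = 0 \<longleftrightarrow> a = 0 \<or> (- \<alpha> * \<mu> / \<beta> > 0 \<and> (a = a\<^sub>p \<mu> \<or> a = a\<^sub>m \<mu>))))
          \<and> (\<forall>\<mu>. \<bar>\<mu>\<bar> < \<epsilon> \<and> - \<alpha> * \<mu> / \<beta> > 0 \<longrightarrow>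
               0 < a\<^sub>p \<mu> \<and> a\<^sub>p \<mu> < \<delta> \<and> a\<^sub>m \<mu> = - a\<^sub>p \<mu>)
          \<and> continuous_on {\<mu>. \<bar>\<mu>\<bar> < \<epsilon> \<and> - \<alpha> * \<mu> / \<beta> > 0} a\<^sub>p
          \<and> continuous_on {\<mu>. \<bar>\<mu>\<bar> < \<epsilon> \<and> - \<alpha> * \<mu> / \<beta> > 0} a\<^sub>m
          \<and> (\<lambda>\<mu>. a\<^sub>p \<mu> - sqrt (- \<alpha> * \<mu> / \<beta>))
               \<in> o[at 0 within {\<mu>. - \<alpha> * \<mu> / \<beta> > 0}](\<lambda>\<mu>. \<bar>\<mu>\<bar> powr (1/2))
          \<and> (\<lambda>\<mu>. a\<^sub>m \<mu> + sqrt (- \<alpha> * \<mu> / \<beta>))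
               \<in> o[at 0 within {\<mu>. - \<alpha> * \<mu> / \<beta> > 0}](\<lambda>\<mu>. \<bar>\<mu>\<bar> powr (1/2))
          \<and> (pitchfork_expansion \<phi> \<alpha> \<beta> \<and> \<beta> > 0 \<longrightarrow>
               (\<forall>\<mu>. \<bar>\<mu>\<bar> < \<epsilon> \<and> - \<alpha> * \<mu> / \<beta> > 0 \<longrightarrow>
                  (\<forall>\<^sub>F a in nhds (a\<^sub>p \<mu>). \<phi> (a\<^sub>p \<mu>) \<mu> \<le> \<phi> a \<mu>)
                \<and> (\<forall>\<^sub>F a in nhds (a\<^sub>m \<mu>). \<phi> (a\<^sub>m \<mu>) \<mu> \<le> \<phi> a \<mu>))
             \<and> (\<exists>m. \<forall>\<mu>. 0 < \<bar>\<mu>\<bar> \<and> \<bar>\<mu>\<bar> < \<epsilon> \<longrightarrow>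
                  \<theta>\<^sub>0 (ls + \<mu>) \<in> fst c \<and>
                  morse_index G c (\<lambda>\<theta>. L \<theta> (ls + \<mu>)) (\<theta>\<^sub>0 (ls + \<mu>))
                    = (if \<alpha> * \<mu> < 0 then m + 1 else m))))"
proof -
  interpret riemannian_manifold A G by (rule manifold)
  have V: "open V" "(0, 0) \<in> V" and V_I: "\<And>u \<mu>. (u, \<mu>) \<in> V \<Longrightarrow> ls + \<mu> \<in> I \<and> \<Psi> u \<mu> \<in> fst c"
    and \<Psi>_smooth: "smooth_on (\<lambda>(u, \<mu>). snd c (\<Psi> u \<mu>)) V"
    and \<Psi>_bij: "\<And>u \<mu>. (u, \<mu>) \<in> V \<Longrightarrow> bij (frechet_derivative (\<lambda>u. snd c (\<Psi> u \<mu>)) (at u))"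
    and \<Psi>_branch: "\<And>\<mu>. (0, \<mu>) \<in> V \<Longrightarrow> \<Psi> 0 \<mu> = \<theta>\<^sub>0 (ls + \<mu>)"
    using coordinates(3) by (auto simp: straightening_def)
  note chart' = chart_simps[OF coordinates(1)]
  have Lt_eq: "Lt u \<mu> = L (\<Psi> u \<mu>) (ls + \<mu>)" for u \<mu> by (simp add: Lt straightened_objective_def)
  define \<psi> where "\<psi> p = snd c (\<Psi> (fst p) (snd p))" for p
  define Lc where "Lc p = L (chart_inv c (fst p)) (snd p)" for p
  have \<psi>_Ck: "Ck_on j \<psi> V" for j
    using \<Psi>_smooth by (simp add: smooth_on_def \<psi>_def[abs_def] case_prod_unfold)
  have Lc_Ck: "Ck_on k Lc (chart_image c \<times> I)"
    using objective(2) coordinates(1) by (simp add: Ck_on_product_def Lc_def[abs_def] case_prod_unfold)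
  \<comment> \<open>In the chart the straightened objective is the C^k objective composed with the
    smooth map (u, \<mu>) to (\<psi>(u, \<mu>), ls + \<mu>).\<close>
  have Lt_Ck: "Ck_on k (\<lambda>(u, \<mu>). Lt u \<mu>) V"
  proof (rule Ck_on_cong[OF V(1)])
    show "Ck_on k (\<lambda>p. Lc (\<psi> p, ls + snd p)) V"
    proof (rule Ck_on_compose[OF V(1) Lc_Ck])
      show "Ck_on k (\<lambda>p. (\<psi> p, ls + snd p)) V"
        by (intro Ck_on_Pair Ck_on_add Ck_on_const \<psi>_Ck V(1) Ck_on_bounded_linear bounded_linear_snd)
    qed (use V_I chart' in \<open>auto simp: \<psi>_def\<close>)
    show "Lc (\<psi> p, ls + snd p) = (case p of (u, \<mu>) \<Rightarrow> Lt u \<mu>)" if "p \<in> V" for p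
      using V_I[of "fst p" "snd p"] that chart'(2) by (auto simp: Lc_def \<psi>_def Lt_eq case_prod_unfold)
  qed
  have slice_C2: "Ck_on (Suc (Suc 0)) ((\<lambda>\<theta>. L \<theta> l) \<circ> chart_inv c) (chart_image c)" if "l \<in> I" for l
  proof -
    have "Ck_on (Suc (Suc 0)) (\<lambda>x. Lc (x, l)) (chart_image c)"
    proof (rule Ck_on_compose[OF chart'(1), where f = Lc and h = "\<lambda>x. (x, l)"])
      show "Ck_on (Suc (Suc 0)) Lc (chart_image c \<times> I)" using objective(1) by (intro Ck_on_le[OF Lc_Ck]) simp
      show "Ck_on (Suc (Suc 0)) (\<lambda>x. (x, l)) (chart_image c)"
        by (intro Ck_on_Pair Ck_on_const Ck_on_bounded_linear bounded_linear_ident chart'(1))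
    qed (use that in auto)
    then show ?thesis by (simp add: Lc_def o_def del: Ck_on.simps)
  qed
  have \<Psi>_C2: "Ck_on (Suc (Suc 0)) (\<lambda>u. snd c (\<Psi> u \<mu>)) {u. (u, \<mu>) \<in> V}" for \<mu>
  proof -
    have "Ck_on (Suc (Suc 0)) (\<lambda>u. \<psi> (u, \<mu>)) {u. (u, \<mu>) \<in> V}"
    proof (rule Ck_on_compose[OF open_slice[OF V(1)] \<psi>_Ck])
      show "Ck_on (Suc (Suc 0)) (\<lambda>u. (u, \<mu>)) {u. (u, \<mu>) \<in> V}"
        by (intro Ck_on_Pair Ck_on_const Ck_on_bounded_linear bounded_linear_ident open_slice V(1))
    qed auto
    then show ?thesis by (simp add: \<psi>_def del: Ck_on.simps)
  qed
  have grad: "riem_grad G c (\<lambda>\<theta>. L \<theta> (ls + \<mu>)) (\<Psi> 0 \<mu>) = 0" if "(0, \<mu>) \<in> V" for \<mu>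
    using branch(2) V_I[OF that] \<Psi>_branch[OF that] coordinates(1) by auto
  note pullback = critical_pullback[OF coordinates(1) open_slice[OF V(1)] _ _ \<Psi>_C2 refl \<Psi>_bij slice_C2 grad]
  have pb_derivative: "frechet_derivative (\<lambda>u. Lt u \<mu>) (at 0) y = 0" if "(0, \<mu>) \<in> V" for \<mu> y
    unfolding Lt_eq by (rule pullback(1)) (use that V_I in auto)
  let ?D = "frechet_derivative (\<lambda>u. snd c (\<Psi> u 0)) (at 0)"
  have "{x. \<forall>y. second_derivative (\<lambda>u. Lt u 0) 0 x y = 0}
      = {x. riem_hess G c (\<lambda>\<theta>. L \<theta> (ls + 0)) (\<Psi> 0 0) (?D x) = 0}"
    unfolding Lt_eq by (rule pullback(2)) (use V(2) V_I V_I[OF V(2)] in auto)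
  also have "\<dots> = {x. ?D x \<in> span {?D v\<^sub>0}}"
    using degeneracy(2) \<Psi>_branch[OF V(2)] by auto
  also have "\<dots> = span {v\<^sub>0}"
  proof -
    have "linear ?D"
      using Ck_on_Suc_has_derivative[OF \<Psi>_C2[of 0], of 0] V(2) by (auto intro: has_derivative_linear)
    then have "?D (r *\<^sub>R v\<^sub>0) = r *\<^sub>R ?D v\<^sub>0" for r by (rule linear_cmul)
    \<comment> \<open>Linearity and injectivity of the identification reduce membership of D x in
      the line of D \<open>v\<^sub>0\<close> to membership of x in the line of
      \<open>v\<^sub>0\<close>.\<close>
    then have "?D x \<in> span {?D v\<^sub>0} \<longleftrightarrow> (\<exists>r. ?D x = ?D (r *\<^sub>R v\<^sub>0))" for x by (auto simp: span_singleton)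
    then show ?thesis
      using bij_is_inj[OF \<Psi>_bij[OF V(2)]] by (auto simp: span_singleton inj_eq)
  qed
  finally have kernel: "{x. \<forall>y. second_derivative (\<lambda>u. Lt u 0) 0 x y = 0} = span {v\<^sub>0}" .
  interpret LS: lyapunov_schmidt k Lt V v\<^sub>0 w
    by unfold_locales (use objective(1) V Lt_Ck degeneracy(1) reduction pb_derivative kernel in auto)
  obtain d\<^sub>1 where d\<^sub>1: "d\<^sub>1 > 0" "\<And>\<mu>. \<bar>\<mu>\<bar> < d\<^sub>1 \<Longrightarrow> (0, \<mu>) \<in> V"
    "Ck_on (Suc (Suc (Suc 0))) (\<lambda>p. g (fst p) (snd p)) ({-d\<^sub>1<..<d\<^sub>1} \<times> {-d\<^sub>1<..<d\<^sub>1})"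
    "\<And>a \<mu>. \<bar>a\<bar> < d\<^sub>1 \<Longrightarrow> \<bar>\<mu>\<bar> < d\<^sub>1 \<Longrightarrow> ((\<lambda>a. \<phi> a \<mu>) has_real_derivative g a \<mu>) (at a)"
    by (rule LS.reduced_problem[folded \<phi> g]) blast
  obtain U where U: "open U" "(0, 0) \<in> U" "\<And>a \<mu>. (a, \<mu>) \<in> U \<Longrightarrow> \<phi> (- a) \<mu> = \<phi> a \<mu>"
    using symmetry unfolding eventually_nhds by auto
  obtain d\<^sub>2 where d\<^sub>2: "d\<^sub>2 > 0" "{-d\<^sub>2<..<d\<^sub>2} \<times> {-d\<^sub>2<..<d\<^sub>2} \<subseteq> U"
    using open_contains_box[OF U(1,2)] by blast
  define d where "d = min d\<^sub>1 d\<^sub>2"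
  have d: "d > 0" "d \<le> d\<^sub>1" "d \<le> d\<^sub>2" using d\<^sub>1 d\<^sub>2 by (auto simp: d_def)
  have \<phi>_deriv: "((\<lambda>a. \<phi> a \<mu>) has_real_derivative g a \<mu>) (at a)" if "\<bar>a\<bar> < d" "\<bar>\<mu>\<bar> < d" for a \<mu>
    using d\<^sub>1(4) that d by simp
  have \<phi>_even: "\<phi> (- a) \<mu> = \<phi> a \<mu>" if "\<bar>a\<bar> < d" "\<bar>\<mu>\<bar> < d" for a \<mu>
    by (rule U(3), rule subsetD[OF d\<^sub>2(2)]) (use that d in auto)
  have g_C3: "Ck_on (Suc (Suc (Suc 0))) (\<lambda>p. g (fst p) (snd p)) ({-d<..<d} \<times> {-d<..<d})"
    by (rule Ck_on_subset[OF d\<^sub>1(3)]) (use d in auto)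
  obtain g\<^sub>1 g\<^sub>2 g\<^sub>3 g\<^sub>m where odd: "odd_bifurcation g g\<^sub>1 g\<^sub>2 g\<^sub>3 g\<^sub>m d \<alpha> \<beta>"
    and g\<^sub>1: "\<And>\<mu>. \<bar>\<mu>\<bar> < d \<Longrightarrow> deriv (\<lambda>a. g a \<mu>) 0 = g\<^sub>1 0 \<mu>"
    by (rule odd_bifurcationI[OF d(1) g_C3 \<phi>_deriv \<phi>_even _ \<alpha> \<beta>])
      (use LS.deriv_reduced_function_origin in \<open>simp_all add: g\<close>)
  interpret P: odd_bifurcation g g\<^sub>1 g\<^sub>2 g\<^sub>3 g\<^sub>m d \<alpha> \<beta> by (rule odd)
  obtain \<epsilon>\<^sub>1 \<delta> b where \<epsilon>\<^sub>1: "0 < \<epsilon>\<^sub>1" "\<epsilon>\<^sub>1 \<le> d" and \<delta>: "0 < \<delta>" "\<delta> \<le> d"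
    and zeros: "\<And>a \<mu>. \<bar>a\<bar> < \<delta> \<Longrightarrow> \<bar>\<mu>\<bar> < \<epsilon>\<^sub>1 \<Longrightarrow>
       g a \<mu> = 0 \<longleftrightarrow> a = 0 \<or> - \<alpha> * \<mu> / \<beta> > 0 \<and> (a = b \<mu> \<or> a = - b \<mu>)"
    and b_bd: "\<And>\<mu>. \<bar>\<mu>\<bar> < \<epsilon>\<^sub>1 \<Longrightarrow> - \<alpha> * \<mu> / \<beta> > 0 \<Longrightarrow> 0 < b \<mu> \<and> b \<mu> < \<delta>"
    and b_cont: "continuous_on {\<mu>. \<bar>\<mu>\<bar> < \<epsilon>\<^sub>1 \<and> - \<alpha> * \<mu> / \<beta> > 0} b"
    and b_small: "(\<lambda>\<mu>. b \<mu> - sqrt (- \<alpha> * \<mu> / \<beta>)) \<in> o[at 0 within {\<mu>. - \<alpha> * \<mu> / \<beta> > 0}](\<lambda>\<mu>. \<bar>\<mu>\<bar> powr (1/2))"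
    and below: "\<And>a \<mu>. \<bar>\<mu>\<bar> < \<epsilon>\<^sub>1 \<Longrightarrow> - \<alpha> * \<mu> / \<beta> > 0 \<Longrightarrow> 0 < a \<Longrightarrow> a < b \<mu> \<Longrightarrow> \<beta> * g a \<mu> < 0"
    and above: "\<And>a \<mu>. \<bar>\<mu>\<bar> < \<epsilon>\<^sub>1 \<Longrightarrow> - \<alpha> * \<mu> / \<beta> > 0 \<Longrightarrow> b \<mu> < a \<Longrightarrow> a < \<delta> \<Longrightarrow> \<beta> * g a \<mu> > 0"
    by (rule P.branches) blast
  obtain m d\<^sub>3 where d\<^sub>3: "d\<^sub>3 > 0" and jump: "\<And>\<mu>. \<bar>\<mu>\<bar> < d\<^sub>3 \<Longrightarrow> deriv (\<lambda>a. g a \<mu>) 0 \<noteq> 0 \<Longrightarrow> (0, \<mu>) \<in> V \<and>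
      (\<exists>S T. subspace S \<and> subspace T \<and> (\<forall>x\<in>S. x \<noteq> 0 \<longrightarrow> second_derivative (\<lambda>u. Lt u \<mu>) 0 x x < 0) \<and>
        (\<forall>x\<in>T. second_derivative (\<lambda>u. Lt u \<mu>) 0 x x \<ge> 0) \<and>
        dim S = (if deriv (\<lambda>a. g a \<mu>) 0 < 0 then m + 1 else m) \<and> DIM('a) \<le> dim S + dim T)"
    by (rule LS.index_jump[folded g]) blast
  have "(g\<^sub>1 0 has_derivative times \<alpha>) (at 0)"
    using P.gm[of 0 0] d(1) P.gm_0 by (simp add: has_field_derivative_def)
  \<comment> \<open>The tolerance |\<alpha>| / 2 makes \<open>g\<^sub>1 0 \<mu>\<close> nonzero with
    the sign of \<alpha> \<mu>, which decides the case in the index formula.\<close>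
  then obtain d\<^sub>4 where d\<^sub>4: "d\<^sub>4 > 0" "\<And>\<mu>. \<bar>\<mu>\<bar> < d\<^sub>4 \<Longrightarrow> \<bar>g\<^sub>1 0 \<mu> - \<alpha> * \<mu>\<bar> \<le> \<bar>\<alpha>\<bar> / 2 * \<bar>\<mu>\<bar>"
    using \<alpha>(2) P.g1_0 unfolding has_derivative_at_alt by (force dest: spec[of _ "\<bar>\<alpha>\<bar> / 2"])
  define \<epsilon> where "\<epsilon> = min \<epsilon>\<^sub>1 (min d\<^sub>3 d\<^sub>4)"
  have \<epsilon>: "\<epsilon> > 0" "\<epsilon> \<le> \<epsilon>\<^sub>1" "\<epsilon> \<le> d\<^sub>3" "\<epsilon> \<le> d\<^sub>4" using \<epsilon>\<^sub>1 d\<^sub>3 d\<^sub>4 by (auto simp: \<epsilon>_def)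
  have minimum: "\<phi> (b \<mu>) \<mu> \<le> \<phi> a \<mu>"
    if \<mu>: "\<bar>\<mu>\<bar> < \<epsilon>" "- \<alpha> * \<mu> / \<beta> > 0" and "\<beta> > 0" and a: "0 < a" "a < \<delta>" for a \<mu>
  proof -
    have \<mu>1: "\<bar>\<mu>\<bar> < \<epsilon>\<^sub>1" using \<mu>(1) \<epsilon> by simp
    note b = b_bd[OF \<mu>1 \<mu>(2)]
    have gb: "g (b \<mu>) \<mu> = 0" using zeros[of "b \<mu>" \<mu>] b \<mu>1 \<mu>(2) by simp
    show ?thesis
    proof (rule min_of_deriv_sign[where f = "\<lambda>a. \<phi> a \<mu>" and f' = "\<lambda>a. g a \<mu>" and l = 0 and r = \<delta>])
      show "((\<lambda>a. \<phi> a \<mu>) has_real_derivative g x \<mu>) (at x)" if "0 < x" "x < \<delta>" for x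
        using that \<delta> \<mu>1 \<epsilon>\<^sub>1 by (intro \<phi>_deriv) auto
      show "g x \<mu> \<le> 0" if "0 < x" "x \<le> b \<mu>" for x
        using below[OF \<mu>1 \<mu>(2), of x] that gb \<open>\<beta> > 0\<close> by (cases "x = b \<mu>") (auto simp: mult_less_0_iff)
      show "g x \<mu> \<ge> 0" if "b \<mu> \<le> x" "x < \<delta>" for x
        using above[OF \<mu>1 \<mu>(2), of x] that gb \<open>\<beta> > 0\<close> by (cases "x = b \<mu>") (auto simp: zero_less_mult_iff)
    qed (use b a in auto)
  qed
  have minima: "(\<forall>\<^sub>F a in nhds (b \<mu>). \<phi> (b \<mu>) \<mu> \<le> \<phi> a \<mu>) \<and> (\<forall>\<^sub>F a in nhds (- b \<mu>). \<phi> (- b \<mu>) \<mu> \<le> \<phi> a \<mu>)"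
    if \<mu>: "\<bar>\<mu>\<bar> < \<epsilon>" "- \<alpha> * \<mu> / \<beta> > 0" and "\<beta> > 0" for \<mu>
  proof
    have \<mu>1: "\<bar>\<mu>\<bar> < \<epsilon>\<^sub>1" using \<mu>(1) \<epsilon> by simp
    note b = b_bd[OF \<mu>1 \<mu>(2)]
    have "\<forall>\<^sub>F a in nhds (b \<mu>). a \<in> {0<..<\<delta>}" by (rule eventually_nhds_in_open) (use b in auto)
    then show "\<forall>\<^sub>F a in nhds (b \<mu>). \<phi> (b \<mu>) \<mu> \<le> \<phi> a \<mu>"
      by (rule eventually_mono) (use minimum[OF that] in auto)
    \<comment> \<open>The minimum at - b is the mirror image of the one at b, by evenness of
      \<phi>.\<close>
    have "\<forall>\<^sub>F a in nhds (- b \<mu>). a \<in> {-\<delta><..<0}" by (rule eventually_nhds_in_open) (use b in auto)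
    then show "\<forall>\<^sub>F a in nhds (- b \<mu>). \<phi> (- b \<mu>) \<mu> \<le> \<phi> a \<mu>"
    proof (rule eventually_mono)
      fix a assume "a \<in> {-\<delta><..<0}"
      then have "\<phi> (b \<mu>) \<mu> \<le> \<phi> (- a) \<mu>" using minimum[OF that, of "- a"] by simp
      moreover have "\<phi> (- a) \<mu> = \<phi> a \<mu>" using \<open>a \<in> {-\<delta><..<0}\<close> \<delta> \<mu>1 \<epsilon>\<^sub>1 by (intro \<phi>_even) auto
      moreover have "\<phi> (- b \<mu>) \<mu> = \<phi> (b \<mu>) \<mu>" using b \<delta> \<mu>1 \<epsilon>\<^sub>1 by (intro \<phi>_even) auto
      ultimately show "\<phi> (- b \<mu>) \<mu> \<le> \<phi> a \<mu>" by simp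
    qed
  qed
  have morse: "\<theta>\<^sub>0 (ls + \<mu>) \<in> fst c \<and>
      morse_index G c (\<lambda>\<theta>. L \<theta> (ls + \<mu>)) (\<theta>\<^sub>0 (ls + \<mu>)) = (if \<alpha> * \<mu> < 0 then m + 1 else m)"
    if \<mu>: "0 < \<bar>\<mu>\<bar>" "\<bar>\<mu>\<bar> < \<epsilon>" for \<mu>
  proof -
    have h: "deriv (\<lambda>a. g a \<mu>) 0 = g\<^sub>1 0 \<mu>" using g\<^sub>1[of \<mu>] \<mu> \<epsilon> \<epsilon>\<^sub>1 by simp
    have "\<bar>g\<^sub>1 0 \<mu> - \<alpha> * \<mu>\<bar> \<le> \<bar>\<alpha> * \<mu>\<bar> / 2" using d\<^sub>4(2)[of \<mu>] \<mu> \<epsilon> by (simp add: abs_mult)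
    moreover have "\<alpha> * \<mu> \<noteq> 0" using \<mu> \<alpha>(2) by simp
    ultimately have sign: "g\<^sub>1 0 \<mu> \<noteq> 0" "g\<^sub>1 0 \<mu> < 0 \<longleftrightarrow> \<alpha> * \<mu> < 0" by linarith+
    obtain N T where V\<mu>: "(0, \<mu>) \<in> V" and NT: "subspace N" "subspace T"
      "\<And>x. x \<in> N \<Longrightarrow> x \<noteq> 0 \<Longrightarrow> second_derivative (\<lambda>u. Lt u \<mu>) 0 x x < 0"
      "\<And>x. x \<in> T \<Longrightarrow> second_derivative (\<lambda>u. Lt u \<mu>) 0 x x \<ge> 0"
      and dimN: "dim N = (if \<alpha> * \<mu> < 0 then m + 1 else m)" and dim: "DIM('a) \<le> dim N + dim T"
      using jump[of \<mu>] \<mu> \<epsilon> h sign by auto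
    have "morse_index G c (\<lambda>\<theta>. L \<theta> (ls + \<mu>)) (\<Psi> 0 \<mu>) = dim N"
      by (rule pullback(3)[where P = T]) (use V\<mu> V_I NT dim in \<open>auto simp: Lt_eq\<close>)
    then show ?thesis using V_I[OF V\<mu>] \<Psi>_branch[OF V\<mu>] dimN by simp
  qed
  have cont: "continuous_on {\<mu>. \<bar>\<mu>\<bar> < \<epsilon> \<and> - \<alpha> * \<mu> / \<beta> > 0} b"
    by (rule continuous_on_subset[OF b_cont]) (use \<epsilon> in auto)
  have "(\<lambda>\<mu>. - (b \<mu> - sqrt (- \<alpha> * \<mu> / \<beta>))) \<in> o[at 0 within {\<mu>. - \<alpha> * \<mu> / \<beta> > 0}](\<lambda>\<mu>. \<bar>\<mu>\<bar> powr (1/2))"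
    using b_small by (simp only: landau_o.small.uminus_in_iff)
  then have small': "(\<lambda>\<mu>. - b \<mu> + sqrt (- \<alpha> * \<mu> / \<beta>)) \<in> o[at 0 within {\<mu>. - \<alpha> * \<mu> / \<beta> > 0}](\<lambda>\<mu>. \<bar>\<mu>\<bar> powr (1/2))"
    by simp
  show ?thesis
  proof (intro conjI P.leading_terms P.equivalent_to_pitchfork,
      rule exI[of _ \<epsilon>], rule conjI[OF \<epsilon>(1)], rule exI[of _ \<delta>], rule conjI[OF \<delta>(1)],
      rule exI[of _ b], rule exI[of _ "\<lambda>\<mu>. - b \<mu>"],
      intro conjI cont continuous_on_minus b_small small')
    show "\<forall>a \<mu>. \<bar>a\<bar> < \<delta> \<and> \<bar>\<mu>\<bar> < \<epsilon> \<longrightarrow>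
        (g a \<mu> = 0 \<longleftrightarrow> a = 0 \<or> (- \<alpha> * \<mu> / \<beta> > 0 \<and> (a = b \<mu> \<or> a = - b \<mu>)))"
      using zeros \<epsilon>(2) by (metis less_le_trans)
    show "\<forall>\<mu>. \<bar>\<mu>\<bar> < \<epsilon> \<and> - \<alpha> * \<mu> / \<beta> > 0 \<longrightarrow> 0 < b \<mu> \<and> b \<mu> < \<delta> \<and> - b \<mu> = - b \<mu>"
      using b_bd \<epsilon>(2) by (metis less_le_trans)
    show "pitchfork_expansion \<phi> \<alpha> \<beta> \<and> \<beta> > 0 \<longrightarrow>
        (\<forall>\<mu>. \<bar>\<mu>\<bar> < \<epsilon> \<and> - \<alpha> * \<mu> / \<beta> > 0 \<longrightarrow>
           (\<forall>\<^sub>F a in nhds (b \<mu>). \<phi> (b \<mu>) \<mu> \<le> \<phi> a \<mu>) \<and> (\<forall>\<^sub>F a in nhds (- b \<mu>). \<phi> (- b \<mu>) \<mu> \<le> \<phi> a \<mu>))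
        \<and> (\<exists>m. \<forall>\<mu>. 0 < \<bar>\<mu>\<bar> \<and> \<bar>\<mu>\<bar> < \<epsilon> \<longrightarrow> \<theta>\<^sub>0 (ls + \<mu>) \<in> fst c \<and>
            morse_index G c (\<lambda>\<theta>. L \<theta> (ls + \<mu>)) (\<theta>\<^sub>0 (ls + \<mu>)) = (if \<alpha> * \<mu> < 0 then m + 1 else m))"
      using minima morse by blast
  qed
qed

end
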